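(* Suppose there are constants $a_0,b_0>0$, $0<\gamma_0<\frac12$ and $0<p=p(n)<1$ such that $$a_0np\le \sum_{v\in\mathcal S,\,v\ne u}p(u,v)\le\sum_{v\neq u}p(u,v)\le b_0np$$ for all vertices $u$ and all sets $\mathcal S\subseteq\{1,\dots,n\}$ containing at least $\gamma_0n$ vertices, and in addition: (I) There is a constant $B>0$ such that $\mathbb E r^2(x,X_1)\le B$ for all $x\in\Omega_{mk}$ and $\mathbb EW^s(h)\le B$ for some $s\ge2$. (II) There are constants $c_1,c_2>0$ such that $F(x)\ge c_1F^{(ct)}(c_2x)$ for all $x>0$. Then for every $\gamma>0$ there is a constant $\lambda>0$ such that if $p\ge\frac{\lambda\log n}{n}$ and $p=o(1)$, then $$\mathbb P\left(E_{con}\cap\left\{\lambda^{-1}n\zeta_n\le\tau_n\le\lambda n\varphi_n\right\}\right)\ge1-\lambda p$$ and $$\lambda^{-1}n\zeta_n\le\mathbb E\tau_n\le\lambda n\varphi_n+\frac1{n^{1+\gamma}}\quad\text{and}\quad\mathrm{var}(\tau_n)\le\lambda n^2p\,\varphi_n^2+\frac1{n^{1+\gamma}},$$ where $$\zeta_n=\zeta_n(\lambda):=H\left(\frac1{\lambda np}\right)\quad\text{and}\quad\varphi_n=\varphi_n(\lambda):=H\left(\frac{\lambda\log n}{np}\right).$$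
   Context: For each integer $n\ge2$ let $K_n$ be the complete graph on $\{1,\dots,n\}$; edges $h=(u,v)$ are undirected. Let $\{Z(h)\}_{h\in K_n}$ be independent Bernoulli random variables with $\mathbb P(Z(h)=1)=p(h)=1-\mathbb P(Z(h)=0)$, $0<p(h)<1$; write $p(h)=p(u,v)=p(v,u)$. The random graph $G$ has vertex set $\{1,\dots,n\}$ and edge set $\{h:Z(h)=1\}$; $E_{con}$ is the event that $G$ is connected. Each edge $h$ has a positive random weight $W(h)=W(u,v)$, the weights being i.i.d.; each vertex $u$ has a random mark $X_u$, the marks $X_1,\dots,X_n$ being i.i.d. with values in a (measurable) set $\Omega_{mk}$. The families $\{Z(h)\}$, $\{W(h)\}$, $\{X_u\}$ are mutually independent. For a deterministic symmetric measurable function $r:\Omega_{mk}\times\Omega_{mk}\to(0,\infty)$, the cost of $h=(u,v)$ is $c(h)=c(u,v)=r(X_u,X_v)\,W(u,v)$. The edge weight cdf is $F(x)=\mathbb P(W(h)\le x)$ and the edge cost cdf is $F^{(ct)}(x)=\mathbb P(c(h)\le x)$, $x>0$. The inverse edge weight cdf is $H(z)=\sup\{x>0:F(x)\le z\}$ for $0\le z\le1$ (possibly $+\infty$). The cost of a tree is the sum of the costs of its edges. $\tau_n$ is the minimum cost of a spanning tree of the largest component of $G$ (ties between largest components broken by any fixed rule). The edge probabilities, the law of the marks and $r$ may depend on $n$; the law of the weights does not. "Constants" do not depend on $n$. *)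

theory Defs
  imports "HOL-Probability.Probability"
begin

section \<open>Finite simple graphs\<close>

text \<open>An undirected edge joining \<open>u \<noteq> v\<close> is the two-element set \<open>{u, v}\<close>.  The notions of tree and
  forest in the AFP entry Graph_Theory concern directed cycles and do not apply here.\<close>

definition complete_edges :: "nat \<Rightarrow> nat set set" where
  "complete_edges n = {{u, v} |u v. u \<in> {1..n} \<and> v \<in> {1..n} \<and> u \<noteq> v}"

definition joined :: "nat set set \<Rightarrow> nat \<Rightarrow> nat \<Rightarrow> bool" where
  "joined E u v \<longleftrightarrow> (u, v) \<in> {(a, b). {a, b} \<in> E}\<^sup>*"

definition connected_graph :: "nat set \<Rightarrow> nat set set \<Rightarrow> bool" where
  "connected_graph V E \<longleftrightarrow> (\<forall>u\<in>V. \<forall>v\<in>V. joined E u v)"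

definition components :: "nat set \<Rightarrow> nat set set \<Rightarrow> nat set set" where
  "components V E = (\<lambda>u. {v \<in> V. joined E u v}) ` V"

definition largest_components :: "nat set \<Rightarrow> nat set set \<Rightarrow> nat set set" where
  "largest_components V E =
     {C \<in> components V E. \<forall>D \<in> components V E. card D \<le> card C}"

definition graph_cycle :: "nat set set \<Rightarrow> nat list \<Rightarrow> bool" where
  "graph_cycle E xs \<longleftrightarrow> 3 \<le> length xs \<and> distinct xs \<and>
     (\<forall>i < length xs. {xs ! i, xs ! (Suc i mod length xs)} \<in> E)"

text \<open>\<open>(C, T)\<close> is a tree all of whose edges are edges of the graph with edge set \<open>E\<close>.\<close>

definition spanning_tree_of :: "nat set \<Rightarrow> nat set set \<Rightarrow> nat set set \<Rightarrow> bool" where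
  "spanning_tree_of C E T \<longleftrightarrow>
     T \<subseteq> E \<and> (\<forall>h\<in>T. h \<subseteq> C) \<and> connected_graph C T \<and> \<not> (\<exists>xs. graph_cycle T xs)"

text \<open>A deterministic rule that singles out one of the largest components of every graph
  on \<open>{1..n}\<close>, given by its edge set.\<close>

definition largest_component_rule :: "nat \<Rightarrow> (nat set set \<Rightarrow> nat set) \<Rightarrow> bool" where
  "largest_component_rule n pick \<longleftrightarrow>
     (\<forall>E. E \<subseteq> complete_edges n \<longrightarrow> pick E \<in> largest_components {1..n} E)"


section \<open>The random graph with random edge costs\<close>

definition random_edges :: "nat \<Rightarrow> (nat set \<Rightarrow> 'w \<Rightarrow> bool) \<Rightarrow> 'w \<Rightarrow> nat set set" where
  "random_edges n Z \<omega> = {h \<in> complete_edges n. Z h \<omega>}"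

text \<open>The endpoints of \<open>h = {u, v}\<close> are \<open>Min h\<close> and \<open>Max h\<close>; since \<open>r\<close> is symmetric, their order
  does not matter.\<close>

definition edge_cost ::
  "('m \<Rightarrow> 'm \<Rightarrow> real) \<Rightarrow> (nat \<Rightarrow> 'w \<Rightarrow> 'm) \<Rightarrow> (nat set \<Rightarrow> 'w \<Rightarrow> real) \<Rightarrow> nat set \<Rightarrow> 'w \<Rightarrow> real" where
  "edge_cost r X W h \<omega> = r (X (Min h) \<omega>) (X (Max h) \<omega>) * W h \<omega>"

definition mst_cost ::
  "nat \<Rightarrow> (nat set set \<Rightarrow> nat set) \<Rightarrow> ('m \<Rightarrow> 'm \<Rightarrow> real) \<Rightarrow> (nat set \<Rightarrow> 'w \<Rightarrow> bool) \<Rightarrow>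
   (nat set \<Rightarrow> 'w \<Rightarrow> real) \<Rightarrow> (nat \<Rightarrow> 'w \<Rightarrow> 'm) \<Rightarrow> 'w \<Rightarrow> real" where
  "mst_cost n pick r Z W X \<omega> =
     Min ((\<lambda>T. \<Sum>h\<in>T. edge_cost r X W h \<omega>) `
       {T. spanning_tree_of (pick (random_edges n Z \<omega>)) (random_edges n Z \<omega>) T})"

text \<open>The supremum is taken in the extended nonnegative reals: it is \<open>\<infinity>\<close> when the set is unbounded
  and \<open>0\<close> when it is empty.\<close>

definition inv_cdf :: "real measure \<Rightarrow> real \<Rightarrow> ennreal" where
  "inv_cdf L z = (SUP x \<in> {x. 0 < x \<and> cdf L x \<le> z}. ennreal x)"

datatype source = EdgeState "nat set" | EdgeWeight "nat set" | Mark nat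

locale weighted_random_graph = prob_space M
  for M :: "'w measure" +
  fixes n :: nat
    and q :: "nat set \<Rightarrow> real"  \<comment> \<open>edge probabilities\<close>
    and L :: "real measure"     \<comment> \<open>law of the edge weights\<close>
    and S :: "'m measure"       \<comment> \<open>mark space\<close>
    and r :: "'m \<Rightarrow> 'm \<Rightarrow> real"
    and Z :: "nat set \<Rightarrow> 'w \<Rightarrow> bool"
    and W :: "nat set \<Rightarrow> 'w \<Rightarrow> real"
    and X :: "nat \<Rightarrow> 'w \<Rightarrow> 'm"
  assumes state_measurable:
      "h \<in> complete_edges n \<Longrightarrow> Z h \<in> M \<rightarrow>\<^sub>M count_space UNIV"
    and state_prob:
      "h \<in> complete_edges n \<Longrightarrow> prob {\<omega> \<in> space M. Z h \<omega>} = q h"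
    and edge_prob_bounds:
      "h \<in> complete_edges n \<Longrightarrow> 0 < q h \<and> q h < 1"
    and weight_measurable:
      "h \<in> complete_edges n \<Longrightarrow> W h \<in> borel_measurable M"
    and weight_law:
      "h \<in> complete_edges n \<Longrightarrow> distr M borel (W h) = L"
    and mark_measurable:
      "u \<in> {1..n} \<Longrightarrow> X u \<in> M \<rightarrow>\<^sub>M S"
    and mark_ident:
      "u \<in> {1..n} \<Longrightarrow> v \<in> {1..n} \<Longrightarrow> distr M S (X u) = distr M S (X v)"
    and independent:
      "indep_sets
         (\<lambda>i. case i of
            EdgeState h \<Rightarrow> {Z h -` A \<inter> space M |A. A \<in> sets (count_space UNIV)}
          | EdgeWeight h \<Rightarrow> {W h -` A \<inter> space M |A. A \<in> sets borel}
          | Mark u \<Rightarrow> {X u -` A \<inter> space M |A. A \<in> sets S})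
         (EdgeState ` complete_edges n \<union> EdgeWeight ` complete_edges n \<union> Mark ` {1..n})"
    and r_measurable:
      "(\<lambda>(x, y). r x y) \<in> borel_measurable (S \<Otimes>\<^sub>M S)"
    and r_symmetric:
      "x \<in> space S \<Longrightarrow> y \<in> space S \<Longrightarrow> r x y = r y x"
    and r_positive:
      "x \<in> space S \<Longrightarrow> y \<in> space S \<Longrightarrow> 0 < r x y"

end

theory Submission
  imports Defs "HOL-Real_Asymp.Real_Asymp"
begin

text \<open>Lower bound: a connected graph needs \<open>n - 1\<close> edges, and by Chebyshev's inequality at most a
  quarter of \<open>n\<close> edges of \<open>G\<close> cost less than a constant multiple of \<open>\<zeta>\<close>.

  Upper bound: fix a large constant \<open>t\<close> and call an edge of \<open>G\<close> cheap if its weight is at most \<open>\<phi>\<close> and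
  its mark factor is at most \<open>t\<close>.  Since \<open>E r\<^sup>2(x, X\<^sub>1) \<le> B\<close> for every \<open>x\<close>, every vertex sees few marks with
  a larger factor, so the cheap edges connect all vertices up to a probability that is an arbitrarily
  large negative power of \<open>n\<close>; this remains true after conditioning on the marks and the weight of
  one edge, which controls second moments on the exceptional event although the costs have no higher
  moments.  When the cheap edges connect, \<open>\<tau>\<close> equals the minimum \<open>\<tau>'\<close> of the total cost over all connected
  spanning subgraphs of the complete graph in which every cost is capped at \<open>K = t\<phi>\<close>, absent edges
  costing \<open>K\<close>.  In particular \<open>\<tau> \<le> nK\<close>.

  Variance: by the Efron--Stein inequality, \<open>Var \<tau>'\<close> is at most the sum over all independent inputs of
  \<open>E (\<tau>' - \<tau>'\<^sub>i)\<^sup>2\<close>, where \<open>\<tau>'\<^sub>i\<close> raises the costs of the edges affected by input \<open>i\<close> to \<open>K\<close>.  For the mark of \<open>u\<close>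
  this difference is at most \<open>K\<close> times the degree of \<open>u\<close> in an optimal tree, and these degrees have
  sum \<open>2(n - 1)\<close> and are typically of order at most \<open>np\<close>.\<close>

section \<open>Connected subgraphs and spanning trees\<close>

text \<open>The exponent in the failure probability \<open>n powr (- (\<gamma> + 7))\<close> of the
  cheap graph comes from the weak moments. On failure, \<tau> is controlled only by the total cost
  of all edges, whose second moment is bounded by a multiple of n^4; two more powers of n absorb
  constants, and n^(-1-\<gamma>) remains. Separating the total cost from the failure event by
  Cauchy-Schwarz would need fourth moments of the costs; factorising edge by edge needs only second
  moments. The marks make the costs of adjacent edges dependent, with no control on how strongly. In
  the lower bound only one of the two cost events of an adjacent pair is therefore used, and this is
  the source of the error of order p. In the upper bound the marks are fixed first; the edges are
  then independent and a union bound over cuts applies. The capped minimum ranges over the complete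
  graph so that it is a bounded function of all inputs, whether or not G is connected, and monotone
  in each cost: raising costs to K is a comparison within one and the same minimisation
  problem.\<close>

lemma joined_refl [simp]: "joined E u u"
  by (simp add: joined_def)

lemma joined_trans: "joined E u v \<Longrightarrow> joined E v w \<Longrightarrow> joined E u w"
  by (auto simp: joined_def)

lemma joined_edge: "{u, v} \<in> E \<Longrightarrow> joined E u v"
  by (auto simp: joined_def)

lemma joined_induct [consumes 1, case_names refl step]:
  assumes "joined E u v" and "P u"
    and "\<And>a b. joined E u a \<Longrightarrow> {a, b} \<in> E \<Longrightarrow> P a \<Longrightarrow> P b"
  shows "P v"
  using assms(1)[unfolded joined_def]
proof (induction rule: rtrancl_induct)
  case base
  then show ?case using assms(2) .
next
  case (step a b)
  then show ?case using assms(3)[of a b] by (auto simp: joined_def)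
qed

lemma joined_subst:
  assumes "joined E u v" and "\<And>a b. {a, b} \<in> E \<Longrightarrow> joined E' a b"
  shows "joined E' u v"
  using assms(1)
proof (induction rule: joined_induct)
  case (step a b)
  then show ?case using assms(2) joined_trans by blast
qed simp

lemma joined_mono: "joined E u v \<Longrightarrow> E \<subseteq> E' \<Longrightarrow> joined E' u v"
  by (erule joined_subst) (auto intro: joined_edge)

lemma joined_sym: "joined E u v \<Longrightarrow> joined E v u"
proof (induction rule: joined_induct)
  case (step a b)
  then show ?case by (metis insert_commute joined_edge joined_trans)
qed simp

lemma connected_graph_mono: "connected_graph V E \<Longrightarrow> E \<subseteq> E' \<Longrightarrow> connected_graph V E'"
  unfolding connected_graph_def using joined_mono by blast

lemma connected_graph_subst:
  assumes "connected_graph V E" and "\<And>a b. {a, b} \<in> E \<Longrightarrow> joined E' a b"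
  shows "connected_graph V E'"
  unfolding connected_graph_def
  by (intro ballI joined_subst[OF _ assms(2)]) (use assms(1) in \<open>auto simp: connected_graph_def\<close>)

lemma connected_graphI_root:
  assumes "\<And>v. v \<in> V \<Longrightarrow> joined E u v"
  shows "connected_graph V E"
  unfolding connected_graph_def using assms joined_sym joined_trans by blast

text \<open>The set reached from one vertex and its complement bound the same cut, and one of them
  has at most half of the vertices. The other side then keeps a fraction \<gamma>0 < 1/2 of all
  vertices even after a small loss, as the degree hypothesis requires.\<close>

lemma disconnected_cut:
  assumes "\<not> connected_graph V E" and "finite V"
  obtains A where "A \<subseteq> V" "A \<noteq> {}" "2 * card A \<le> card V"
    "\<And>a b. a \<in> A \<Longrightarrow> b \<in> V - A \<Longrightarrow> {a, b} \<notin> E"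
proof -
  obtain u v where uv: "u \<in> V" "v \<in> V" "\<not> joined E u v"
    using assms by (auto simp: connected_graph_def)
  define A where "A = {w \<in> V. joined E u w}"
  have A: "A \<subseteq> V" "u \<in> A" "v \<in> V - A" using uv by (auto simp: A_def)
  have no: "{a, b} \<notin> E" if "a \<in> A" "b \<in> V - A" for a b
    using that joined_trans[OF _ joined_edge] unfolding A_def by blast
  have cd: "card V = card A + card (V - A)"
    using A(1) assms(2) by (simp add: card_Diff_subset card_mono finite_subset)
  show thesis
  proof (cases "2 * card A \<le> card V")
    case True
    then show thesis using A no that[of A] by auto
  next
    case False
    have "{a, b} \<notin> E" if "a \<in> V - A" "b \<in> V - (V - A)" for a b
      using no[of b a] that A(1) by (auto simp: insert_commute)
    then show thesis using A False cd that[of "V - A"] by auto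
  qed
qed

lemma connected_graph_crossing:
  assumes "connected_graph V E" and "\<And>h. h \<in> E \<Longrightarrow> h \<subseteq> V"
    and "x \<in> A" and "A \<subseteq> V" and "y \<in> V - A"
  shows "\<exists>a\<in>A. \<exists>b\<in>V - A. {a, b} \<in> E"
proof (rule ccontr)
  assume no: "\<not> ?thesis"
  have "joined E x y" using assms by (auto simp: connected_graph_def)
  then have "y \<in> A"
  proof (induction rule: joined_induct)
    case (step a b)
    then show ?case using no assms(2)[of "{a, b}"] by blast
  qed (use assms in auto)
  then show False using assms by auto
qed

text \<open>Prim's growth: as long as U is not all of V, some edge leaves U, and adding it brings in
  exactly one new vertex. This yields one edge fewer than vertices without any appeal to
  acyclicity.\<close>

lemma connected_graph_grow:
  assumes "connected_graph V E" and "\<And>h. h \<in> E \<Longrightarrow> h \<subseteq> V" and "finite V"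
    and "Suc k \<le> card V"
  shows "\<exists>U T. U \<subseteq> V \<and> T \<subseteq> E \<and> card U = Suc k \<and> finite T \<and> card T = k \<and> \<Union>T \<subseteq> U
    \<and> connected_graph U T"
  using assms(4)
proof (induction k)
  case 0
  then obtain u where "u \<in> V" by fastforce
  then show ?case by (intro exI[of _ "{u}"] exI[of _ "{}"]) (auto simp: connected_graph_def)
next
  case (Suc k)
  then obtain U T where UT: "U \<subseteq> V" "T \<subseteq> E" "card U = Suc k" "finite T" "card T = k"
    "\<Union>T \<subseteq> U" "connected_graph U T" by auto
  have "U \<noteq> V" using UT Suc.prems by auto
  then obtain y where y: "y \<in> V - U" using UT(1) by auto
  obtain x where x: "x \<in> U" using UT(3) by fastforce
  obtain a b where ab: "a \<in> U" "b \<in> V - U" "{a, b} \<in> E"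
    using connected_graph_crossing[OF assms(1,2) x UT(1) y] by blast
  have "{a, b} \<notin> T" using UT(6) ab by blast
  have fU: "finite U" using UT(1) assms(3) finite_subset by blast
  have "joined (insert {a, b} T) a w" if "w \<in> insert b U" for w
    using that ab UT(7) joined_mono[of T a w "insert {a, b} T"] joined_edge[of a b]
    by (auto simp: connected_graph_def)
  then have "connected_graph (insert b U) (insert {a, b} T)" by (rule connected_graphI_root)
  then show ?case using UT ab fU \<open>{a, b} \<notin> T\<close>
    by (intro exI[of _ "insert b U"] exI[of _ "insert {a, b} T"]) auto
qed

lemma connected_graph_sparse_subgraph:
  assumes "connected_graph V E" and "\<And>h. h \<in> E \<Longrightarrow> h \<subseteq> V" and "finite V" and "V \<noteq> {}"
  shows "\<exists>T\<subseteq>E. finite T \<and> card T = card V - 1 \<and> connected_graph V T"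
proof -
  have "Suc (card V - 1) = card V" using assms(3,4) by (simp add: card_gt_0_iff)
  with connected_graph_grow[OF assms(1-3), of "card V - 1"] assms(3)
  show ?thesis by (metis card_subset_eq order.refl)
qed

lemma connected_graph_card_edges:
  assumes "connected_graph V E" and "\<And>h. h \<in> E \<Longrightarrow> h \<subseteq> V" and "finite V" and "finite E"
  shows "card V - 1 \<le> card E"
proof (cases "V = {}")
  case False
  obtain T where "T \<subseteq> E" "card T = card V - 1"
    using connected_graph_sparse_subgraph[OF assms(1-3) False] by metis
  then show ?thesis using card_mono[OF assms(4)] by metis
qed simp

text \<open>The other edges of the cycle form a path between the ends of the closing edge, so every
  use of that edge can be rerouted.\<close>

lemma graph_cycle_remove_edge:
  assumes "graph_cycle T xs" and "connected_graph V T"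
  shows "\<exists>e\<in>T. connected_graph V (T - {e})"
proof -
  define k where "k = length xs"
  define e where "e = {xs ! (k - 1), xs ! 0}"
  have k: "3 \<le> k" "distinct xs"
    and edges: "\<And>i. i < k \<Longrightarrow> {xs ! i, xs ! (Suc i mod k)} \<in> T"
    using assms(1) by (auto simp: graph_cycle_def k_def)
  have e: "e \<in> T" using edges[of "k - 1"] k by (simp add: e_def)
  have step: "{xs ! i, xs ! Suc i} \<in> T - {e}" if "Suc i < k" for i
  proof -
    \<comment> \<open>Length at least 3 matters: on two vertices the closing edge would be the only
      other edge again.\<close>
    have "{xs ! i, xs ! Suc i} \<noteq> e"
    proof
      assume "{xs ! i, xs ! Suc i} = e"
      then have "i = k - 1 \<or> i = 0 \<and> Suc i = k - 1"
        using that k nth_eq_iff_index_eq[OF k(2), of i "k - 1"] nth_eq_iff_index_eq[OF k(2), of i 0]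
          nth_eq_iff_index_eq[OF k(2), of "Suc i" "k - 1"]
          k(1) unfolding e_def k_def[symmetric] by (auto simp: doubleton_eq_iff)
      then show False using that k(1) by auto
    qed
    then show ?thesis using edges[of i] that by auto
  qed
  have path: "joined (T - {e}) (xs ! 0) (xs ! i)" if "i < k" for i
    using that
  proof (induction i)
    case (Suc i)
    then have "joined (T - {e}) (xs ! 0) (xs ! i)" by simp
    then show ?case using joined_trans joined_edge[OF step[of i]] Suc.prems by blast
  qed simp
  have je: "joined (T - {e}) (xs ! 0) (xs ! (k - 1))" using path k by simp
  have "joined (T - {e}) a b" if "{a, b} \<in> T" for a b
  proof (cases "{a, b} = e")
    case True
    then show ?thesis using je joined_sym[OF je] by (auto simp: e_def doubleton_eq_iff)
  qed (use that joined_edge[of a b "T - {e}"] in auto)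
  then show ?thesis using e connected_graph_subst[OF assms(2)] by blast
qed

text \<open>A connected subgraph with \<open>card V - 1\<close> edges is automatically acyclic: an
  edge of a cycle could be deleted without disconnecting it, and too few edges would be
  left.\<close>

lemma connected_graph_spanning_tree:
  assumes "connected_graph V E" and "\<And>h. h \<in> E \<Longrightarrow> h \<subseteq> V" and "finite V" and "V \<noteq> {}"
  shows "\<exists>T. spanning_tree_of V E T"
proof -
  obtain T where T: "T \<subseteq> E" "finite T" "card T = card V - 1" "connected_graph V T"
    using connected_graph_sparse_subgraph[OF assms] by metis
  have "\<not> graph_cycle T xs" for xs
  proof
    assume "graph_cycle T xs"
    from graph_cycle_remove_edge[OF this T(4)]
    obtain e where e: "e \<in> T" "connected_graph V (T - {e})" by auto
    have "card V - 1 \<le> card (T - {e})"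
      using connected_graph_card_edges[OF e(2)] T assms(2,3) by blast
    moreover have "card T > 0" using e T(2) by (auto simp: card_gt_0_iff)
    ultimately show False using T e by (simp add: card_Diff_singleton)
  qed
  then show ?thesis using T assms(2) by (intro exI[of _ T]) (auto simp: spanning_tree_of_def)
qed

text \<open>Without \<open>{a, b}\<close>, either a and b are still joined, or S falls into the part
  of a and the part of b. In the second case the connected graph E has an edge between the
  parts.\<close>

lemma connected_graph_exchange:
  assumes S: "connected_graph V S" and E: "connected_graph V E"
    and SV: "\<And>h. h \<in> S \<Longrightarrow> h \<subseteq> V" and EV: "\<And>h. h \<in> E \<Longrightarrow> h \<subseteq> V"
    and ab: "{a, b} \<in> S" "a \<noteq> b"
  shows "\<exists>g\<in>E. connected_graph V (insert g (S - {{a, b}}))"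
proof -
  let ?S = "S - {{a, b}}"
  define A where "A = {w \<in> V. joined ?S a w}"
  have V: "a \<in> V" "b \<in> V" using SV[OF ab(1)] by auto
  show ?thesis
  proof (cases "b \<in> A")
    case True
    then have j: "joined ?S a b" by (simp add: A_def)
    have "joined ?S x y" if "{x, y} \<in> S" for x y
      using that j joined_sym[OF j] joined_edge[of x y ?S] by (auto simp: doubleton_eq_iff)
    then have c: "connected_graph V ?S"
      by (rule connected_graph_subst[OF S])
    \<comment> \<open>Any edge of E will do here; there is one because a and b are distinct
      vertices.\<close>
    obtain x y where "{x, y} \<in> E"
      using connected_graph_crossing[OF E EV, of a "{a}" b] V ab(2) by blast
    then show ?thesis using connected_graph_mono[OF c] by blast
  next
    case False
    then obtain x y where xy: "x \<in> A" "y \<in> V - A" "{x, y} \<in> E"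
      using connected_graph_crossing[OF E EV, of a A b] V by (auto simp: A_def)
    have ab_or: "joined ?S a w \<or> joined ?S b w" if "joined S a w" for w
      using that
    proof (induction rule: joined_induct)
      case (step c d)
      then show ?case
      proof (cases "{c, d} = {a, b}")
        case True
        then show ?thesis by (auto simp: doubleton_eq_iff)
      next
        case False
        then have "joined ?S c d" using step(2) by (intro joined_edge) auto
        then show ?thesis using step(3) joined_trans by blast
      qed
    qed simp
    have "joined S a y" using S V xy by (auto simp: connected_graph_def)
    with ab_or xy have bj: "joined ?S b y" by (auto simp: A_def)
    let ?T = "insert {x, y} ?S"
    have "joined ?T a x" "joined ?T y b"
      using xy(1) joined_sym[OF bj] joined_mono[of ?S _ _ ?T] by (auto simp: A_def)
    then have j: "joined ?T a b" using joined_edge[of x y ?T] joined_trans by blast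
    have "joined ?T u v" if "{u, v} \<in> S" for u v
      using that j joined_sym[OF j] joined_edge[of u v ?T] by (auto simp: doubleton_eq_iff)
    then have "connected_graph V ?T"
      by (rule connected_graph_subst[OF S])
    then show ?thesis using xy by blast
  qed
qed

section \<open>The complete graph and its components\<close>

lemma finite_complete_edges [simp]: "finite (complete_edges n)"
  by (rule finite_subset[of _ "Pow {1..n}"]) (auto simp: complete_edges_def)

lemma complete_edges_subset: "h \<in> complete_edges n \<Longrightarrow> h \<subseteq> {1..n}"
  by (auto simp: complete_edges_def)

lemma complete_edgesE:
  assumes "h \<in> complete_edges n"
  obtains u v where "h = {u, v}" "u \<in> {1..n}" "v \<in> {1..n}" "u \<noteq> v"
  using assms by (auto simp: complete_edges_def)

lemma doubleton_in_complete_edges [simp]: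
  "{u, v} \<in> complete_edges n \<longleftrightarrow> u \<in> {1..n} \<and> v \<in> {1..n} \<and> u \<noteq> v"
  by (auto simp: complete_edges_def doubleton_eq_iff)

lemma Min_Max_complete_edges:
  assumes "h \<in> complete_edges n"
  shows "Min h \<in> {1..n}" "Max h \<in> {1..n}" "Min h \<noteq> Max h" "h = {Min h, Max h}"
proof -
  obtain u v where "h = {u, v}" "u \<in> {1..n}" "v \<in> {1..n}" "u \<noteq> v"
    using assms by (rule complete_edgesE)
  then show "Min h \<in> {1..n}" "Max h \<in> {1..n}" "Min h \<noteq> Max h" "h = {Min h, Max h}"
    by (cases "u < v"; auto)+
qed

lemma connected_complete_edges: "connected_graph {1..n} (complete_edges n)"
  unfolding connected_graph_def by (metis doubleton_in_complete_edges joined_edge joined_refl)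

lemma finite_spanning_trees: "finite E \<Longrightarrow> finite {T. spanning_tree_of C E T}"
  by (rule finite_subset[of _ "Pow E"]) (auto simp: spanning_tree_of_def)

text \<open>Ensures that the minimum in \<open>mst_cost\<close> is over a nonempty set even when G
  is disconnected.\<close>

lemma component_has_spanning_tree:
  assumes "C \<in> components {1..n} E" and "E \<subseteq> complete_edges n"
  shows "\<exists>T. spanning_tree_of C E T"
proof -
  obtain u where u: "u \<in> {1..n}" "C = {v \<in> {1..n}. joined E u v}"
    using assms(1) by (auto simp: components_def)
  define EC where "EC = {h \<in> E. h \<subseteq> C}"
  have "joined EC u v" if "joined E u v" for v
    using that
  proof (induction rule: joined_induct)
    case (step a b)
    have "{a, b} \<subseteq> {1..n}" using assms(2) step(2) complete_edges_subset by blast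
    then have "a \<in> C" "b \<in> C" using step(1,2) joined_trans joined_edge u by auto
    then have "{a, b} \<in> EC" using step(2) by (auto simp: EC_def)
    then show ?case using step(3) joined_edge joined_trans by blast
  qed simp
  then have "connected_graph C EC" using u by (intro connected_graphI_root[of _ _ u]) auto
  moreover have "u \<in> C" "finite C" using u by auto
  ultimately have "\<exists>T. spanning_tree_of C EC T"
    by (intro connected_graph_spanning_tree) (auto simp: EC_def)
  then show ?thesis by (auto simp: spanning_tree_of_def EC_def)
qed

lemma components_connected_graph:
  assumes "connected_graph V E" and "C \<in> components V E"
  shows "C = V"
  using assms by (auto simp: components_def connected_graph_def)

text \<open>Connected edge sets replace trees: for nonnegative costs the optimum is attained with
  \<open>n - 1\<close> edges anyway, and the index set depends on n alone, which makes the minimum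
  monotone and measurable in the costs.\<close>

definition min_connecting_cost :: "nat \<Rightarrow> (nat set \<Rightarrow> real) \<Rightarrow> real" where
  "min_connecting_cost n c =
     Min (sum c ` {T. T \<subseteq> complete_edges n \<and> connected_graph {1..n} T})"

lemma finite_connecting: "finite {T. T \<subseteq> complete_edges n \<and> connected_graph {1..n} T}"
  by (rule finite_subset[of _ "Pow (complete_edges n)"]) auto

lemma min_connecting_cost_le:
  "T \<subseteq> complete_edges n \<Longrightarrow> connected_graph {1..n} T \<Longrightarrow> min_connecting_cost n c \<le> sum c T"
  unfolding min_connecting_cost_def using finite_connecting by (intro Min_le) auto

lemma min_connecting_cost_attained:
  assumes "\<And>h. h \<in> complete_edges n \<Longrightarrow> 0 \<le> c h" and "0 < n"
  obtains T where "T \<subseteq> complete_edges n" "connected_graph {1..n} T" "card T = n - 1"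
    "min_connecting_cost n c = sum c T"
proof -
  let ?A = "{T. T \<subseteq> complete_edges n \<and> connected_graph {1..n} T}"
  have "min_connecting_cost n c \<in> sum c ` ?A"
    unfolding min_connecting_cost_def using finite_connecting connected_complete_edges
    by (intro Min_in) auto
  then obtain S where S: "S \<subseteq> complete_edges n" "connected_graph {1..n} S"
    "min_connecting_cost n c = sum c S" by auto
  have "\<exists>T\<subseteq>S. finite T \<and> card T = card {1..n} - 1 \<and> connected_graph {1..n} T"
    by (rule connected_graph_sparse_subgraph[OF S(2)])
      (use S(1) complete_edges_subset assms(2) in auto)
  then obtain T where T: "T \<subseteq> S" "card T = n - 1" "connected_graph {1..n} T" by auto
  have "sum c T \<le> sum c S"
    using T(1) S(1) assms(1) by (intro sum_mono2) (auto intro: finite_subset)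
  moreover have "min_connecting_cost n c \<le> sum c T"
    using T S by (intro min_connecting_cost_le) auto
  ultimately show thesis using T S that[of T] by simp
qed

lemma min_connecting_cost_mono:
  assumes "\<And>h. h \<in> complete_edges n \<Longrightarrow> 0 \<le> c h"
    and "\<And>h. h \<in> complete_edges n \<Longrightarrow> c h \<le> c' h" and "0 < n"
  shows "min_connecting_cost n c \<le> min_connecting_cost n c'"
proof -
  have "\<And>h. h \<in> complete_edges n \<Longrightarrow> 0 \<le> c' h" using assms(1,2) order_trans by blast
  then obtain T where T: "T \<subseteq> complete_edges n" "connected_graph {1..n} T"
    "min_connecting_cost n c' = sum c' T"
    using assms(3) by (metis min_connecting_cost_attained)
  have "min_connecting_cost n c \<le> sum c T" using T by (intro min_connecting_cost_le)
  also have "\<dots> \<le> sum c' T" using T assms(2) by (intro sum_mono) auto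
  finally show ?thesis using T by simp
qed

lemma min_connecting_cost_bounds:
  assumes "\<And>h. h \<in> complete_edges n \<Longrightarrow> 0 \<le> c h \<and> c h \<le> K" and "0 < n"
  shows "0 \<le> min_connecting_cost n c" "min_connecting_cost n c \<le> real (n - 1) * K"
proof -
  obtain T where T: "T \<subseteq> complete_edges n" "card T = n - 1" "min_connecting_cost n c = sum c T"
    by (rule min_connecting_cost_attained[of n c]) (use assms in auto)
  show "0 \<le> min_connecting_cost n c" using T assms by (auto intro!: sum_nonneg)
  have "sum c T \<le> (\<Sum>h\<in>T. K)" using T assms by (intro sum_mono) auto
  then show "min_connecting_cost n c \<le> real (n - 1) * K" using T by simp
qed

text \<open>Edges outside G are exchanged one at a time for edges of E. Each exchange replaces a
  cost K by a cost at most K and lowers the number of edges outside G.\<close>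

lemma cheap_connected_exchange:
  fixes c :: "nat set \<Rightarrow> real"
  assumes "S \<subseteq> complete_edges n" and "connected_graph {1..n} S"
    and "E \<subseteq> complete_edges n" and "connected_graph {1..n} E"
    and "\<And>h. h \<in> complete_edges n \<Longrightarrow> 0 \<le> c h"
    and "\<And>h. h \<in> E \<Longrightarrow> c h \<le> K"
    and "\<And>h. h \<in> complete_edges n - G \<Longrightarrow> c h = K" and "E \<subseteq> G"
  shows "\<exists>S'\<subseteq>G \<inter> complete_edges n. connected_graph {1..n} S' \<and> sum c S' \<le> sum c S"
  using assms(1,2)
proof (induction "card (S - G)" arbitrary: S)
  case 0
  have "finite S" using 0(2) finite_subset finite_complete_edges by blast
  then have "S - G = {}" using 0(1) by simp
  then have "S \<subseteq> G \<inter> complete_edges n" using 0(2) by auto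
  then show ?case using 0(3) by (intro exI[of _ S]) simp
next
  case (Suc k)
  have fS: "finite S" using Suc(3) finite_subset finite_complete_edges by blast
  obtain h where h: "h \<in> S" "h \<notin> G" using Suc(2)
    by (metis Diff_iff all_not_in_conv card.empty nat.distinct(1))
  then obtain a b where ab: "h = {a, b}" "a \<noteq> b" using Suc(3) complete_edgesE by blast
  have "\<exists>g\<in>E. connected_graph {1..n} (insert g (S - {{a, b}}))"
    by (rule connected_graph_exchange[OF Suc(4) assms(4)])
      (use ab h Suc(3) assms(3) complete_edges_subset in blast)+
  then obtain g where g: "g \<in> E" "connected_graph {1..n} (insert g (S - {h}))"
    using ab by auto
  let ?S = "insert g (S - {h})"
  have sub: "?S \<subseteq> complete_edges n" using g assms(3) Suc(3) by auto
  have "?S - G = (S - G) - {h}" using g assms(8) by auto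
  then have "k = card (?S - G)" using Suc(2) h fS by (simp add: card_Diff_singleton)
  from Suc(1)[OF this sub g(2)] obtain S' where
    S': "S' \<subseteq> G \<inter> complete_edges n" "connected_graph {1..n} S'" "sum c S' \<le> sum c ?S" by blast
  \<comment> \<open>Only an inequality, since g may already be among the remaining edges; its cost
    is then counted twice on the right.\<close>
  have "sum c ?S \<le> c g + sum c (S - {h})"
    using fS g(1) assms(3,5) by (cases "g \<in> S - {h}") (auto simp: insert_absorb)
  also have "\<dots> \<le> c h + sum c (S - {h})"
    using assms(6)[OF g(1)] assms(7)[of h] h Suc(3) by auto
  also have "\<dots> = sum c S" using fS h by (simp add: sum.remove)
  finally have "sum c S' \<le> sum c S" using S'(3) by simp
  then show ?case using S'(1,2) by blast
qed

text \<open>On the cheap edges capped and true costs agree, and an optimum of the capped problem can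
  be moved into them by exchanges, where it contains a tree. Conversely, capping only lowers the
  cost of a tree of G.\<close>

lemma min_spanning_tree_eq_capped:
  fixes c :: "nat set \<Rightarrow> real"
  assumes "0 < n" and "G \<subseteq> complete_edges n" and pos: "\<And>h. h \<in> G \<Longrightarrow> 0 \<le> c h" and "0 \<le> K"
    and conn: "connected_graph {1..n} {h \<in> G. c h \<le> K}"
  shows "Min ((\<lambda>T. \<Sum>h\<in>T. c h) ` {T. spanning_tree_of {1..n} G T})
    = min_connecting_cost n (\<lambda>h. if h \<in> G then max 0 (min (c h) K) else K)"
    (is "Min (?s ` ?T) = min_connecting_cost n ?c")
proof -
  have fG: "finite G" using assms(2) finite_subset finite_complete_edges by blast
  have fin: "finite ?T" by (rule finite_spanning_trees[OF fG])
  have GV: "h \<subseteq> {1..n}" if "h \<in> G" for h using that assms(2) complete_edges_subset by blast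
  have "connected_graph {1..n} G" by (rule connected_graph_mono[OF conn]) auto
  then have ne: "?T \<noteq> {}"
    using connected_graph_spanning_tree[of "{1..n}" G] GV assms(1) by auto
  have c0: "0 \<le> ?c h" for h using assms(4) by auto
  obtain S where S: "S \<subseteq> complete_edges n" "connected_graph {1..n} S"
    "min_connecting_cost n ?c = sum ?c S"
    by (rule min_connecting_cost_attained[of n ?c]) (use c0 assms(1) in auto)
  define E where "E = {h \<in> G. c h \<le> K}"
  \<comment> \<open>The cheap edges are both the supply of replacements and the target set: an edge
    of G above the cap also has capped cost exactly K.\<close>
  have "\<exists>S'\<subseteq>E \<inter> complete_edges n. connected_graph {1..n} S' \<and> sum ?c S' \<le> sum ?c S"
    by (rule cheap_connected_exchange[OF S(1,2), of E ?c K E])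
      (use conn assms(2,4) pos in \<open>auto simp: E_def\<close>)
  then obtain S' where S': "S' \<subseteq> E" "connected_graph {1..n} S'" "sum ?c S' \<le> sum ?c S"
    by auto
  obtain T where T: "spanning_tree_of {1..n} S' T"
    using connected_graph_spanning_tree[OF S'(2)] S'(1) GV assms(1) by (auto simp: E_def)
  have TS: "T \<subseteq> S'" using T by (simp add: spanning_tree_of_def)
  have "spanning_tree_of {1..n} G T" using T S'(1) by (auto simp: spanning_tree_of_def E_def)
  then have "Min (?s ` ?T) \<le> sum c T" using fin by (intro Min_le) auto
  also have "\<dots> = sum ?c T"
    using TS S'(1) pos by (intro sum.cong) (auto simp: E_def)
  also have "\<dots> \<le> sum ?c S'"
    using TS S'(1) fG c0 by (intro sum_mono2) (auto simp: E_def intro: finite_subset)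
  also have "\<dots> \<le> min_connecting_cost n ?c" using S S' by simp
  finally have le: "Min (?s ` ?T) \<le> min_connecting_cost n ?c" .
  have "Min (?s ` ?T) \<in> ?s ` ?T" using fin ne by (intro Min_in) auto
  then obtain T' where T': "spanning_tree_of {1..n} G T'" "Min (?s ` ?T) = sum c T'" by auto
  have "min_connecting_cost n ?c \<le> sum ?c T'"
    using T' assms(2) by (intro min_connecting_cost_le) (auto simp: spanning_tree_of_def)
  also have "\<dots> \<le> sum c T'"
    using T' pos by (intro sum_mono) (auto simp: spanning_tree_of_def)
  finally show ?thesis using le T' by simp
qed

section \<open>The Efron--Stein inequality\<close>

text \<open>The mean is the best constant in mean square. An arbitrary c is allowed so that \<tau>
  can later be centred at the mean of the capped minimum.\<close>

lemma (in prob_space) variance_le_sq_deviation: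
  fixes f :: "'a \<Rightarrow> real"
  assumes "integrable M f" "integrable M (\<lambda>x. (f x)\<^sup>2)"
  shows "variance f \<le> expectation (\<lambda>x. (f x - c)\<^sup>2)"
proof -
  have "expectation (\<lambda>x. (f x - c)\<^sup>2) = expectation (\<lambda>x. (f x)\<^sup>2 - 2 * c * f x + c\<^sup>2)"
    by (intro Bochner_Integration.integral_cong) (auto simp: power2_eq_square algebra_simps)
  also have "\<dots> = expectation (\<lambda>x. (f x)\<^sup>2) - 2 * c * expectation f + c\<^sup>2"
    using assms by (simp add: prob_space)
  also have "\<dots> = variance f + (expectation f - c)\<^sup>2"
    using variance_eq[OF assms] by (simp add: power2_eq_square algebra_simps)
  finally show ?thesis by simp
qed

lemma (in finite_measure) integrable_bounded_real:
  fixes f :: "'a \<Rightarrow> real"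
  assumes "f \<in> borel_measurable M" "\<And>x. x \<in> space M \<Longrightarrow> \<bar>f x\<bar> \<le> C"
  shows "integrable M f"
  by (rule integrable_const_bound[of _ C]) (use assms in auto)

text \<open>The insertion step splits the variance as
  \<open>Var f = E\<^sub>y Var\<^sub>x f(x, y) + Var\<^sub>y E\<^sub>x f(x, y)\<close>, the second term of which is at most
  \<open>E (f - g\<^sub>i)\<^sup>2\<close> because \<open>E\<^sub>x g\<^sub>i\<close> does not depend on \<open>y\<close>.\<close>
lemma efron_stein_PiM:
  fixes f :: "('i \<Rightarrow> 'b) \<Rightarrow> real" and g :: "'i \<Rightarrow> ('i \<Rightarrow> 'b) \<Rightarrow> real"
  assumes N: "\<And>i. prob_space (N i)" and "finite I"
    and "f \<in> borel_measurable (PiM I N)" and "\<And>x. x \<in> space (PiM I N) \<Longrightarrow> \<bar>f x\<bar> \<le> C"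
    and "\<And>i. i \<in> I \<Longrightarrow> g i \<in> borel_measurable (PiM I N)"
    and "\<And>i x. i \<in> I \<Longrightarrow> x \<in> space (PiM I N) \<Longrightarrow> \<bar>g i x\<bar> \<le> C"
    and "\<And>i x y. i \<in> I \<Longrightarrow> x \<in> space (PiM I N) \<Longrightarrow> y \<in> space (N i) \<Longrightarrow> g i (x(i := y)) = g i x"
  shows "(LINT x|PiM I N. (f x - (LINT x|PiM I N. f x))\<^sup>2) \<le> (\<Sum>i\<in>I. LINT x|PiM I N. (f x - g i x)\<^sup>2)"
  using assms(2-)
proof (induction I arbitrary: f g rule: finite_induct)
  case empty
  then show ?case by (simp add: PiM_empty lebesgue_integral_count_space_finite)
next
  case (insert i I)
  interpret product_sigma_finite N
    by (rule product_sigma_finite.intro, rule prob_space_imp_sigma_finite, rule N)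
  interpret P: prob_space "PiM I N" by (rule prob_space_PiM) (rule N)
  interpret Q: prob_space "PiM (insert i I) N" by (rule prob_space_PiM) (rule N)
  interpret Ni: prob_space "N i" by (rule N)
  interpret PN: pair_prob_space "PiM I N" "N i" ..
  note f[measurable] = insert.prems(1) and fC = insert.prems(2) and g[measurable] = insert.prems(3)
    and gC = insert.prems(4) and gi = insert.prems(5)
  have upd: "x(i := y) \<in> space (PiM (insert i I) N)" if "x \<in> space (PiM I N)" "y \<in> space (N i)" for x y
    using that by (auto simp: space_PiM PiE_def extensional_def Pi_def)
  have swap: "(LINT x|PiM (insert i I) N. h x) = (LINT y|N i. LINT x|PiM I N. h (x(i := y)))"
    if h: "h \<in> borel_measurable (PiM (insert i I) N)" "\<And>x. x \<in> space (PiM (insert i I) N) \<Longrightarrow> \<bar>h x\<bar> \<le> D"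
    for h :: "('i \<Rightarrow> 'b) \<Rightarrow> real" and D
  proof -
    have "(LINT x|PiM (insert i I) N. h x) = (LINT x|PiM I N. LINT y|N i. h (x(i := y)))"
      using insert.hyps Q.integrable_bounded_real[OF h] by (rule product_integral_insert)
    also have "\<dots> = (LINT y|N i. LINT x|PiM I N. h (x(i := y)))"
    proof (rule PN.Fubini_integral[symmetric])
      have [measurable]: "h \<in> borel_measurable (PiM (insert i I) N)" by fact
      show "integrable (PiM I N \<Otimes>\<^sub>M N i) (\<lambda>(x, y). h (x(i := y)))"
        by (rule PN.integrable_bounded_real[where C=D])
          (use h(2) upd in \<open>auto simp: space_pair_measure\<close>)
    qed
    finally show ?thesis .
  qed
  define m where "m = (LINT x|PiM (insert i I) N. f x)"
  define F where "F y = (LINT x|PiM I N. f (x(i := y)))" for y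
  have int_x: "integrable (PiM I N) (\<lambda>x. h (x(i := y)))"
    if h[measurable]: "h \<in> borel_measurable (PiM (insert i I) N)"
      and "\<And>x. x \<in> space (PiM (insert i I) N) \<Longrightarrow> \<bar>h x\<bar> \<le> D" and y[measurable]: "y \<in> space (N i)"
    for h :: "('i \<Rightarrow> 'b) \<Rightarrow> real" and D y
    by (rule P.integrable_bounded_real[where C=D]) (use that upd in auto)
  have int_y: "integrable (N i) (\<lambda>y. LINT x|PiM I N. h (x(i := y)))"
    if h[measurable]: "h \<in> borel_measurable (PiM (insert i I) N)"
      and D: "\<And>x. x \<in> space (PiM (insert i I) N) \<Longrightarrow> \<bar>h x\<bar> \<le> D"
    for h :: "('i \<Rightarrow> 'b) \<Rightarrow> real" and D
  proof (rule Ni.integrable_bounded_real[where C=D])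
    show "\<bar>LINT x|PiM I N. h (x(i := y))\<bar> \<le> D" if y: "y \<in> space (N i)" for y
    proof -
      have "\<bar>LINT x|PiM I N. h (x(i := y))\<bar> \<le> (LINT x|PiM I N. \<bar>h (x(i := y))\<bar>)"
        by (rule integral_abs_bound)
      also have "\<dots> \<le> (LINT x|PiM I N. D)"
        using int_x[OF h D y] D upd[OF _ y] by (intro integral_mono integrable_abs) auto
      finally show ?thesis by (simp add: P.prob_space)
    qed
  qed measurable
  have C0: "0 \<le> C" using fC Q.not_empty abs_ge_zero order_trans by (metis all_not_in_conv)
  have m_eq: "m = (LINT y|N i. F y)" unfolding m_def F_def by (rule swap[OF f fC])
  have bd2: "\<bar>(a - b)\<^sup>2\<bar> \<le> (2 * C)\<^sup>2" if "\<bar>a\<bar> \<le> C" "\<bar>b\<bar> \<le> C" for a b :: real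
  proof -
    have "\<bar>a - b\<bar> \<le> \<bar>2 * C\<bar>" using that C0 by linarith
    then show ?thesis by (simp add: abs_le_square_iff)
  qed
  have mC: "\<bar>m\<bar> \<le> C"
  proof -
    have "\<bar>m\<bar> \<le> (LINT x|PiM (insert i I) N. \<bar>f x\<bar>)" unfolding m_def by (rule integral_abs_bound)
    also have "\<dots> \<le> (LINT x|PiM (insert i I) N. C)"
      using fC Q.integrable_bounded_real[OF f fC] by (intro integral_mono integrable_abs) auto
    finally show ?thesis by (simp add: Q.prob_space)
  qed
  let ?A = "\<lambda>y. LINT x|PiM I N. (f (x(i := y)) - F y)\<^sup>2"
  let ?B = "\<lambda>j y. LINT x|PiM I N. (f (x(i := y)) - g j (x(i := y)))\<^sup>2"
  have sqm: "(\<lambda>x. (f x - g j x)\<^sup>2) \<in> borel_measurable (PiM (insert i I) N)"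
    "\<And>x. x \<in> space (PiM (insert i I) N) \<Longrightarrow> \<bar>(f x - g j x)\<^sup>2\<bar> \<le> (2 * C)\<^sup>2"
    if "j \<in> insert i I" for j
    using that g[of j] fC gC bd2 by auto
  have fm: "(\<lambda>x. (f x - m)\<^sup>2) \<in> borel_measurable (PiM (insert i I) N)"
    "\<And>x. x \<in> space (PiM (insert i I) N) \<Longrightarrow> \<bar>(f x - m)\<^sup>2\<bar> \<le> (2 * C)\<^sup>2"
    using fC mC bd2 by auto
  have f2: "(\<lambda>x. (f x)\<^sup>2) \<in> borel_measurable (PiM (insert i I) N)"
    "\<And>x. x \<in> space (PiM (insert i I) N) \<Longrightarrow> \<bar>(f x)\<^sup>2\<bar> \<le> (2 * C)\<^sup>2"
    using fC bd2[of _ 0] C0 by auto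
  \<comment> \<open>For fixed y the section in the other coordinates satisfies the same hypotheses,
    because updates at j and at i commute for j different from i.\<close>
  have IH: "?A y \<le> (\<Sum>j\<in>I. ?B j y)" if y: "y \<in> space (N i)" for y
    unfolding F_def
  proof (rule insert.IH)
    note [measurable] = y
    show "(\<lambda>x. f (x(i := y))) \<in> borel_measurable (PiM I N)" by measurable
    show "\<bar>f (x(i := y))\<bar> \<le> C" if "x \<in> space (PiM I N)" for x using fC upd that y by blast
    have "(\<lambda>x. x(i := y)) \<in> PiM I N \<rightarrow>\<^sub>M PiM (insert i I) N" by measurable
    then show "(\<lambda>x. g j (x(i := y))) \<in> borel_measurable (PiM I N)" if "j \<in> I" for j
      using g[of j] that measurable_compose by blast
    show "\<bar>g j (x(i := y))\<bar> \<le> C" if "j \<in> I" "x \<in> space (PiM I N)" for j x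
      using gC upd that y by blast
    show "g j (x(j := z, i := y)) = g j (x(i := y))"
      if "j \<in> I" "x \<in> space (PiM I N)" "z \<in> space (N j)" for j x z
      using gi[of j "x(i := y)" z] that upd[OF that(2) y] insert.hyps(2)
      by (metis fun_upd_twist insertCI)
  qed
  have decomp: "(LINT x|PiM I N. (f (x(i := y)) - m)\<^sup>2) = ?A y + (F y - m)\<^sup>2" if y: "y \<in> space (N i)" for y
  proof -
    have i1: "integrable (PiM I N) (\<lambda>x. f (x(i := y)))" by (rule int_x[OF f fC y])
    have i2: "integrable (PiM I N) (\<lambda>x. (f (x(i := y)))\<^sup>2)" by (rule int_x[OF f2 y])
    have *: "(LINT x|PiM I N. (f (x(i := y)) - c)\<^sup>2)
      = (LINT x|PiM I N. (f (x(i := y)))\<^sup>2) - 2 * c * F y + c\<^sup>2" for c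
    proof -
      have "(LINT x|PiM I N. (f (x(i := y)) - c)\<^sup>2)
        = (LINT x|PiM I N. (f (x(i := y)))\<^sup>2 - 2 * c * f (x(i := y)) + c\<^sup>2)"
        by (intro Bochner_Integration.integral_cong) (auto simp: power2_eq_square algebra_simps)
      then show ?thesis using i1 i2 by (simp add: P.prob_space F_def)
    qed
    show ?thesis unfolding * by (simp add: power2_eq_square algebra_simps)
  qed
  have iF: "integrable (N i) F" unfolding F_def by (rule int_y[OF f fC])
  have Fm[measurable]: "F \<in> borel_measurable (N i)" using iF by auto
  have FC: "\<bar>F y\<bar> \<le> C" if y: "y \<in> space (N i)" for y
  proof -
    have "\<bar>F y\<bar> \<le> (LINT x|PiM I N. \<bar>f (x(i := y))\<bar>)" unfolding F_def by (rule integral_abs_bound)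
    also have "\<dots> \<le> (LINT x|PiM I N. C)"
      by (intro integral_mono integrable_abs int_x[OF f fC y]) (use fC upd[OF _ y] in auto)
    finally show ?thesis by (simp add: P.prob_space)
  qed
  have iF2: "integrable (N i) (\<lambda>y. (F y - c)\<^sup>2)" if "\<bar>c\<bar> \<le> C" for c
    by (rule Ni.integrable_bounded_real[where C="(2 * C)\<^sup>2"]) (use that FC bd2 in auto)
  \<comment> \<open>The integrand of \<open>?A\<close> contains \<open>F y\<close>, so it is not a
    section of one fixed function; integrability is read off from the decomposition instead.\<close>
  have iA: "integrable (N i) ?A"
  proof -
    have "integrable (N i) (\<lambda>y. (LINT x|PiM I N. (f (x(i := y)) - m)\<^sup>2) - (F y - m)\<^sup>2)"
      using int_y[OF fm] iF2[OF mC] by (rule Bochner_Integration.integrable_diff)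
    then show ?thesis by (rule Bochner_Integration.integrable_cong[THEN iffD1, rotated -1]) (auto simp: decomp)
  qed
  have iB: "integrable (N i) (?B j)" if "j \<in> insert i I" for j
    using int_y[OF sqm[OF that]] .
  obtain y0 where y0: "y0 \<in> space (N i)" using Ni.not_empty by auto
  define k where "k = (LINT x|PiM I N. g i (x(i := y0)))"
  have k: "(LINT x|PiM I N. g i (x(i := y))) = k" if y: "y \<in> space (N i)" for y
    unfolding k_def
  proof (rule Bochner_Integration.integral_cong[OF refl])
    fix x assume x: "x \<in> space (PiM I N)"
    show "g i (x(i := y)) = g i (x(i := y0))"
      using gi[OF _ upd[OF x y0] y] by (metis fun_upd_upd insertI1)
  qed
  have gim: "g i \<in> borel_measurable (PiM (insert i I) N)"
    "\<And>x. x \<in> space (PiM (insert i I) N) \<Longrightarrow> \<bar>g i x\<bar> \<le> C" using g gC by auto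
  \<comment> \<open>The square of a mean is at most the mean of the square, applied to the
    difference of the sections of f and \<open>g i\<close>.\<close>
  have last: "(F y - k)\<^sup>2 \<le> ?B i y" if y: "y \<in> space (N i)" for y
  proof -
    let ?h = "\<lambda>x. f (x(i := y)) - g i (x(i := y))"
    have i1: "integrable (PiM I N) ?h"
      using int_x[OF f fC y] int_x[OF gim y] by (rule Bochner_Integration.integrable_diff)
    have i2: "integrable (PiM I N) (\<lambda>x. (?h x)\<^sup>2)"
      by (rule int_x[OF sqm y]) simp_all
    have "F y - k = P.expectation ?h"
      unfolding F_def k[OF y, symmetric]
      using int_x[OF f fC y] int_x[OF gim y] by (rule Bochner_Integration.integral_diff[symmetric])
    then show ?thesis using P.variance_positive[of ?h] P.variance_eq[OF i1 i2] by simp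
  qed
  have "(LINT x|PiM (insert i I) N. (f x - m)\<^sup>2) = (LINT y|N i. LINT x|PiM I N. (f (x(i := y)) - m)\<^sup>2)"
    by (rule swap[OF fm])
  also have "\<dots> = (LINT y|N i. ?A y + (F y - m)\<^sup>2)"
    by (intro Bochner_Integration.integral_cong) (auto simp: decomp)
  also have "\<dots> = (LINT y|N i. ?A y) + (LINT y|N i. (F y - m)\<^sup>2)"
    using iA iF2[OF mC] by (rule Bochner_Integration.integral_add)
  also have "\<dots> \<le> (\<Sum>j\<in>I. LINT y|N i. ?B j y) + (LINT y|N i. ?B i y)"
  proof (rule add_mono)
    have "(LINT y|N i. ?A y) \<le> (LINT y|N i. (\<Sum>j\<in>I. ?B j y))"
      using iA iB IH by (intro integral_mono Bochner_Integration.integrable_sum) auto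
    then show "(LINT y|N i. ?A y) \<le> (\<Sum>j\<in>I. LINT y|N i. ?B j y)"
      using iB by (subst (asm) Bochner_Integration.integral_sum) auto
    have "integrable (N i) (\<lambda>y. (F y)\<^sup>2)" using iF2[of 0] C0 by simp
    from Ni.variance_le_sq_deviation[OF iF this, of k]
    have "(LINT y|N i. (F y - m)\<^sup>2) \<le> (LINT y|N i. (F y - k)\<^sup>2)" by (simp add: m_eq)
    also have "\<dots> \<le> (LINT y|N i. ?B i y)"
    proof (rule integral_mono)
      have "\<bar>k\<bar> \<le> C"
      proof -
        have "\<bar>k\<bar> \<le> (LINT x|PiM I N. \<bar>g i (x(i := y0))\<bar>)" unfolding k_def by (rule integral_abs_bound)
        also have "\<dots> \<le> (LINT x|PiM I N. C)"
          by (intro integral_mono integrable_abs int_x[OF gim y0]) (use gim(2) upd[OF _ y0] in auto)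
        finally show ?thesis by (simp add: P.prob_space)
      qed
      then show "integrable (N i) (\<lambda>y. (F y - k)\<^sup>2)" by (rule iF2)
    qed (use last iB in auto)
    finally show "(LINT y|N i. (F y - m)\<^sup>2) \<le> (LINT y|N i. ?B i y)" .
  qed
  also have "\<dots> = (\<Sum>j\<in>insert i I. LINT x|PiM (insert i I) N. (f x - g j x)\<^sup>2)"
    using insert.hyps swap[OF sqm] by simp
  finally show ?case unfolding m_def .
qed

section \<open>Independence of the sources of randomness\<close>

lemma Int_stable_vimage: "Int_stable {f -` A \<inter> \<Omega> |A. A \<in> sets N}"
proof (rule Int_stableI)
  fix a b assume "a \<in> {f -` A \<inter> \<Omega> |A. A \<in> sets N}" "b \<in> {f -` A \<inter> \<Omega> |A. A \<in> sets N}"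
  then obtain A B where "A \<in> sets N" "a = f -` A \<inter> \<Omega>" "B \<in> sets N" "b = f -` B \<inter> \<Omega>" by auto
  then show "a \<inter> b \<in> {f -` A \<inter> \<Omega> |A. A \<in> sets N}" by (auto intro!: exI[of _ "A \<inter> B"])
qed

context weighted_random_graph
begin

definition source_events :: "source \<Rightarrow> 'w set set" where
  "source_events i = (case i of
      EdgeState h \<Rightarrow> {Z h -` A \<inter> space M |A. A \<in> sets (count_space UNIV)}
    | EdgeWeight h \<Rightarrow> {W h -` A \<inter> space M |A. A \<in> sets borel}
    | Mark u \<Rightarrow> {X u -` A \<inter> space M |A. A \<in> sets S})"

definition sources :: "source set" where
  "sources = EdgeState ` complete_edges n \<union> EdgeWeight ` complete_edges n \<union> Mark ` {1..n}"

text \<open>The sigma-algebra of the information carried by the sources in K. Measurability with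
  respect to it says that a variable depends on these sources only, so all independence claims
  reduce to disjointness of index sets.\<close>

definition known :: "source set \<Rightarrow> 'w measure" where
  "known K = sigma (space M) (\<Union>i\<in>K. source_events i)"

lemma source_events_space: "source_events i \<subseteq> Pow (space M)"
  by (auto simp: source_events_def split: source.splits)

lemma space_known [simp]: "space (known K) = space M"
  unfolding known_def using source_events_space by (intro space_measure_of) auto

lemma sets_known: "sets (known K) = sigma_sets (space M) (\<Union>i\<in>K. source_events i)"
  unfolding known_def using source_events_space by (intro sets_measure_of) auto

lemma indep_source_events: "indep_sets source_events sources"
  using independent unfolding source_events_def[abs_def] sources_def .

lemma subalgebra_known:
  assumes "K \<subseteq> sources"
  shows "subalgebra M (known K)"
proof -
  have "source_events i \<subseteq> events" if "i \<in> K" for i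
    using indep_source_events that assms by (auto simp: indep_sets_def)
  then have "sigma_sets (space M) (\<Union>i\<in>K. source_events i) \<subseteq> events"
    by (intro sets.sigma_sets_subset) auto
  then show ?thesis by (simp add: subalgebra_def sets_known)
qed

lemma measurable_known: "f \<in> known K \<rightarrow>\<^sub>M N \<Longrightarrow> K \<subseteq> sources \<Longrightarrow> f \<in> M \<rightarrow>\<^sub>M N"
  using measurable_from_subalg subalgebra_known by blast

lemma measurable_known_mono: "f \<in> known K \<rightarrow>\<^sub>M N \<Longrightarrow> K \<subseteq> K' \<Longrightarrow> f \<in> known K' \<rightarrow>\<^sub>M N"
  by (rule measurable_from_subalg[of "known K'"])
    (auto simp: subalgebra_def sets_known intro!: sigma_sets_mono' )

lemma known_source:
  assumes "f \<in> space M \<rightarrow> space N"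
    and "\<And>A. A \<in> sets N \<Longrightarrow> f -` A \<inter> space M \<in> source_events i" and "i \<in> K"
  shows "f \<in> known K \<rightarrow>\<^sub>M N"
  using assms by (intro measurableI) (auto simp: sets_known)

lemma state_known:
  "h \<in> complete_edges n \<Longrightarrow> EdgeState h \<in> K \<Longrightarrow> Z h \<in> known K \<rightarrow>\<^sub>M count_space UNIV"
  by (rule known_source[of _ _ "EdgeState h"]) (auto simp: source_events_def)

lemma weight_known:
  "h \<in> complete_edges n \<Longrightarrow> EdgeWeight h \<in> K \<Longrightarrow> W h \<in> known K \<rightarrow>\<^sub>M borel"
  by (rule known_source[of _ _ "EdgeWeight h"]) (auto simp: source_events_def)

lemma mark_space: "u \<in> {1..n} \<Longrightarrow> \<omega> \<in> space M \<Longrightarrow> X u \<omega> \<in> space S"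
  using mark_measurable by (auto dest: measurable_space)

lemma mark_known: "u \<in> {1..n} \<Longrightarrow> Mark u \<in> K \<Longrightarrow> X u \<in> known K \<rightarrow>\<^sub>M S"
  by (rule known_source[of _ _ "Mark u"])
    (use mark_space in \<open>auto simp: source_events_def\<close>)

text \<open>Grouping principle: disjoint blocks of an independent family of intersection-stable
  systems generate independent sigma-algebras.\<close>

lemma indep_known:
  assumes "\<And>j. j \<in> J \<Longrightarrow> K j \<subseteq> sources" and "disjoint_family_on K J"
    and "\<And>j. j \<in> J \<Longrightarrow> Y j \<in> known (K j) \<rightarrow>\<^sub>M N j"
  shows "indep_vars N Y J"
proof -
  have "indep_sets (\<lambda>j. sigma_sets (space M) (\<Union>i\<in>K j. source_events i)) J"
  proof (rule indep_sets_collect_sigma)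
    show "indep_sets source_events (\<Union>j\<in>J. K j)"
      by (rule indep_sets_mono_index[OF _ indep_source_events]) (use assms(1) in auto)
    show "Int_stable (source_events i)" for i
      unfolding source_events_def by (cases i) (simp_all only: source.case Int_stable_vimage)
  qed (rule assms(2))
  then show ?thesis
    unfolding indep_vars_def2
  proof (intro conjI ballI)
    fix j assume j: "j \<in> J"
    then show "random_variable (N j) (Y j)" using assms(1,3) measurable_known by blast
  next
    assume "indep_sets (\<lambda>j. sigma_sets (space M) (\<Union>i\<in>K j. source_events i)) J"
    then show "indep_sets (\<lambda>i. {Y i -` A \<inter> space M |A. A \<in> sets (N i)}) J"
      by (rule indep_sets_mono_sets) (use measurable_sets[OF assms(3)] in \<open>auto simp: sets_known\<close>)
  qed
qed

lemma nn_integral_prod_known: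
  fixes Y :: "'j \<Rightarrow> 'w \<Rightarrow> ennreal"
  assumes "finite J" and "\<And>j. j \<in> J \<Longrightarrow> K j \<subseteq> sources" and "disjoint_family_on K J"
    and "\<And>j. j \<in> J \<Longrightarrow> Y j \<in> borel_measurable (known (K j))"
  shows "(\<integral>\<^sup>+\<omega>. (\<Prod>j\<in>J. Y j \<omega>) \<partial>M) = (\<Prod>j\<in>J. \<integral>\<^sup>+\<omega>. Y j \<omega> \<partial>M)"
  using assms(1) indep_known[OF assms(2-4)] by (intro indep_vars_nn_integral) auto

lemma nn_integral_mult_known:
  fixes Y1 Y2 :: "'w \<Rightarrow> ennreal"
  assumes "K1 \<subseteq> sources" "K2 \<subseteq> sources" "K1 \<inter> K2 = {}"
    and "Y1 \<in> borel_measurable (known K1)" "Y2 \<in> borel_measurable (known K2)"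
  shows "(\<integral>\<^sup>+\<omega>. Y1 \<omega> * Y2 \<omega> \<partial>M) = (\<integral>\<^sup>+\<omega>. Y1 \<omega> \<partial>M) * (\<integral>\<^sup>+\<omega>. Y2 \<omega> \<partial>M)"
proof -
  have "(\<integral>\<^sup>+\<omega>. (\<Prod>j\<in>UNIV. case_bool Y1 Y2 j \<omega>) \<partial>M) = (\<Prod>j\<in>UNIV. \<integral>\<^sup>+\<omega>. case_bool Y1 Y2 j \<omega> \<partial>M)"
    by (rule nn_integral_prod_known[where K="case_bool K1 K2"])
      (use assms in \<open>auto simp: disjoint_family_on_def split: bool.splits\<close>)
  then show ?thesis by (simp add: UNIV_bool mult.commute)
qed

text \<open>Independence as a product law for values in arbitrary measurable spaces, as the marks
  require. Both laws are finite, so it is enough to compare them on rectangles.\<close>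

lemma distr_pair_known:
  assumes K: "K1 \<subseteq> sources" "K2 \<subseteq> sources" "K1 \<inter> K2 = {}"
    and Y: "Y1 \<in> known K1 \<rightarrow>\<^sub>M N1" "Y2 \<in> known K2 \<rightarrow>\<^sub>M N2"
  shows "distr M N1 Y1 \<Otimes>\<^sub>M distr M N2 Y2 = distr M (N1 \<Otimes>\<^sub>M N2) (\<lambda>\<omega>. (Y1 \<omega>, Y2 \<omega>))"
proof -
  have [measurable]: "Y1 \<in> M \<rightarrow>\<^sub>M N1" "Y2 \<in> M \<rightarrow>\<^sub>M N2" using measurable_known Y K by blast+
  interpret D1: prob_space "distr M N1 Y1" by (rule prob_space_distr) measurable
  interpret D2: prob_space "distr M N2 Y2" by (rule prob_space_distr) measurable
  show ?thesis
  proof (rule pair_measure_eqI)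
    fix A B assume "A \<in> sets (distr M N1 Y1)" "B \<in> sets (distr M N2 Y2)"
    then have AB[measurable]: "A \<in> sets N1" "B \<in> sets N2" by auto
    have "emeasure (distr M (N1 \<Otimes>\<^sub>M N2) (\<lambda>\<omega>. (Y1 \<omega>, Y2 \<omega>))) (A \<times> B)
      = (\<integral>\<^sup>+z. indicator (A \<times> B) z \<partial>distr M (N1 \<Otimes>\<^sub>M N2) (\<lambda>\<omega>. (Y1 \<omega>, Y2 \<omega>)))"
      by (rule nn_integral_indicator[symmetric]) auto
    also have "\<dots> = (\<integral>\<^sup>+\<omega>. indicator A (Y1 \<omega>) * indicator B (Y2 \<omega>) \<partial>M)"
      by (subst nn_integral_distr) (auto simp: indicator_times)
    also have "\<dots> = (\<integral>\<^sup>+\<omega>. indicator A (Y1 \<omega>) \<partial>M) * (\<integral>\<^sup>+\<omega>. indicator B (Y2 \<omega>) \<partial>M)"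
      by (rule nn_integral_mult_known[OF K])
        (use measurable_compose[OF Y(1) borel_measurable_indicator[OF AB(1)]]
          measurable_compose[OF Y(2) borel_measurable_indicator[OF AB(2)]] in auto)
    also have "\<dots> = emeasure (distr M N1 Y1) A * emeasure (distr M N2 Y2) B"
      by (simp add: nn_integral_distr[symmetric, of _ M N1] nn_integral_distr[symmetric, of _ M N2])
    finally show "emeasure (distr M N1 Y1) A * emeasure (distr M N2 Y2) B
      = emeasure (distr M (N1 \<Otimes>\<^sub>M N2) (\<lambda>\<omega>. (Y1 \<omega>, Y2 \<omega>))) (A \<times> B)" by simp
  qed (auto intro: D1.sigma_finite_measure_axioms D2.sigma_finite_measure_axioms)
qed

text \<open>Freezing: the mark of v is independent of everything in K, so by Fubini it can be
  averaged with the mark of w held fixed. The bound b is uniform in that fixed mark and comes out of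
  the integral.\<close>

lemma integrate_out_mark:
  fixes Y :: "'w \<Rightarrow> ennreal" and g :: "'m \<Rightarrow> 'm \<Rightarrow> ennreal"
  assumes K: "K \<subseteq> sources" "Mark v \<notin> K" and v: "v \<in> {1..n}" and w: "w \<in> {1..n}" "Mark w \<in> K"
    and Y: "Y \<in> borel_measurable (known K)"
    and g[measurable]: "case_prod g \<in> borel_measurable (S \<Otimes>\<^sub>M S)"
    and b: "\<And>x. x \<in> space S \<Longrightarrow> (\<integral>\<^sup>+\<omega>. g x (X v \<omega>) \<partial>M) \<le> b"
  shows "(\<integral>\<^sup>+\<omega>. Y \<omega> * g (X w \<omega>) (X v \<omega>) \<partial>M) \<le> (\<integral>\<^sup>+\<omega>. Y \<omega> \<partial>M) * b"
proof -
  let ?YX = "\<lambda>\<omega>. (Y \<omega>, X w \<omega>)"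
  have YXk: "?YX \<in> known K \<rightarrow>\<^sub>M borel \<Otimes>\<^sub>M S"
    using Y mark_known[OF w] by (rule measurable_Pair)
  have Xv: "Mark v \<in> sources" using v by (auto simp: sources_def)
  have YX[measurable]: "?YX \<in> M \<rightarrow>\<^sub>M borel \<Otimes>\<^sub>M S" using YXk K(1) by (rule measurable_known)
  have Xm[measurable]: "X v \<in> M \<rightarrow>\<^sub>M S" by (rule mark_measurable[OF v])
  have Ym[measurable]: "Y \<in> borel_measurable M" using Y K(1) by (rule measurable_known)
  interpret S': prob_space "distr M S (X v)" by (rule prob_space_distr) fact
  have eq: "distr M (borel \<Otimes>\<^sub>M S) ?YX \<Otimes>\<^sub>M distr M S (X v)
      = distr M ((borel \<Otimes>\<^sub>M S) \<Otimes>\<^sub>M S) (\<lambda>\<omega>. (?YX \<omega>, X v \<omega>))"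
    by (rule distr_pair_known[OF K(1) _ _ YXk mark_known[of v "{Mark v}"]]) (use v Xv K in auto)
  let ?G = "\<lambda>z. fst (fst z) * g (snd (fst z)) (snd z) :: ennreal"
  have Gm[measurable]: "?G \<in> borel_measurable ((borel \<Otimes>\<^sub>M S) \<Otimes>\<^sub>M S)"
    by (intro borel_measurable_times_ennreal measurable_Pair_compose_split[OF g]) measurable
  have "(\<integral>\<^sup>+\<omega>. Y \<omega> * g (X w \<omega>) (X v \<omega>) \<partial>M)
      = (\<integral>\<^sup>+z. ?G z \<partial>(distr M (borel \<Otimes>\<^sub>M S) ?YX \<Otimes>\<^sub>M distr M S (X v)))"
    unfolding eq by (subst nn_integral_distr) auto
  also have "\<dots> = (\<integral>\<^sup>+a. \<integral>\<^sup>+x'. ?G (a, x') \<partial>distr M S (X v) \<partial>distr M (borel \<Otimes>\<^sub>M S) ?YX)"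
    by (rule S'.nn_integral_fst[symmetric]) measurable
  also have "\<dots> = (\<integral>\<^sup>+\<omega>. \<integral>\<^sup>+\<omega>'. Y \<omega> * g (X w \<omega>) (X v \<omega>') \<partial>M \<partial>M)"
    by (subst nn_integral_distr) (auto simp: nn_integral_distr intro!: nn_integral_cong)
  also have "\<dots> \<le> (\<integral>\<^sup>+\<omega>. Y \<omega> * b \<partial>M)"
  proof (rule nn_integral_mono)
    fix \<omega> assume \<omega>: "\<omega> \<in> space M"
    then have x: "X w \<omega> \<in> space S" using mark_space w by auto
    have "(\<integral>\<^sup>+\<omega>'. Y \<omega> * g (X w \<omega>) (X v \<omega>') \<partial>M) = Y \<omega> * (\<integral>\<^sup>+\<omega>'. g (X w \<omega>) (X v \<omega>') \<partial>M)"
      using x by (intro nn_integral_cmult) measurable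
    also have "\<dots> \<le> Y \<omega> * b" using b[OF x] by (intro mult_left_mono) auto
    finally show "(\<integral>\<^sup>+\<omega>'. Y \<omega> * g (X w \<omega>) (X v \<omega>') \<partial>M) \<le> Y \<omega> * b" .
  qed
  also have "\<dots> = (\<integral>\<^sup>+\<omega>. Y \<omega> \<partial>M) * b" by (rule nn_integral_multc) measurable
  finally show ?thesis .
qed

end

section \<open>Degrees and mark costs\<close>

lemma sum_edges_at:
  fixes g :: "nat set \<Rightarrow> 'a::comm_monoid_add"
  assumes "u \<in> {1..n}"
  shows "(\<Sum>h\<in>{h \<in> complete_edges n. u \<in> h}. g h) = (\<Sum>v\<in>{1..n} - {u}. g {u, v})"
proof (rule sum.reindex_bij_witness[of _ "\<lambda>v. {u, v}" "\<lambda>h. THE v. h = {u, v}"])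
  have the: "(THE v'. {u, v} = {u, v'}) = v" for v by (auto simp: doubleton_eq_iff)
  fix h assume "h \<in> {h \<in> complete_edges n. u \<in> h}"
  then obtain v where v: "h = {u, v}" "v \<in> {1..n}" "v \<noteq> u"
    by (auto simp: complete_edges_def)
  then show "{u, THE v. h = {u, v}} = h" "(THE v. h = {u, v}) \<in> {1..n} - {u}"
    "g {u, THE v. h = {u, v}} = g h" using the[of v] by auto
qed (use assms in \<open>auto simp: doubleton_eq_iff\<close>)

lemma sum_edges_handshake:
  fixes g :: "nat set \<Rightarrow> real"
  assumes "T \<subseteq> complete_edges n"
  shows "(\<Sum>u\<in>{1..n}. \<Sum>h\<in>{h \<in> T. u \<in> h}. g h) = 2 * (\<Sum>h\<in>T. g h)"
proof -
  have fT: "finite T" using assms finite_subset finite_complete_edges by blast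
  have "(\<Sum>u\<in>{1..n}. \<Sum>h\<in>{h \<in> T. u \<in> h}. g h) = (\<Sum>h\<in>T. \<Sum>u\<in>{u \<in> {1..n}. u \<in> h}. g h)"
    by (rule sum.swap_restrict[OF _ fT]) simp
  also have "\<dots> = (\<Sum>h\<in>T. 2 * g h)"
  proof (rule sum.cong[OF refl])
    fix h assume "h \<in> T"
    then obtain u v where uv: "h = {u, v}" "u \<in> {1..n}" "v \<in> {1..n}" "u \<noteq> v"
      using assms complete_edgesE by blast
    then have "{u \<in> {1..n}. u \<in> h} = {u, v}" by auto
    then show "(\<Sum>u\<in>{u \<in> {1..n}. u \<in> h}. g h) = 2 * g h" using uv(4) by simp
  qed
  finally show ?thesis by (simp add: sum_distrib_left)
qed

lemma sum_power_card_Pow: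
  assumes "finite V"
  shows "(\<Sum>A\<in>Pow V. x ^ card A) = (1 + x :: 'a::comm_semiring_1) ^ card V"
  using prod_add[OF assms, of "\<lambda>_. x" "\<lambda>_. 1"] by (simp add: add.commute)

lemma (in prob_space) nn_integral_two_valued:
  assumes "{\<omega> \<in> space M. P \<omega>} \<in> events" "0 \<le> a" "0 \<le> b"
  shows "(\<integral>\<^sup>+\<omega>. ennreal (if P \<omega> then a else b) \<partial>M)
    = ennreal (b + (a - b) * prob {\<omega> \<in> space M. P \<omega>})"
proof -
  let ?A = "{\<omega> \<in> space M. P \<omega>}"
  have "(\<integral>\<^sup>+\<omega>. ennreal (if P \<omega> then a else b) \<partial>M)
      = (\<integral>\<^sup>+\<omega>. ennreal a * indicator ?A \<omega> + ennreal b * indicator (space M - ?A) \<omega> \<partial>M)"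
    by (intro nn_integral_cong) (auto simp: indicator_def)
  also have "\<dots> = ennreal a * emeasure M ?A + ennreal b * emeasure M (space M - ?A)"
    using assms(1) by (subst nn_integral_add) (auto simp: nn_integral_cmult)
  also have "\<dots> = ennreal (a * prob ?A + b * (1 - prob ?A))"
    using assms by (simp add: emeasure_eq_measure prob_compl ennreal_mult ennreal_plus)
  finally show ?thesis by (simp add: algebra_simps)
qed

text \<open>The left side is the exponential moment, at parameter one, of an indicator of
  probability p. It is the factor in the Chernoff bounds for degrees and for marks; the 2 is a bound
  for \<open>exp 1 - 1\<close>.\<close>

lemma exp_two_valued_bound:
  assumes "0 \<le> (p::real)" "p \<le> \<eta>"
  shows "1 + (exp 1 - 1) * p \<le> exp (2 * \<eta>)"
proof -
  have "(exp 1 - 1) * p \<le> 2 * p" using exp_le assms by (intro mult_right_mono) auto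
  then have "1 + (exp 1 - 1) * p \<le> 1 + 2 * \<eta>" using assms by simp
  then show ?thesis using exp_ge_add_one_self[of "2 * \<eta>"] by linarith
qed

context weighted_random_graph
begin

definition mark_cost :: "nat set \<Rightarrow> 'w \<Rightarrow> real" where
  "mark_cost h \<omega> = r (X (Min h) \<omega>) (X (Max h) \<omega>)"

lemma edge_cost_eq: "edge_cost r X W h \<omega> = mark_cost h \<omega> * W h \<omega>"
  by (simp add: edge_cost_def mark_cost_def)

lemma mark_cost_doubleton:
  assumes "u \<in> {1..n}" "v \<in> {1..n}" "\<omega> \<in> space M"
  shows "mark_cost {u, v} \<omega> = r (X u \<omega>) (X v \<omega>)"
  using r_symmetric[of "X u \<omega>" "X v \<omega>"] mark_space assms
  by (auto simp: mark_cost_def min_def max_def)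

lemma mark_cost_pos: "h \<in> complete_edges n \<Longrightarrow> \<omega> \<in> space M \<Longrightarrow> 0 < mark_cost h \<omega>"
  unfolding mark_cost_def using Min_Max_complete_edges mark_space r_positive by metis

lemma r_known:
  assumes "u \<in> {1..n}" "v \<in> {1..n}" "Mark u \<in> K" "Mark v \<in> K"
  shows "(\<lambda>\<omega>. r (X u \<omega>) (X v \<omega>)) \<in> borel_measurable (known K)"
  by (rule measurable_Pair_compose_split[OF r_measurable]) (use assms mark_known in auto)

lemma mark_cost_known:
  assumes "h \<in> complete_edges n" "Mark ` h \<subseteq> K"
  shows "mark_cost h \<in> borel_measurable (known K)"
proof -
  have "Min h \<in> h" "Max h \<in> h" using Min_Max_complete_edges(4)[OF assms(1)] by auto
  then show ?thesis unfolding mark_cost_def[abs_def]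
    using Min_Max_complete_edges(1,2)[OF assms(1)] assms(2) by (intro r_known) auto
qed

lemma mark_sources: "Mark ` {1..n} \<subseteq> sources"
  by (auto simp: sources_def)

text \<open>Chernoff bound at parameter one: the edges at j are independent and each contributes a
  factor \<open>exp (2 * q {j, v})\<close> to the exponential moment of the degree.\<close>

lemma degree_tail:
  assumes j: "j \<in> {1..n}" and D: "(\<Sum>v\<in>{1..n} - {j}. q {j, v}) \<le> D"
  shows "prob {\<omega> \<in> space M. l \<le> real (card {v \<in> {1..n} - {j}. Z {j, v} \<omega>})} \<le> exp (2 * D - l)"
proof -
  let ?V = "{1..n} - {j}"
  let ?deg = "\<lambda>\<omega>. real (card {v \<in> ?V. Z {j, v} \<omega>})"
  have h: "{j, v} \<in> complete_edges n" if "v \<in> ?V" for v using that j by auto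
  have [measurable]: "Z {j, v} \<in> M \<rightarrow>\<^sub>M count_space UNIV" if "v \<in> ?V" for v
    using state_measurable h that by blast
  have deg: "?deg \<omega> = (\<Sum>v\<in>?V. if Z {j, v} \<omega> then 1 else 0)" for \<omega>
    by (simp add: sum.If_cases Int_def conj_commute)
  have expdeg: "ennreal (exp (?deg \<omega>)) = (\<Prod>v\<in>?V. ennreal (if Z {j, v} \<omega> then exp 1 else 1))" for \<omega>
  proof -
    have "exp (?deg \<omega>) = (\<Prod>v\<in>?V. if Z {j, v} \<omega> then exp 1 else 1)"
      unfolding deg by (subst exp_sum) (simp, intro prod.cong, simp_all)
    then show ?thesis by (simp only:, subst prod_ennreal) auto
  qed
  have degm: "?deg \<in> borel_measurable M" unfolding deg by measurable
  have "(\<integral>\<^sup>+\<omega>. ennreal (exp (?deg \<omega>)) \<partial>M)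
      = (\<Prod>v\<in>?V. \<integral>\<^sup>+\<omega>. ennreal (if Z {j, v} \<omega> then exp 1 else 1) \<partial>M)"
    unfolding expdeg
  proof (rule nn_integral_prod_known[where K="\<lambda>v. {EdgeState {j, v}}"])
    show "{EdgeState {j, v}} \<subseteq> sources" if "v \<in> ?V" for v using h[OF that] by (auto simp: sources_def)
    show "(\<lambda>\<omega>. ennreal (if Z {j, v} \<omega> then exp 1 else 1)) \<in> borel_measurable (known {EdgeState {j, v}})"
      if "v \<in> ?V" for v
      by (rule measurable_compose[OF state_known[OF h[OF that]]]) auto
  qed (auto simp: disjoint_family_on_def doubleton_eq_iff)
  also have "\<dots> = (\<Prod>v\<in>?V. ennreal (1 + (exp 1 - 1) * q {j, v}))"
    by (intro prod.cong refl, subst nn_integral_two_valued) (use h state_prob in auto)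
  also have "\<dots> = ennreal (\<Prod>v\<in>?V. 1 + (exp 1 - 1) * q {j, v})"
    using edge_prob_bounds h by (intro prod_ennreal) (auto intro!: add_nonneg_nonneg mult_nonneg_nonneg simp: less_imp_le)
  also have "\<dots> \<le> ennreal (\<Prod>v\<in>?V. exp (2 * q {j, v}))"
    using edge_prob_bounds h
    by (intro ennreal_leI prod_mono conjI exp_two_valued_bound)
      (auto intro!: add_nonneg_nonneg mult_nonneg_nonneg simp: less_imp_le)
  also have "\<dots> = ennreal (exp (2 * (\<Sum>v\<in>?V. q {j, v})))"
    by (simp add: exp_sum sum_distrib_left)
  also have "\<dots> \<le> ennreal (exp (2 * D))" using D by (intro ennreal_leI) simp
  finally have E: "(\<integral>\<^sup>+\<omega>. ennreal (exp (?deg \<omega>)) \<partial>M) \<le> ennreal (exp (2 * D))" .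
  have "emeasure M {\<omega> \<in> space M. l \<le> ?deg \<omega>} = (\<integral>\<^sup>+\<omega>. indicator {\<omega> \<in> space M. l \<le> ?deg \<omega>} \<omega> \<partial>M)"
    using degm by (intro nn_integral_indicator[symmetric]) measurable
  also have "\<dots> \<le> (\<integral>\<^sup>+\<omega>. ennreal (exp (- l)) * ennreal (exp (?deg \<omega>)) \<partial>M)"
  proof (rule nn_integral_mono)
    fix \<omega>
    have "1 \<le> ennreal (exp (- l + ?deg \<omega>))" if "l \<le> ?deg \<omega>"
      using that ennreal_leI[of 1 "exp (- l + ?deg \<omega>)"] by simp
    then show "indicator {\<omega> \<in> space M. l \<le> ?deg \<omega>} \<omega> \<le> ennreal (exp (- l)) * ennreal (exp (?deg \<omega>))"
      unfolding exp_add by (simp add: indicator_def ennreal_mult)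
  qed
  also have "\<dots> = ennreal (exp (- l)) * (\<integral>\<^sup>+\<omega>. ennreal (exp (?deg \<omega>)) \<partial>M)"
    using degm by (intro nn_integral_cmult) measurable
  also have "\<dots> \<le> ennreal (exp (- l)) * ennreal (exp (2 * D))" using E by (intro mult_left_mono) auto
  also have "\<dots> = ennreal (exp (2 * D - l))"
    unfolding ennreal_mult[OF exp_ge_zero exp_ge_zero, symmetric] exp_add[symmetric]
    by (simp add: algebra_simps)
  finally show ?thesis by (simp add: emeasure_eq_measure)
qed

lemma nn_integral_mark:
  assumes "v \<in> {1..n}" "w \<in> {1..n}" and [measurable]: "g \<in> borel_measurable S"
  shows "(\<integral>\<^sup>+\<omega>. g (X v \<omega>) \<partial>M) = (\<integral>\<^sup>+\<omega>. g (X w \<omega>) \<partial>M)"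
proof -
  have *: "(\<integral>\<^sup>+\<omega>. g (X u \<omega>) \<partial>M) = (\<integral>\<^sup>+x. g x \<partial>distr M S (X u))" if "u \<in> {1..n}" for u
    by (rule nn_integral_distr[symmetric]) (use mark_measurable[OF that] in auto)
  show ?thesis unfolding *[OF assms(1)] *[OF assms(2)] mark_ident[OF assms(1,2)] ..
qed

lemma mark_tail_exp_bound:
  assumes x: "x \<in> space S" and v: "v \<in> {1..n}"
    and \<eta>: "\<And>x. x \<in> space S \<Longrightarrow> prob {\<omega> \<in> space M. t < r x (X 1 \<omega>)} \<le> \<eta>"
  shows "(\<integral>\<^sup>+\<omega>. ennreal (if t < r x (X v \<omega>) then exp 1 else 1) \<partial>M) \<le> ennreal (exp (2 * \<eta>))"
proof -
  have 1: "1 \<in> {1..n}" using v by auto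
  have rx[measurable]: "(\<lambda>y. r x y) \<in> borel_measurable S"
    using measurable_compose[OF measurable_Pair1'[OF x] r_measurable] by simp
  have [measurable]: "X 1 \<in> M \<rightarrow>\<^sub>M S" by (rule mark_measurable[OF 1])
  have "(\<integral>\<^sup>+\<omega>. ennreal (if t < r x (X v \<omega>) then exp 1 else 1) \<partial>M)
      = (\<integral>\<^sup>+\<omega>. ennreal (if t < r x (X 1 \<omega>) then exp 1 else 1) \<partial>M)"
    by (rule nn_integral_mark[OF v 1]) measurable
  also have "\<dots> = ennreal (1 + (exp 1 - 1) * prob {\<omega> \<in> space M. t < r x (X 1 \<omega>)})"
    by (subst nn_integral_two_valued; (measurable | simp))
  also have "\<dots> \<le> ennreal (exp (2 * \<eta>))"
    by (intro ennreal_leI exp_two_valued_bound \<eta>[OF x]) auto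
  finally show ?thesis .
qed

text \<open>The factors all share the mark of w and are not independent, so they are integrated out
  one vertex at a time with that mark frozen; the tail bound \<eta> is uniform in it.\<close>

lemma mark_tail_prod_bound:
  fixes Y :: "'w \<Rightarrow> ennreal"
  assumes w: "w \<in> {1..n}" "Mark w \<in> K" and K: "K \<subseteq> sources" and Y: "Y \<in> borel_measurable (known K)"
    and \<eta>: "\<And>x. x \<in> space S \<Longrightarrow> prob {\<omega> \<in> space M. t < r x (X 1 \<omega>)} \<le> \<eta>"
    and U: "finite U" "U \<subseteq> {1..n}" "\<And>v. v \<in> U \<Longrightarrow> Mark v \<notin> K"
  shows "(\<integral>\<^sup>+\<omega>. Y \<omega> * (\<Prod>v\<in>U. ennreal (if t < r (X w \<omega>) (X v \<omega>) then exp 1 else 1)) \<partial>M)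
    \<le> (\<integral>\<^sup>+\<omega>. Y \<omega> \<partial>M) * ennreal (exp (2 * \<eta>)) ^ card U"
  using U
proof (induction U)
  case (insert v U)
  let ?K = "K \<union> Mark ` U"
  let ?g = "\<lambda>x y. ennreal (if t < r x y then exp 1 else 1)"
  let ?Y = "\<lambda>\<omega>. Y \<omega> * (\<Prod>v\<in>U. ?g (X w \<omega>) (X v \<omega>))"
  have gm: "case_prod ?g \<in> borel_measurable (S \<Otimes>\<^sub>M S)"
    using r_measurable by measurable
  have Yk: "?Y \<in> borel_measurable (known ?K)"
  proof (intro borel_measurable_times_ennreal borel_measurable_prod_ennreal)
    show "Y \<in> borel_measurable (known ?K)" using Y by (rule measurable_known_mono) auto
    show "(\<lambda>\<omega>. ?g (X w \<omega>) (X v \<omega>)) \<in> borel_measurable (known ?K)" if "v \<in> U" for v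
      by (rule measurable_Pair_compose_split[OF gm]; rule mark_known) (use that insert.prems w in auto)
  qed
  have "(\<integral>\<^sup>+\<omega>. Y \<omega> * (\<Prod>v\<in>insert v U. ?g (X w \<omega>) (X v \<omega>)) \<partial>M)
      = (\<integral>\<^sup>+\<omega>. ?Y \<omega> * ?g (X w \<omega>) (X v \<omega>) \<partial>M)"
    using insert.hyps by (intro nn_integral_cong) (simp add: mult_ac)
  also have "\<dots> \<le> (\<integral>\<^sup>+\<omega>. ?Y \<omega> \<partial>M) * ennreal (exp (2 * \<eta>))"
  proof (rule integrate_out_mark[OF _ _ _ w(1) _ Yk gm])
    show "?K \<subseteq> sources" using K insert.prems by (auto simp: sources_def)
    show "(\<integral>\<^sup>+\<omega>. ?g x (X v \<omega>) \<partial>M) \<le> ennreal (exp (2 * \<eta>))" if "x \<in> space S" for x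
      by (rule mark_tail_exp_bound[OF that _ \<eta>]) (use insert.prems in auto)
  qed (use insert w in auto)
  also have "\<dots> \<le> ((\<integral>\<^sup>+\<omega>. Y \<omega> \<partial>M) * ennreal (exp (2 * \<eta>)) ^ card U) * ennreal (exp (2 * \<eta>))"
    by (intro mult_right_mono insert.IH) (use insert.prems in auto)
  finally show ?case using insert.hyps by (simp add: mult_ac)
qed simp

end

section \<open>Connectivity of the subgraph of cheap edges\<close>

context weighted_random_graph
begin

definition cut_edges :: "nat set \<Rightarrow> nat set \<Rightarrow> nat set set \<Rightarrow> nat set set" where
  "cut_edges V A R = {e \<in> R. \<exists>a\<in>A. \<exists>b\<in>V - A. e = {a, b}}"

text \<open>A vertex of A faces at least n/2 vertices across the cut and loses at most \<delta>n of
  them to pairs outside R. At least \<gamma>0 n are left, and the degree hypothesis gives each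
  vertex of A the weight a.\<close>

lemma cut_weight:
  assumes deg: "\<And>u A. u \<in> {1..n} \<Longrightarrow> A \<subseteq> {1..n} \<Longrightarrow> \<gamma>0 * real n \<le> real (card A) \<Longrightarrow>
      a \<le> (\<Sum>v\<in>A - {u}. q {u, v})"
    and R: "R \<subseteq> complete_edges n" and \<delta>: "\<delta> + \<gamma>0 \<le> 1 / 2"
    and good: "\<And>w. w \<in> {1..n} \<Longrightarrow> real (card {v \<in> {1..n} - {w}. {w, v} \<notin> R}) \<le> \<delta> * real n"
    and A: "A \<subseteq> {1..n}" "2 * card A \<le> n"
  shows "real (card A) * a \<le> (\<Sum>e\<in>cut_edges {1..n} A R. q e)"
proof -
  define N where "N u = {v \<in> {1..n} - A. {u, v} \<in> R}" for u
  have "a \<le> (\<Sum>v\<in>N u. q {u, v})" if u: "u \<in> A" for u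
  proof -
    have fin: "finite A" using A(1) finite_subset by blast
    have "{1..n} - A \<subseteq> N u \<union> {v \<in> {1..n} - {u}. {u, v} \<notin> R}" using u by (auto simp: N_def)
    then have "card ({1..n} - A) \<le> card (N u \<union> {v \<in> {1..n} - {u}. {u, v} \<notin> R})"
      by (intro card_mono) (auto simp: N_def)
    also have "\<dots> \<le> card (N u) + card {v \<in> {1..n} - {u}. {u, v} \<notin> R}" by (rule card_Un_le)
    finally have "real n - real (card A) \<le> real (card (N u)) + \<delta> * real n"
      using good[of u] u A fin by (auto simp: card_Diff_subset)
    moreover have "(\<delta> + \<gamma>0) * real n \<le> 1 / 2 * real n" using \<delta> by (intro mult_right_mono) auto
    moreover have "real (card A) \<le> real n / 2" using A(2) by linarith
    ultimately have "\<gamma>0 * real n \<le> real (card (N u))" by (simp add: algebra_simps)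
    moreover have "N u \<subseteq> {1..n}" by (auto simp: N_def)
    ultimately have "a \<le> (\<Sum>v\<in>N u - {u}. q {u, v})" using deg[of u "N u"] u A(1) by blast
    moreover have "N u - {u} = N u" using u by (auto simp: N_def)
    ultimately show ?thesis by simp
  qed
  then have "real (card A) * a \<le> (\<Sum>u\<in>A. \<Sum>v\<in>N u. q {u, v})"
    using sum_mono[of A "\<lambda>_. a" "\<lambda>u. \<Sum>v\<in>N u. q {u, v}"] by simp
  also have "\<dots> = (\<Sum>p\<in>Sigma A N. q {fst p, snd p})"
    using A(1) by (subst sum.Sigma) (auto simp: N_def case_prod_beta intro: finite_subset)
  \<comment> \<open>No edge is counted twice: exactly one end of a cut edge lies in A.\<close>
  also have "\<dots> = (\<Sum>e\<in>(\<lambda>p. {fst p, snd p}) ` Sigma A N. q e)"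
    by (subst sum.reindex) (auto simp: inj_on_def N_def doubleton_eq_iff)
  also have "\<dots> \<le> (\<Sum>e\<in>cut_edges {1..n} A R. q e)"
  proof (rule sum_mono2)
    show "finite (cut_edges {1..n} A R)"
      using R finite_subset[OF _ finite_complete_edges] by (auto simp: cut_edges_def)
    show "(\<lambda>p. {fst p, snd p}) ` Sigma A N \<subseteq> cut_edges {1..n} A R"
    proof
      fix e assume "e \<in> (\<lambda>p. {fst p, snd p}) ` Sigma A N"
      then obtain u v where "e = {u, v}" "u \<in> A" "v \<in> {1..n} - A" "{u, v} \<in> R" by (auto simp: N_def)
      then show "e \<in> cut_edges {1..n} A R" unfolding cut_edges_def by blast
    qed
    show "0 \<le> q e" if "e \<in> cut_edges {1..n} A R - (\<lambda>p. {fst p, snd p}) ` Sigma A N" for e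
      using that R edge_prob_bounds[of e] by (auto simp: cut_edges_def)
  qed
  finally show ?thesis .
qed

lemma weight_ident:
  assumes "h \<in> complete_edges n"
  shows "prob {\<omega> \<in> space M. W h \<omega> \<le> y} = cdf L y"
proof -
  have [measurable]: "W h \<in> borel_measurable M" using weight_measurable assms .
  show ?thesis
    unfolding cdf_def weight_law[OF assms, symmetric]
    by (subst measure_distr) (auto intro!: arg_cong[where f=prob])
qed

lemma edge_closed_prob:
  assumes h: "h \<in> complete_edges n"
  shows "(\<integral>\<^sup>+\<omega>. ennreal (if Z h \<omega> \<and> W h \<omega> \<le> y then 0 else 1) \<partial>M) = ennreal (1 - q h * cdf L y)"
proof -
  have [measurable]: "W h \<in> borel_measurable M" "Z h \<in> M \<rightarrow>\<^sub>M count_space UNIV"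
    using weight_measurable state_measurable h by auto
  have ev: "{\<omega> \<in> space M. Z h \<omega> \<and> W h \<omega> \<le> y} \<in> events" "{\<omega> \<in> space M. Z h \<omega>} \<in> events"
    "{\<omega> \<in> space M. W h \<omega> \<le> y} \<in> events" by measurable
  have "ennreal (prob {\<omega> \<in> space M. Z h \<omega> \<and> W h \<omega> \<le> y})
      = (\<integral>\<^sup>+\<omega>. ennreal (if Z h \<omega> \<and> W h \<omega> \<le> y then 1 else 0) \<partial>M)"
    by (simp add: nn_integral_two_valued[OF ev(1)])
  also have "\<dots> = (\<integral>\<^sup>+\<omega>. ennreal (if Z h \<omega> then 1 else 0) * ennreal (if W h \<omega> \<le> y then 1 else 0) \<partial>M)"
    by (intro nn_integral_cong) auto
  also have "\<dots> = (\<integral>\<^sup>+\<omega>. ennreal (if Z h \<omega> then 1 else 0) \<partial>M) * (\<integral>\<^sup>+\<omega>. ennreal (if W h \<omega> \<le> y then 1 else 0) \<partial>M)"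
  proof (rule nn_integral_mult_known)
    show "(\<lambda>\<omega>. ennreal (if Z h \<omega> then 1 else 0)) \<in> borel_measurable (known {EdgeState h})"
      by (rule measurable_compose[OF state_known[OF h]]) auto
    show "(\<lambda>\<omega>. ennreal (if W h \<omega> \<le> y then 1 else 0)) \<in> borel_measurable (known {EdgeWeight h})"
      by (rule measurable_compose[OF weight_known[OF h]]) auto
  qed (use h in \<open>auto simp: sources_def\<close>)
  also have "(\<integral>\<^sup>+\<omega>. ennreal (if Z h \<omega> then 1 else 0) \<partial>M) = ennreal (q h)"
    by (simp add: nn_integral_two_valued[OF ev(2)] state_prob[OF h])
  also have "(\<integral>\<^sup>+\<omega>. ennreal (if W h \<omega> \<le> y then 1 else 0) \<partial>M) = ennreal (cdf L y)"
    by (simp add: nn_integral_two_valued[OF ev(3)] weight_ident[OF h])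
  also have "ennreal (q h) * ennreal (cdf L y) = ennreal (q h * cdf L y)"
    using edge_prob_bounds[OF h] by (intro ennreal_mult[symmetric]) (auto simp: cdf_def)
  finally have p: "prob {\<omega> \<in> space M. Z h \<omega> \<and> W h \<omega> \<le> y} = q h * cdf L y"
    using edge_prob_bounds[OF h] by (subst (asm) ennreal_inj) (auto simp: cdf_def)
  show ?thesis
    by (simp add: nn_integral_two_valued[OF ev(1)] p)
qed

text \<open>The edge \<open>h\<close> is left out of the cut so that its own weight, which enters through \<open>g\<close>, stays
  independent of the event bounded.\<close>
lemma disconnected_fixed_marks:
  fixes \<Phi> :: "'w \<Rightarrow> ennreal" and g :: "real \<Rightarrow> ennreal"
  assumes deg: "\<And>u A. u \<in> {1..n} \<Longrightarrow> A \<subseteq> {1..n} \<Longrightarrow> \<gamma>0 * real n \<le> real (card A) \<Longrightarrow>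
      a \<le> (\<Sum>v\<in>A - {u}. q {u, v})"
    and R: "R \<subseteq> complete_edges n" and \<delta>: "\<delta> + \<gamma>0 \<le> 1 / 2"
    and good: "\<And>w. w \<in> {1..n} \<Longrightarrow> real (card {v \<in> {1..n} - {w}. {w, v} \<notin> R}) \<le> \<delta> * real n"
    and h: "h \<in> complete_edges n"
    and \<Phi>: "\<Phi> \<in> borel_measurable (known (Mark ` {1..n}))" and g: "g \<in> borel_measurable borel"
    and z: "z \<le> cdf L y" and a: "0 \<le> a"
  shows "(\<integral>\<^sup>+\<omega>. \<Phi> \<omega> * g (W h \<omega>) *
      (if connected_graph {1..n} {e \<in> R. Z e \<omega> \<and> W e \<omega> \<le> y} then 0 else 1) \<partial>M)
    \<le> (\<integral>\<^sup>+\<omega>. \<Phi> \<omega> \<partial>M) * (\<integral>\<^sup>+\<omega>. g (W h \<omega>) \<partial>M) * ennreal (exp 1 * ((1 + exp (- z * a)) ^ n - 1))"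
proof -
  define C where "C = {A. A \<subseteq> {1..n} \<and> A \<noteq> {} \<and> 2 * card A \<le> n}"
  define D where "D A = cut_edges {1..n} A R - {h}" for A
  define cl where "cl e \<omega> = ennreal (if Z e \<omega> \<and> W e \<omega> \<le> y then 0 else 1)" for e \<omega>
  have finC: "finite C" by (rule finite_subset[of _ "Pow {1..n}"]) (auto simp: C_def)
  have DK: "D A \<subseteq> complete_edges n" for A using R by (auto simp: D_def cut_edges_def)
  then have finD: "finite (D A)" for A using finite_subset finite_complete_edges by blast
  have L1: "cdf L y \<le> 1" "0 \<le> cdf L y"
    using weight_ident[OF h, of y] by (metis prob_le_1, metis measure_nonneg)
  have gW: "(\<lambda>\<omega>. g (W h \<omega>)) \<in> borel_measurable (known {EdgeWeight h})"
    by (rule measurable_compose[OF weight_known[OF h] g]) simp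
  have cl_known: "cl e \<in> borel_measurable (known {EdgeState e, EdgeWeight e})" if "e \<in> complete_edges n" for e
  proof -
    have [measurable]: "Z e \<in> known {EdgeState e, EdgeWeight e} \<rightarrow>\<^sub>M count_space UNIV"
      "W e \<in> borel_measurable (known {EdgeState e, EdgeWeight e})"
      using state_known weight_known that by auto
    show ?thesis unfolding cl_def by measurable
  qed
  have prod_cl_known: "(\<lambda>\<omega>. \<Prod>e\<in>D A. cl e \<omega>) \<in> borel_measurable (known (\<Union>e\<in>D A. {EdgeState e, EdgeWeight e}))" for A
    by (intro borel_measurable_prod_ennreal measurable_known_mono[OF cl_known]) (use DK in auto)
  have \<Phi>M: "\<Phi> \<in> borel_measurable M" by (rule measurable_known[OF \<Phi> mark_sources])
  have gM: "(\<lambda>\<omega>. g (W h \<omega>)) \<in> borel_measurable M"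
    using weight_measurable[OF h] g by (rule measurable_compose)
  have clM: "cl e \<in> borel_measurable M" if "e \<in> complete_edges n" for e
    by (rule measurable_known[OF cl_known[OF that]]) (use that in \<open>auto simp: sources_def\<close>)
  \<comment> \<open>Union bound: if the graph is disconnected, all edges of some cut are closed, and
    one side of that cut has at most half of the vertices.\<close>
  have cut: "(if connected_graph {1..n} {e \<in> R. Z e \<omega> \<and> W e \<omega> \<le> y} then 0 else 1)
      \<le> (\<Sum>A\<in>C. \<Prod>e\<in>D A. cl e \<omega>)" for \<omega>
  proof (cases "connected_graph {1..n} {e \<in> R. Z e \<omega> \<and> W e \<omega> \<le> y}")
    case False
    obtain A where A: "A \<subseteq> {1..n}" "A \<noteq> {}" "2 * card A \<le> card {1..n}"
      "\<And>a b. a \<in> A \<Longrightarrow> b \<in> {1..n} - A \<Longrightarrow> {a, b} \<notin> {e \<in> R. Z e \<omega> \<and> W e \<omega> \<le> y}"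
      by (rule disconnected_cut[OF False finite_atLeastAtMost]) (rule that)
    have "cl e \<omega> = 1" if "e \<in> D A" for e
      using that A(4) by (auto simp: D_def cut_edges_def cl_def)
    then have "1 = (\<Prod>e\<in>D A. cl e \<omega>)" by simp
    also have "\<dots> \<le> (\<Sum>A\<in>C. \<Prod>e\<in>D A. cl e \<omega>)"
      by (rule member_le_sum) (use A finC in \<open>auto simp: C_def\<close>)
    finally show ?thesis using False by simp
  qed simp
  have each: "(\<integral>\<^sup>+\<omega>. \<Phi> \<omega> * g (W h \<omega>) * (\<Prod>e\<in>D A. cl e \<omega>) \<partial>M)
      \<le> (\<integral>\<^sup>+\<omega>. \<Phi> \<omega> \<partial>M) * (\<integral>\<^sup>+\<omega>. g (W h \<omega>) \<partial>M) * ennreal (exp 1 * exp (- z * a) ^ card A)"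
    if A: "A \<in> C" for A
  proof -
    have "(\<integral>\<^sup>+\<omega>. \<Phi> \<omega> * g (W h \<omega>) * (\<Prod>e\<in>D A. cl e \<omega>) \<partial>M)
        = (\<integral>\<^sup>+\<omega>. \<Phi> \<omega> * g (W h \<omega>) \<partial>M) * (\<integral>\<^sup>+\<omega>. (\<Prod>e\<in>D A. cl e \<omega>) \<partial>M)"
    proof (rule nn_integral_mult_known[OF _ _ _ _ prod_cl_known])
      show "(\<lambda>\<omega>. \<Phi> \<omega> * g (W h \<omega>)) \<in> borel_measurable (known (insert (EdgeWeight h) (Mark ` {1..n})))"
        by (intro borel_measurable_times_ennreal measurable_known_mono[OF \<Phi>] measurable_known_mono[OF gW]) auto
    qed (use h DK[of A] mark_sources in \<open>auto simp: sources_def D_def\<close>)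
    also have "(\<integral>\<^sup>+\<omega>. \<Phi> \<omega> * g (W h \<omega>) \<partial>M) = (\<integral>\<^sup>+\<omega>. \<Phi> \<omega> \<partial>M) * (\<integral>\<^sup>+\<omega>. g (W h \<omega>) \<partial>M)"
      by (rule nn_integral_mult_known[OF _ _ _ \<Phi> gW]) (use h in \<open>auto simp: sources_def\<close>)
    also have "(\<integral>\<^sup>+\<omega>. (\<Prod>e\<in>D A. cl e \<omega>) \<partial>M) = (\<Prod>e\<in>D A. \<integral>\<^sup>+\<omega>. cl e \<omega> \<partial>M)"
    proof (rule nn_integral_prod_known[where K="\<lambda>e. {EdgeState e, EdgeWeight e}" and Y=cl, OF finD])
      show "{EdgeState e, EdgeWeight e} \<subseteq> sources" if "e \<in> D A" for e
        using that DK by (auto simp: sources_def)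
      show "cl e \<in> borel_measurable (known {EdgeState e, EdgeWeight e})" if "e \<in> D A" for e
        using that DK cl_known by blast
    qed (auto simp: disjoint_family_on_def)
    also have "\<dots> = (\<Prod>e\<in>D A. ennreal (1 - q e * cdf L y))"
      unfolding cl_def using DK by (intro prod.cong refl edge_closed_prob) auto
    also have "\<dots> \<le> (\<Prod>e\<in>D A. ennreal (exp (- (q e * cdf L y))))"
    proof (intro prod_mono_ennreal ennreal_leI)
      show "1 - q e * cdf L y \<le> exp (- (q e * cdf L y))" for e
        using exp_ge_add_one_self[of "- (q e * cdf L y)"] by simp
    qed
    also have "\<dots> = ennreal (exp (- cdf L y * (\<Sum>e\<in>D A. q e)))"
    proof -
      have "- cdf L y * (\<Sum>e\<in>D A. q e) = (\<Sum>e\<in>D A. - (q e * cdf L y))"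
        by (simp add: sum_distrib_left sum_negf mult.commute)
      then show ?thesis using finD by (simp only: exp_sum) (simp add: prod_ennreal)
    qed
    also have "\<dots> \<le> ennreal (exp 1 * exp (- z * a) ^ card A)"
    proof (rule ennreal_leI)
      have fc: "finite (cut_edges {1..n} A R)"
        using R finite_subset[OF _ finite_complete_edges] by (auto simp: cut_edges_def)
      have "real (card A) * a \<le> (\<Sum>e\<in>cut_edges {1..n} A R. q e)"
        by (rule cut_weight[OF deg R \<delta> good]) (use A in \<open>auto simp: C_def\<close>)
      \<comment> \<open>Leaving out h costs at most \<open>q h\<close>, which is below 1; this is
        the origin of the factor \<open>exp 1\<close>.\<close>
      also have "\<dots> \<le> (\<Sum>e\<in>D A. q e) + 1"
        unfolding D_def using fc edge_prob_bounds[OF h] by (simp add: sum_diff1)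
      finally have "real (card A) * a - 1 \<le> (\<Sum>e\<in>D A. q e)" by simp
      then have "cdf L y * (real (card A) * a - 1) \<le> cdf L y * (\<Sum>e\<in>D A. q e)"
        using L1 by (intro mult_left_mono) auto
      moreover have "z * (real (card A) * a) \<le> cdf L y * (real (card A) * a)"
        using z a by (intro mult_right_mono) auto
      ultimately have "- cdf L y * (\<Sum>e\<in>D A. q e) \<le> 1 + real (card A) * (- z * a)"
        using L1 by (simp add: algebra_simps)
      then have "exp (- cdf L y * (\<Sum>e\<in>D A. q e)) \<le> exp (1 + real (card A) * (- z * a))" by simp
      then show "exp (- cdf L y * (\<Sum>e\<in>D A. q e)) \<le> exp 1 * exp (- z * a) ^ card A"
        by (simp only: exp_add exp_of_nat_mult)
    qed
    finally show ?thesis by (simp add: mult_left_mono)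
  qed
  have "(\<integral>\<^sup>+\<omega>. \<Phi> \<omega> * g (W h \<omega>) *
      (if connected_graph {1..n} {e \<in> R. Z e \<omega> \<and> W e \<omega> \<le> y} then 0 else 1) \<partial>M)
    \<le> (\<integral>\<^sup>+\<omega>. (\<Sum>A\<in>C. \<Phi> \<omega> * g (W h \<omega>) * (\<Prod>e\<in>D A. cl e \<omega>)) \<partial>M)"
    unfolding sum_distrib_left[symmetric] by (intro nn_integral_mono mult_left_mono cut) simp
  also have "\<dots> = (\<Sum>A\<in>C. \<integral>\<^sup>+\<omega>. \<Phi> \<omega> * g (W h \<omega>) * (\<Prod>e\<in>D A. cl e \<omega>) \<partial>M)"
    using \<Phi>M gM clM DK
    by (intro nn_integral_sum borel_measurable_times_ennreal borel_measurable_prod_ennreal) auto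
  also have "\<dots> \<le> (\<Sum>A\<in>C. (\<integral>\<^sup>+\<omega>. \<Phi> \<omega> \<partial>M) * (\<integral>\<^sup>+\<omega>. g (W h \<omega>) \<partial>M) * ennreal (exp 1 * exp (- z * a) ^ card A))"
    by (intro sum_mono each)
  also have "\<dots> = (\<integral>\<^sup>+\<omega>. \<Phi> \<omega> \<partial>M) * (\<integral>\<^sup>+\<omega>. g (W h \<omega>) \<partial>M) * ennreal (\<Sum>A\<in>C. exp 1 * exp (- z * a) ^ card A)"
    by (simp add: sum_distrib_left[symmetric] sum_ennreal)
  also have "\<dots> \<le> (\<integral>\<^sup>+\<omega>. \<Phi> \<omega> \<partial>M) * (\<integral>\<^sup>+\<omega>. g (W h \<omega>) \<partial>M) * ennreal (exp 1 * ((1 + exp (- z * a)) ^ n - 1))"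
  proof (intro mult_left_mono ennreal_leI)
    \<comment> \<open>Dropping the size restriction completes the sum to all nonempty sets, where
      the binomial formula applies; the subtracted 1 is the empty set.\<close>
    have "(\<Sum>A\<in>C. exp (- z * a) ^ card A) \<le> (\<Sum>A\<in>Pow {1..n} - {{}}. exp (- z * a) ^ card A)"
      by (intro sum_mono2) (auto simp: C_def)
    also have "\<dots> = (1 + exp (- z * a)) ^ n - 1"
      using sum_power_card_Pow[of "{1..n}" "exp (- z * a)"] by (simp add: sum_diff1)
    finally show "(\<Sum>A\<in>C. exp 1 * exp (- z * a) ^ card A) \<le> exp 1 * ((1 + exp (- z * a)) ^ n - 1)"
      unfolding sum_distrib_left[symmetric] by (rule mult_left_mono) simp
  qed simp
  finally show ?thesis .
qed

end

section \<open>Averaging over the marks\<close>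

context weighted_random_graph
begin

definition cheap_graph :: "real \<Rightarrow> real \<Rightarrow> 'w \<Rightarrow> nat set set" where
  "cheap_graph y t \<omega> = {e \<in> complete_edges n. Z e \<omega> \<and> W e \<omega> \<le> y \<and> mark_cost e \<omega> \<le> t}"

text \<open>Chernoff bound for the number of costly partners of w. The vertices a and b, whose marks
  enter \<Phi>, are left out of the product; this changes the count by at most 2 and gives the 2 in
  the exponent.\<close>

lemma many_expensive_marks:
  fixes \<Phi> :: "'w \<Rightarrow> ennreal"
  assumes ab: "a \<in> {1..n}" "b \<in> {1..n}" and w: "w \<in> {1..n}"
    and \<Phi>: "\<Phi> \<in> borel_measurable (known {Mark a, Mark b})"
    and \<eta>: "\<And>x. x \<in> space S \<Longrightarrow> prob {\<omega> \<in> space M. t < r x (X 1 \<omega>)} \<le> \<eta>" "0 \<le> \<eta>"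
  shows "(\<integral>\<^sup>+\<omega>. \<Phi> \<omega> * (if d < real (card {v \<in> {1..n} - {w}. t < r (X w \<omega>) (X v \<omega>)}) then 1 else 0) \<partial>M)
    \<le> (\<integral>\<^sup>+\<omega>. \<Phi> \<omega> \<partial>M) * ennreal (exp (2 - d + 2 * \<eta> * real n))"
proof -
  define U where "U = {1..n} - {w, a, b}"
  let ?g = "\<lambda>v \<omega>. if t < r (X w \<omega>) (X v \<omega>) then exp 1 else (1::real)"
  have finU: "finite U" by (simp add: U_def)
  have pt: "(if d < real (card {v \<in> {1..n} - {w}. t < r (X w \<omega>) (X v \<omega>)}) then 1 else 0)
      \<le> ennreal (exp (2 - d)) * (\<Prod>v\<in>U. ennreal (?g v \<omega>))" for \<omega>
  proof (cases "d < real (card {v \<in> {1..n} - {w}. t < r (X w \<omega>) (X v \<omega>)})")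
    case True
    let ?B = "{v \<in> U. t < r (X w \<omega>) (X v \<omega>)}"
    have "card {v \<in> {1..n} - {w}. t < r (X w \<omega>) (X v \<omega>)} \<le> card (?B \<union> {a, b})"
      by (intro card_mono) (auto simp: U_def)
    also have "\<dots> \<le> card ?B + card {a, b}" by (rule card_Un_le)
    also have "\<dots> \<le> card ?B + 2" using card_insert_le_m1[of 2 "{b}" a] by simp
    finally have d: "d \<le> real (card ?B) + 2" using True by linarith
    have "(\<Prod>v\<in>U. ?g v \<omega>) = exp (real (card ?B))"
    proof -
      have "exp (\<Sum>v\<in>U. if t < r (X w \<omega>) (X v \<omega>) then 1 else (0::real)) = (\<Prod>v\<in>U. ?g v \<omega>)"
        using finU by (subst exp_sum) (simp, intro prod.cong, simp_all)
      moreover have "(\<Sum>v\<in>U. if t < r (X w \<omega>) (X v \<omega>) then 1 else (0::real)) = real (card ?B)"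
        using finU by (simp add: sum.If_cases Int_def conj_commute)
      ultimately show ?thesis by simp
    qed
    then have "1 \<le> exp (2 - d) * (\<Prod>v\<in>U. ?g v \<omega>)"
      using d unfolding exp_add[symmetric] by (simp add: exp_add[symmetric] del: exp_add)
    then have "ennreal 1 \<le> ennreal (exp (2 - d) * (\<Prod>v\<in>U. ?g v \<omega>))" by (rule ennreal_leI)
    also have "\<dots> = ennreal (exp (2 - d)) * (\<Prod>v\<in>U. ennreal (?g v \<omega>))"
    proof -
      have "(\<Prod>v\<in>U. ennreal (?g v \<omega>)) = ennreal (\<Prod>v\<in>U. ?g v \<omega>)" by (rule prod_ennreal) simp
      then show ?thesis by (simp only:) (rule ennreal_mult, auto intro!: prod_nonneg)
    qed
    finally show ?thesis using True by simp
  qed simp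
  have \<Phi>': "\<Phi> \<in> borel_measurable (known {Mark w, Mark a, Mark b})"
    using \<Phi> by (rule measurable_known_mono) auto
  have src: "{Mark w, Mark a, Mark b} \<subseteq> sources" using ab w by (auto simp: sources_def)
  have "(\<integral>\<^sup>+\<omega>. \<Phi> \<omega> * (if d < real (card {v \<in> {1..n} - {w}. t < r (X w \<omega>) (X v \<omega>)}) then 1 else 0) \<partial>M)
      \<le> (\<integral>\<^sup>+\<omega>. ennreal (exp (2 - d)) * (\<Phi> \<omega> * (\<Prod>v\<in>U. ennreal (?g v \<omega>))) \<partial>M)"
  proof (rule nn_integral_mono)
    fix \<omega>
    show "\<Phi> \<omega> * (if d < real (card {v \<in> {1..n} - {w}. t < r (X w \<omega>) (X v \<omega>)}) then 1 else 0)
      \<le> ennreal (exp (2 - d)) * (\<Phi> \<omega> * (\<Prod>v\<in>U. ennreal (?g v \<omega>)))"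
      using mult_left_mono[OF pt[of \<omega>], of "\<Phi> \<omega>"] by (simp add: mult_ac)
  qed
  also have "\<dots> = ennreal (exp (2 - d)) * (\<integral>\<^sup>+\<omega>. \<Phi> \<omega> * (\<Prod>v\<in>U. ennreal (?g v \<omega>)) \<partial>M)"
  proof (intro nn_integral_cmult borel_measurable_times_ennreal borel_measurable_prod_ennreal)
    show "\<Phi> \<in> borel_measurable M" by (rule measurable_known[OF \<Phi>' src])
    fix v assume "v \<in> U"
    then have "(\<lambda>\<omega>. r (X w \<omega>) (X v \<omega>)) \<in> borel_measurable (known (Mark ` {1..n}))"
      using w by (intro r_known) (auto simp: U_def)
    then have [measurable]: "(\<lambda>\<omega>. r (X w \<omega>) (X v \<omega>)) \<in> borel_measurable M"
      by (rule measurable_known[OF _ mark_sources])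
    show "(\<lambda>\<omega>. ennreal (?g v \<omega>)) \<in> borel_measurable M" by measurable
  qed
  also have "\<dots> \<le> ennreal (exp (2 - d)) * ((\<integral>\<^sup>+\<omega>. \<Phi> \<omega> \<partial>M) * ennreal (exp (2 * \<eta>)) ^ card U)"
    by (intro mult_left_mono mark_tail_prod_bound[OF w _ src \<Phi>' \<eta>(1) finU]) (auto simp: U_def)
  also have "\<dots> \<le> ennreal (exp (2 - d)) * ((\<integral>\<^sup>+\<omega>. \<Phi> \<omega> \<partial>M) * ennreal (exp (2 * \<eta> * real n)))"
  proof (intro mult_left_mono)
    have "card U \<le> card {1..n}" by (intro card_mono) (auto simp: U_def)
    then have "real (card U) * (2 * \<eta>) \<le> real n * (2 * \<eta>)" using \<eta>(2) by (intro mult_right_mono) auto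
    then have "exp (2 * \<eta>) ^ card U \<le> exp (2 * \<eta> * real n)"
      by (simp add: exp_of_nat_mult[symmetric] mult_ac)
    then show "ennreal (exp (2 * \<eta>)) ^ card U \<le> ennreal (exp (2 * \<eta> * real n))"
      by (simp add: ennreal_power ennreal_leI)
  qed auto
  also have "\<dots> = (\<integral>\<^sup>+\<omega>. \<Phi> \<omega> \<partial>M) * ennreal (exp (2 - d + 2 * \<eta> * real n))"
    unfolding exp_add by (simp add: ennreal_mult mult_ac)
  finally show ?thesis .
qed

text \<open>The moment is split over the finitely many values of the set of edges whose mark cost is at
  most \<open>t\<close>; values leaving some vertex with too few such edges are discarded by a Chernoff bound.\<close>
lemma disconnected_moment:
  fixes \<Phi> :: "'w \<Rightarrow> ennreal" and g :: "real \<Rightarrow> ennreal"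
  assumes deg: "\<And>u A. u \<in> {1..n} \<Longrightarrow> A \<subseteq> {1..n} \<Longrightarrow> \<gamma>0 * real n \<le> real (card A) \<Longrightarrow>
      a \<le> (\<Sum>v\<in>A - {u}. q {u, v})"
    and \<delta>: "\<delta> + \<gamma>0 \<le> 1 / 2"
    and h: "h \<in> complete_edges n"
    and \<Phi>: "\<Phi> \<in> borel_measurable (known (Mark ` h))" and g: "g \<in> borel_measurable borel"
    and z: "z \<le> cdf L y" and a: "0 \<le> a"
    and \<eta>: "\<And>x. x \<in> space S \<Longrightarrow> prob {\<omega> \<in> space M. t < r x (X 1 \<omega>)} \<le> \<eta>" "0 \<le> \<eta>"
  shows "(\<integral>\<^sup>+\<omega>. \<Phi> \<omega> * g (W h \<omega>) *
      (if connected_graph {1..n} (cheap_graph y t \<omega>) then 0 else 1) \<partial>M)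
    \<le> (\<integral>\<^sup>+\<omega>. \<Phi> \<omega> \<partial>M) * (\<integral>\<^sup>+\<omega>. g (W h \<omega>) \<partial>M) *
      ennreal (exp 1 * ((1 + exp (- z * a)) ^ n - 1) + real n * exp (2 - \<delta> * real n + 2 * \<eta> * real n))"
proof -
  obtain u v where uv: "h = {u, v}" "u \<in> {1..n}" "v \<in> {1..n}" "u \<noteq> v" using h by (rule complete_edgesE)
  define R where "R \<omega> = {e \<in> complete_edges n. mark_cost e \<omega> \<le> t}" for \<omega>
  define good where "good Q \<longleftrightarrow> (\<forall>w\<in>{1..n}. real (card {v \<in> {1..n} - {w}. {w, v} \<notin> Q}) \<le> \<delta> * real n)" for Q
  define GR where "GR = {Q. Q \<subseteq> complete_edges n \<and> good Q}"
  define I where "I Q \<omega> = (if R \<omega> = Q then 1 else 0 :: ennreal)" for Q \<omega>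
  define disc where "disc Q \<omega> = (if connected_graph {1..n} {e \<in> Q. Z e \<omega> \<and> W e \<omega> \<le> y} then 0 else 1 :: ennreal)" for Q \<omega>
  define bad where "bad \<omega> = (if good (R \<omega>) then 0 else 1 :: ennreal)" for \<omega>
  have finGR: "finite GR" by (rule finite_subset[of _ "Pow (complete_edges n)"]) (auto simp: GR_def)
  have hn: "Mark ` h \<subseteq> Mark ` {1..n}" using uv by auto
  have \<Phi>k: "\<Phi> \<in> borel_measurable (known (Mark ` {1..n}))" by (rule measurable_known_mono[OF \<Phi> hn])
  have \<Phi>M[measurable]: "\<Phi> \<in> borel_measurable M" by (rule measurable_known[OF \<Phi>k mark_sources])
  have mck: "mark_cost e \<in> borel_measurable (known (Mark ` {1..n}))" if "e \<in> complete_edges n" for e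
    by (rule mark_cost_known[OF that]) (use complete_edges_subset[OF that] in auto)
  have pR: "Measurable.pred (known (Mark ` {1..n})) (\<lambda>\<omega>. R \<omega> = Q)" if Q: "Q \<subseteq> complete_edges n" for Q
  proof -
    have [measurable]: "mark_cost e \<in> borel_measurable (known (Mark ` {1..n}))" if "e \<in> complete_edges n" for e
      using mck that .
    have "Measurable.pred (known (Mark ` {1..n})) (\<lambda>\<omega>. \<forall>e\<in>complete_edges n. (mark_cost e \<omega> \<le> t) = (e \<in> Q))"
      by measurable
    moreover have "(\<forall>e\<in>complete_edges n. (mark_cost e \<omega> \<le> t) = (e \<in> Q)) \<longleftrightarrow> R \<omega> = Q" for \<omega>
      using Q by (auto simp: R_def)
    ultimately show ?thesis by simp
  qed
  have Ik: "I Q \<in> borel_measurable (known (Mark ` {1..n}))" if "Q \<in> GR" for Q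
    using pR[of Q] that unfolding I_def GR_def by auto
  have RK: "R \<omega> \<subseteq> complete_edges n" for \<omega> by (auto simp: R_def)
  \<comment> \<open>Exactly one indicator equals 1 when the value of R is good and none does
    otherwise, so measurability of \<open>bad\<close> follows from a finite sum.\<close>
  have bad_eq: "bad \<omega> = 1 - (\<Sum>Q\<in>GR. I Q \<omega>)" for \<omega>
    using finGR RK[of \<omega>] by (simp add: bad_def I_def GR_def)
  have badk: "bad \<in> borel_measurable (known (Mark ` {1..n}))"
    unfolding bad_eq[abs_def] using Ik by (intro borel_measurable_minus_ennreal borel_measurable_sum) auto
  have gW: "(\<lambda>\<omega>. g (W h \<omega>)) \<in> borel_measurable (known {EdgeWeight h})"
    by (rule measurable_compose[OF weight_known[OF h] g]) simp
  have gM[measurable]: "(\<lambda>\<omega>. g (W h \<omega>)) \<in> borel_measurable M"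
    using weight_measurable[OF h] g by (rule measurable_compose)
  have IM: "I Q \<in> borel_measurable M" if "Q \<in> GR" for Q by (rule measurable_known[OF Ik[OF that] mark_sources])
  have badM[measurable]: "bad \<in> borel_measurable M" by (rule measurable_known[OF badk mark_sources])
  have discM: "disc Q \<in> borel_measurable M" if Q: "Q \<subseteq> complete_edges n" for Q
  proof -
    have fQ: "finite Q" using Q finite_subset finite_complete_edges by blast
    have [measurable]: "Measurable.pred M (\<lambda>\<omega>. Z e \<omega> \<and> W e \<omega> \<le> y)" if "e \<in> Q" for e
    proof -
      have [measurable]: "Z e \<in> M \<rightarrow>\<^sub>M count_space UNIV" "W e \<in> borel_measurable M"
        using state_measurable weight_measurable that Q by auto
      show ?thesis by measurable
    qed
    \<comment> \<open>The event is split over the finitely many disconnected patterns of open edges,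
      each of which is measurable.\<close>
    have *: "disc Q \<omega> = (\<Sum>T\<in>{T \<in> Pow Q. \<not> connected_graph {1..n} T}.
        if \<forall>e\<in>Q. (Z e \<omega> \<and> W e \<omega> \<le> y) = (e \<in> T) then 1 else 0)" for \<omega>
    proof -
      have "(\<forall>e\<in>Q. (Z e \<omega> \<and> W e \<omega> \<le> y) = (e \<in> T)) \<longleftrightarrow> T = {e \<in> Q. Z e \<omega> \<and> W e \<omega> \<le> y}"
        if "T \<in> {T \<in> Pow Q. \<not> connected_graph {1..n} T}" for T
        using that by auto
      then have "(\<Sum>T\<in>{T \<in> Pow Q. \<not> connected_graph {1..n} T}.
          if \<forall>e\<in>Q. (Z e \<omega> \<and> W e \<omega> \<le> y) = (e \<in> T) then 1 else 0)
        = (\<Sum>T\<in>{T \<in> Pow Q. \<not> connected_graph {1..n} T}. if T = {e \<in> Q. Z e \<omega> \<and> W e \<omega> \<le> y} then 1 else 0 :: ennreal)"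
        by (intro sum.cong) auto
      then show ?thesis using fQ by (auto simp: disc_def)
    qed
    have [measurable]: "Measurable.pred M (\<lambda>\<omega>. \<forall>e\<in>Q. (Z e \<omega> \<and> W e \<omega> \<le> y) = (e \<in> T))" for T
      using fQ by measurable
    show ?thesis unfolding *[abs_def] by measurable
  qed
  have pt: "\<Phi> \<omega> * g (W h \<omega>) * (if connected_graph {1..n} (cheap_graph y t \<omega>) then 0 else 1)
      \<le> \<Phi> \<omega> * bad \<omega> * g (W h \<omega>) + (\<Sum>Q\<in>GR. (\<Phi> \<omega> * I Q \<omega>) * g (W h \<omega>) * disc Q \<omega>)" for \<omega>
  proof (cases "good (R \<omega>)")
    case True
    then have RG: "R \<omega> \<in> GR" using RK by (simp add: GR_def)
    have "cheap_graph y t \<omega> = {e \<in> R \<omega>. Z e \<omega> \<and> W e \<omega> \<le> y}"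
      by (auto simp: cheap_graph_def R_def)
    then have "\<Phi> \<omega> * g (W h \<omega>) * (if connected_graph {1..n} (cheap_graph y t \<omega>) then 0 else 1)
      = (\<Phi> \<omega> * I (R \<omega>) \<omega>) * g (W h \<omega>) * disc (R \<omega>) \<omega>" by (simp add: I_def disc_def)
    also have "\<dots> \<le> (\<Sum>Q\<in>GR. (\<Phi> \<omega> * I Q \<omega>) * g (W h \<omega>) * disc Q \<omega>)"
      by (rule member_le_sum[OF RG _ finGR]) simp
    finally show ?thesis by (simp add: bad_def True)
  next
    case False
    then show ?thesis by (simp add: bad_def add_increasing2 sum_nonneg)
  qed
  let ?x = "exp 1 * ((1 + exp (- z * a)) ^ n - 1)"
  have x0: "0 \<le> ?x" by (simp add: one_le_power)
  have "(\<integral>\<^sup>+\<omega>. \<Phi> \<omega> * g (W h \<omega>) * (if connected_graph {1..n} (cheap_graph y t \<omega>) then 0 else 1) \<partial>M)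
    \<le> (\<integral>\<^sup>+\<omega>. \<Phi> \<omega> * bad \<omega> * g (W h \<omega>) + (\<Sum>Q\<in>GR. (\<Phi> \<omega> * I Q \<omega>) * g (W h \<omega>) * disc Q \<omega>) \<partial>M)"
    by (intro nn_integral_mono pt)
  also have "\<dots> = (\<integral>\<^sup>+\<omega>. \<Phi> \<omega> * bad \<omega> * g (W h \<omega>) \<partial>M)
      + (\<Sum>Q\<in>GR. \<integral>\<^sup>+\<omega>. (\<Phi> \<omega> * I Q \<omega>) * g (W h \<omega>) * disc Q \<omega> \<partial>M)"
    using IM discM
    by (subst nn_integral_add, measurable) (auto simp: GR_def intro!: nn_integral_sum arg_cong2[where f="(+)"])
  also have "(\<integral>\<^sup>+\<omega>. \<Phi> \<omega> * bad \<omega> * g (W h \<omega>) \<partial>M) = (\<integral>\<^sup>+\<omega>. \<Phi> \<omega> * bad \<omega> \<partial>M) * (\<integral>\<^sup>+\<omega>. g (W h \<omega>) \<partial>M)"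
    by (rule nn_integral_mult_known[OF mark_sources _ _ borel_measurable_times_ennreal[OF \<Phi>k badk] gW])
      (use h in \<open>auto simp: sources_def\<close>)
  also have "(\<integral>\<^sup>+\<omega>. \<Phi> \<omega> * bad \<omega> \<partial>M) \<le> (\<integral>\<^sup>+\<omega>. \<Phi> \<omega> \<partial>M) * ennreal (real n * exp (2 - \<delta> * real n + 2 * \<eta> * real n))"
  proof -
    let ?c = "\<lambda>w \<omega>. (if \<delta> * real n < real (card {v \<in> {1..n} - {w}. t < r (X w \<omega>) (X v \<omega>)}) then 1 else 0 :: ennreal)"
    have cM: "?c w \<in> borel_measurable M" if w: "w \<in> {1..n}" for w
    proof -
      have [measurable]: "(\<lambda>\<omega>. r (X w \<omega>) (X v \<omega>)) \<in> borel_measurable M" if "v \<in> {1..n}" for v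
        by (rule measurable_known[OF r_known[OF w that, of "Mark ` {1..n}"] mark_sources]) (use w that in auto)
      have "real (card {v \<in> {1..n} - {w}. t < r (X w \<omega>) (X v \<omega>)})
          = (\<Sum>v\<in>{1..n} - {w}. if t < r (X w \<omega>) (X v \<omega>) then 1 else 0)" for \<omega>
        by (simp add: sum.If_cases Int_def conj_commute)
      then show ?thesis by simp
    qed
    have "(\<integral>\<^sup>+\<omega>. \<Phi> \<omega> * bad \<omega> \<partial>M) \<le> (\<integral>\<^sup>+\<omega>. (\<Sum>w\<in>{1..n}. \<Phi> \<omega> * ?c w \<omega>) \<partial>M)"
    proof (rule nn_integral_mono)
      fix \<omega> assume \<omega>: "\<omega> \<in> space M"
      show "\<Phi> \<omega> * bad \<omega> \<le> (\<Sum>w\<in>{1..n}. \<Phi> \<omega> * ?c w \<omega>)"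
      proof (cases "good (R \<omega>)")
        case False
        then obtain w where w: "w \<in> {1..n}" "\<not> real (card {v \<in> {1..n} - {w}. {w, v} \<notin> R \<omega>}) \<le> \<delta> * real n"
          by (auto simp: good_def)
        have "{v \<in> {1..n} - {w}. {w, v} \<notin> R \<omega>} = {v \<in> {1..n} - {w}. t < r (X w \<omega>) (X v \<omega>)}"
          using w(1) mark_cost_doubleton[OF w(1) _ \<omega>] by (auto simp: R_def not_le)
        then have "\<Phi> \<omega> * bad \<omega> = \<Phi> \<omega> * ?c w \<omega>" using False w(2) by (simp add: bad_def not_le)
        also have "\<dots> \<le> (\<Sum>w\<in>{1..n}. \<Phi> \<omega> * ?c w \<omega>)" by (rule member_le_sum[OF w(1)]) auto
        finally show ?thesis .
      qed (simp add: bad_def)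
    qed
    also have "\<dots> = (\<Sum>w\<in>{1..n}. \<integral>\<^sup>+\<omega>. \<Phi> \<omega> * ?c w \<omega> \<partial>M)"
      by (intro nn_integral_sum borel_measurable_times_ennreal \<Phi>M cM)
    also have "\<dots> \<le> (\<Sum>w\<in>{1..n}. (\<integral>\<^sup>+\<omega>. \<Phi> \<omega> \<partial>M) * ennreal (exp (2 - \<delta> * real n + 2 * \<eta> * real n)))"
      using \<Phi> uv by (intro sum_mono many_expensive_marks[OF uv(2,3) _ _ \<eta>]) auto
    also have "\<dots> = (\<integral>\<^sup>+\<omega>. \<Phi> \<omega> \<partial>M) * ennreal (real n * exp (2 - \<delta> * real n + 2 * \<eta> * real n))"
      by (simp add: ennreal_mult ennreal_of_nat_eq_real_of_nat mult_ac)
    finally show ?thesis .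
  qed
  also have "(\<Sum>Q\<in>GR. \<integral>\<^sup>+\<omega>. (\<Phi> \<omega> * I Q \<omega>) * g (W h \<omega>) * disc Q \<omega> \<partial>M)
    \<le> (\<Sum>Q\<in>GR. (\<integral>\<^sup>+\<omega>. \<Phi> \<omega> * I Q \<omega> \<partial>M) * (\<integral>\<^sup>+\<omega>. g (W h \<omega>) \<partial>M) * ennreal ?x)"
    unfolding disc_def
    by (intro sum_mono disconnected_fixed_marks[OF deg _ \<delta> _ h borel_measurable_times_ennreal[OF \<Phi>k Ik] g z a])
      (auto simp: GR_def good_def)
  also have "\<dots> = (\<integral>\<^sup>+\<omega>. (\<Sum>Q\<in>GR. \<Phi> \<omega> * I Q \<omega>) \<partial>M) * (\<integral>\<^sup>+\<omega>. g (W h \<omega>) \<partial>M) * ennreal ?x"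
    using IM by (subst nn_integral_sum) (auto simp: sum_distrib_right)
  also have "\<dots> \<le> (\<integral>\<^sup>+\<omega>. \<Phi> \<omega> \<partial>M) * (\<integral>\<^sup>+\<omega>. g (W h \<omega>) \<partial>M) * ennreal ?x"
  proof (intro mult_right_mono nn_integral_mono)
    fix \<omega>
    have "(\<Sum>Q\<in>GR. I Q \<omega>) \<le> 1" using finGR by (simp add: I_def)
    then show "(\<Sum>Q\<in>GR. \<Phi> \<omega> * I Q \<omega>) \<le> \<Phi> \<omega>"
      unfolding sum_distrib_left[symmetric] using mult_left_mono[of _ 1 "\<Phi> \<omega>"] by simp
  qed auto
  finally have "(\<integral>\<^sup>+\<omega>. \<Phi> \<omega> * g (W h \<omega>) * (if connected_graph {1..n} (cheap_graph y t \<omega>) then 0 else 1) \<partial>M)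
    \<le> (\<integral>\<^sup>+\<omega>. \<Phi> \<omega> \<partial>M) * ennreal (real n * exp (2 - \<delta> * real n + 2 * \<eta> * real n)) * (\<integral>\<^sup>+\<omega>. g (W h \<omega>) \<partial>M)
      + (\<integral>\<^sup>+\<omega>. \<Phi> \<omega> \<partial>M) * (\<integral>\<^sup>+\<omega>. g (W h \<omega>) \<partial>M) * ennreal ?x" 
    by (simp add: add_mono mult_right_mono)
  also have "\<dots> = (\<integral>\<^sup>+\<omega>. \<Phi> \<omega> \<partial>M) * (\<integral>\<^sup>+\<omega>. g (W h \<omega>) \<partial>M) *
      ennreal (?x + real n * exp (2 - \<delta> * real n + 2 * \<eta> * real n))"
    by (subst ennreal_plus[OF x0]) (simp, simp only: distrib_left mult_ac add_ac)
  finally show ?thesis .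
qed

end

section \<open>Few very cheap edges\<close>

context weighted_random_graph
begin

text \<open>For variables in [0, 1] all integrals are finite, so the product rule for extended
  nonnegative integrals passes to expectations, as needed for covariances.\<close>

lemma expectation_mult_known:
  fixes Y1 Y2 :: "'w \<Rightarrow> real"
  assumes K: "K1 \<subseteq> sources" "K2 \<subseteq> sources" "K1 \<inter> K2 = {}"
    and Y: "Y1 \<in> borel_measurable (known K1)" "Y2 \<in> borel_measurable (known K2)"
    and bd: "\<And>\<omega>. 0 \<le> Y1 \<omega> \<and> Y1 \<omega> \<le> 1" "\<And>\<omega>. 0 \<le> Y2 \<omega> \<and> Y2 \<omega> \<le> 1"
  shows "expectation (\<lambda>\<omega>. Y1 \<omega> * Y2 \<omega>) = expectation Y1 * expectation Y2"
proof -
  have m[measurable]: "Y1 \<in> borel_measurable M" "Y2 \<in> borel_measurable M"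
    using measurable_known Y K by blast+
  have i: "integrable M Y1" "integrable M Y2" "integrable M (\<lambda>\<omega>. Y1 \<omega> * Y2 \<omega>)"
    by (rule integrable_bounded_real[of _ 1], (use bd in \<open>auto intro: mult_le_one\<close>)[2])+
  have "ennreal (expectation (\<lambda>\<omega>. Y1 \<omega> * Y2 \<omega>)) = (\<integral>\<^sup>+\<omega>. ennreal (Y1 \<omega>) * ennreal (Y2 \<omega>) \<partial>M)"
    using i bd by (subst nn_integral_eq_integral[symmetric]) (auto simp: ennreal_mult)
  also have "\<dots> = (\<integral>\<^sup>+\<omega>. ennreal (Y1 \<omega>) \<partial>M) * (\<integral>\<^sup>+\<omega>. ennreal (Y2 \<omega>) \<partial>M)"
    using Y by (intro nn_integral_mult_known[OF K]) auto
  also have "\<dots> = ennreal (expectation Y1 * expectation Y2)"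
    using i bd by (simp add: nn_integral_eq_integral ennreal_mult)
  finally show ?thesis using bd by (subst (asm) ennreal_inj) (auto intro!: integral_nonneg_AE)
qed

lemma edge_cost_known:
  assumes "h \<in> complete_edges n" "EdgeWeight h \<in> K" "Mark ` h \<subseteq> K"
  shows "edge_cost r X W h \<in> borel_measurable (known K)"
  unfolding edge_cost_eq[abs_def]
  by (intro borel_measurable_times mark_cost_known weight_known assms)

lemma edge_cost_measurable: "h \<in> complete_edges n \<Longrightarrow> edge_cost r X W h \<in> borel_measurable M"
  by (rule measurable_known[OF edge_cost_known[of h sources]])
    (use complete_edges_subset[of h n] in \<open>auto simp: sources_def\<close>)

text \<open>Disjoint edges are independent, so only pairs with a common vertex enter the variance.
  The pairs of equal edges contribute the term with D, the pairs of distinct adjacent edges the term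
  with D squared.\<close>

lemma few_cheap_edges:
  assumes n: "0 < n" and D: "\<And>u. u \<in> {1..n} \<Longrightarrow> (\<Sum>v\<in>{1..n} - {u}. q {u, v}) \<le> D"
    and \<kappa>: "\<And>e. e \<in> complete_edges n \<Longrightarrow> prob {\<omega> \<in> space M. edge_cost r X W e \<omega> \<le> y} \<le> \<kappa>"
    and \<kappa>0: "0 \<le> \<kappa>" and D\<kappa>: "D * \<kappa> \<le> 1 / 4" and D0: "0 \<le> D"
  shows "prob {\<omega> \<in> space M. real n / 4 \<le> real (card {e \<in> complete_edges n. Z e \<omega> \<and> edge_cost r X W e \<omega> \<le> y})}
    \<le> 64 * (D * \<kappa> + D\<^sup>2 * \<kappa>) / real n"
proof -
  let ?K = "complete_edges n"
  define iz where "iz e \<omega> = (if Z e \<omega> then 1 else 0 :: real)" for e \<omega>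
  define ic where "ic e \<omega> = (if edge_cost r X W e \<omega> \<le> y then 1 else 0 :: real)" for e \<omega>
  define I where "I e \<omega> = iz e \<omega> * ic e \<omega>" for e \<omega>
  define N where "N \<omega> = (\<Sum>e\<in>?K. I e \<omega>)" for \<omega>
  have bd: "0 \<le> iz e \<omega> \<and> iz e \<omega> \<le> 1" "0 \<le> ic e \<omega> \<and> ic e \<omega> \<le> 1" "0 \<le> I e \<omega> \<and> I e \<omega> \<le> 1" for e \<omega>
    by (auto simp: iz_def ic_def I_def)
  have card_eq: "real (card {e \<in> ?K. Z e \<omega> \<and> edge_cost r X W e \<omega> \<le> y}) = N \<omega>" for \<omega>
  proof -
    have "N \<omega> = (\<Sum>e\<in>?K. if Z e \<omega> \<and> edge_cost r X W e \<omega> \<le> y then 1 else 0)"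
      unfolding N_def by (intro sum.cong) (auto simp: I_def iz_def ic_def)
    then show ?thesis by (simp add: sum.If_cases Int_def)
  qed
  have izk: "iz e \<in> borel_measurable (known {EdgeState e})" if "e \<in> ?K" for e
    unfolding iz_def by (rule measurable_compose[OF state_known[OF that]]) auto
  have ick: "ic e \<in> borel_measurable (known (insert (EdgeWeight e) (Mark ` e)))" if e: "e \<in> ?K" for e
  proof -
    have [measurable]: "edge_cost r X W e \<in> borel_measurable (known (insert (EdgeWeight e) (Mark ` e)))"
      by (rule edge_cost_known[OF e]) auto
    show ?thesis unfolding ic_def by measurable
  qed
  have Ik: "I e \<in> borel_measurable (known (insert (EdgeState e) (insert (EdgeWeight e) (Mark ` e))))" if e: "e \<in> ?K" for e
    unfolding I_def[abs_def]
    by (intro borel_measurable_times measurable_known_mono[OF izk[OF e]] measurable_known_mono[OF ick[OF e]]) auto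
  have src: "insert (EdgeState e) (insert (EdgeWeight e) (Mark ` e)) \<subseteq> sources" if "e \<in> ?K" for e
    using that complete_edges_subset[OF that] by (auto simp: sources_def)
  have Im[measurable]: "I e \<in> borel_measurable M" if "e \<in> ?K" for e
    by (rule measurable_known[OF Ik[OF that] src[OF that]])
  have izm[measurable]: "iz e \<in> borel_measurable M" if "e \<in> ?K" for e
    by (rule measurable_known[OF izk[OF that]]) (use src[OF that] in auto)
  have icm[measurable]: "ic e \<in> borel_measurable M" if "e \<in> ?K" for e
    by (rule measurable_known[OF ick[OF that]]) (use src[OF that] in auto)
  have Eiz: "expectation (iz e) = q e" if e: "e \<in> ?K" for e
  proof -
    have ev: "{\<omega> \<in> space M. Z e \<omega>} \<in> events"
      using measurable_sets[OF state_measurable[OF e], of "{True}"] by (simp add: vimage_def Int_def conj_commute)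
    have "expectation (iz e) = expectation (indicator {\<omega> \<in> space M. Z e \<omega>})"
      by (intro Bochner_Integration.integral_cong) (auto simp: iz_def)
    then show ?thesis using state_prob[OF e] ev by simp
  qed
  have Eic: "expectation (ic e) \<le> \<kappa>" if e: "e \<in> ?K" for e
  proof -
    have [measurable]: "edge_cost r X W e \<in> borel_measurable M" by (rule edge_cost_measurable[OF e])
    have ev: "{\<omega> \<in> space M. edge_cost r X W e \<omega> \<le> y} \<in> events" by measurable
    have "expectation (ic e) = expectation (indicator {\<omega> \<in> space M. edge_cost r X W e \<omega> \<le> y})"
      by (intro Bochner_Integration.integral_cong) (auto simp: ic_def)
    then show ?thesis using \<kappa>[OF e] ev by simp
  qed
  have q0: "0 \<le> q e" if "e \<in> ?K" for e using edge_prob_bounds[OF that] by simp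
  have EI: "expectation (I e) \<le> q e * \<kappa>" if e: "e \<in> ?K" for e
  proof -
    have "expectation (I e) = expectation (iz e) * expectation (ic e)"
      unfolding I_def[abs_def]
      by (rule expectation_mult_known[OF _ _ _ izk[OF e] ick[OF e] bd(1,2)]) (use src[OF e] in auto)
    then show ?thesis using Eiz[OF e] Eic[OF e] q0[OF e] by (simp add: mult_left_mono)
  qed
  have I2: "integrable M (\<lambda>\<omega>. I e \<omega> * I f \<omega>)" if "e \<in> ?K" "f \<in> ?K" for e f
    by (rule integrable_bounded_real[of _ 1]) (use that bd(3)[of e] bd(3)[of f] in \<open>auto intro: mult_le_one\<close>)
  have I1: "integrable M (I e)" if "e \<in> ?K" for e
    by (rule integrable_bounded_real[of _ 1]) (use that bd(3)[of e] in auto)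
  have EII: "expectation (\<lambda>\<omega>. I e \<omega> * I f \<omega>) \<le> q e * q f * \<kappa>" if ef: "e \<in> ?K" "f \<in> ?K" "e \<noteq> f" for e f
  proof -
    have "expectation (\<lambda>\<omega>. I e \<omega> * I f \<omega>) \<le> expectation (\<lambda>\<omega>. iz e \<omega> * (iz f \<omega> * ic e \<omega>))"
    proof (rule integral_mono[OF I2[OF ef(1,2)]])
      show "integrable M (\<lambda>\<omega>. iz e \<omega> * (iz f \<omega> * ic e \<omega>))"
      proof (rule integrable_bounded_real[of _ 1])
        show "(\<lambda>\<omega>. iz e \<omega> * (iz f \<omega> * ic e \<omega>)) \<in> borel_measurable M"
          by (intro borel_measurable_times izm icm ef)
      qed (simp add: iz_def ic_def)
    qed (auto simp: I_def iz_def ic_def)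
    also have "\<dots> = expectation (iz e) * expectation (\<lambda>\<omega>. iz f \<omega> * ic e \<omega>)"
    proof (rule expectation_mult_known)
      let ?K2 = "insert (EdgeState f) (insert (EdgeWeight e) (Mark ` e))"
      show "{EdgeState e} \<subseteq> sources" "?K2 \<subseteq> sources" using src ef by auto
      show "{EdgeState e} \<inter> ?K2 = {}" using ef(3) by auto
      show "iz e \<in> borel_measurable (known {EdgeState e})" by (rule izk[OF ef(1)])
      show "(\<lambda>\<omega>. iz f \<omega> * ic e \<omega>) \<in> borel_measurable (known ?K2)"
        by (intro borel_measurable_times measurable_known_mono[OF izk[OF ef(2)]]
            measurable_known_mono[OF ick[OF ef(1)]]) auto
    qed (simp_all add: iz_def ic_def)
    also have "expectation (\<lambda>\<omega>. iz f \<omega> * ic e \<omega>) = expectation (iz f) * expectation (ic e)"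
      by (rule expectation_mult_known[OF _ _ _ izk[OF ef(2)] ick[OF ef(1)] bd(1,2)])
        (use src[OF ef(1)] src[OF ef(2)] in auto)
    finally have "expectation (\<lambda>\<omega>. I e \<omega> * I f \<omega>) \<le> q e * (q f * expectation (ic e))"
      using Eiz ef by simp
    also have "\<dots> \<le> q e * (q f * \<kappa>)" using Eic q0 ef by (intro mult_left_mono) auto
    finally show ?thesis by (simp add: mult_ac)
  qed
  have cov0: "expectation (\<lambda>\<omega>. I e \<omega> * I f \<omega>) = expectation (I e) * expectation (I f)"
    if ef: "e \<in> ?K" "f \<in> ?K" "e \<inter> f = {}" for e f
  proof (rule expectation_mult_known[OF src[OF ef(1)] src[OF ef(2)] _ Ik[OF ef(1)] Ik[OF ef(2)] bd(3) bd(3)])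
    have "e \<noteq> {}" using ef(1) by (auto elim: complete_edgesE)
    then show "insert (EdgeState e) (insert (EdgeWeight e) (Mark ` e)) \<inter>
      insert (EdgeState f) (insert (EdgeWeight f) (Mark ` f)) = {}" using ef(3) by auto
  qed
  have II0: "0 \<le> expectation (\<lambda>\<omega>. I e \<omega> * I f \<omega>)" for e f using bd by (intro integral_nonneg_AE) auto
  have sumq: "(\<Sum>e\<in>{e \<in> ?K. u \<in> e}. q e) \<le> D" if "u \<in> {1..n}" for u
    using D[OF that] sum_edges_at[OF that, of q] by simp
  have EN: "expectation N = (\<Sum>e\<in>?K. expectation (I e))"
    unfolding N_def using I1 by (intro Bochner_Integration.integral_sum) auto
  \<comment> \<open>Half of the sum of the expected cheap degrees, each at most D\<kappa> and hence
    at most 1/4. Reaching n/4 is therefore a deviation of at least n/8.\<close>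
  have EN8: "expectation N \<le> real n / 8"
  proof -
    have "expectation N \<le> (\<Sum>e\<in>?K. q e * \<kappa>)" unfolding EN by (intro sum_mono EI)
    also have "\<dots> = (\<Sum>u\<in>{1..n}. \<Sum>e\<in>{e \<in> ?K. u \<in> e}. q e) / 2 * \<kappa>"
      using sum_edges_handshake[of ?K n q] by (simp add: sum_distrib_right)
    also have "\<dots> \<le> (\<Sum>u\<in>{1..n}. D) / 2 * \<kappa>"
      using sumq \<kappa>0 by (intro mult_right_mono divide_right_mono sum_mono) auto
    also have "\<dots> = real n / 2 * (D * \<kappa>)" by simp
    also have "\<dots> \<le> real n / 2 * (1 / 4)" using D\<kappa> by (intro mult_left_mono) auto
    finally show ?thesis by simp
  qed
  have Nm[measurable]: "N \<in> borel_measurable M" unfolding N_def by measurable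
  have N2: "(N \<omega>)\<^sup>2 = (\<Sum>e\<in>?K. \<Sum>f\<in>?K. I e \<omega> * I f \<omega>)" for \<omega>
    by (simp add: N_def power2_eq_square sum_product)
  have iN: "integrable M N" unfolding N_def using I1 by (intro Bochner_Integration.integrable_sum) auto
  have iN2: "integrable M (\<lambda>\<omega>. (N \<omega>)\<^sup>2)"
    unfolding N2 using I2 by (intro Bochner_Integration.integrable_sum) auto
  have "variance N = (\<Sum>e\<in>?K. \<Sum>f\<in>?K. expectation (\<lambda>\<omega>. I e \<omega> * I f \<omega>) - expectation (I e) * expectation (I f))"
  proof -
    have "expectation (\<lambda>\<omega>. (N \<omega>)\<^sup>2) = (\<Sum>e\<in>?K. \<Sum>f\<in>?K. expectation (\<lambda>\<omega>. I e \<omega> * I f \<omega>))"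
      unfolding N2 using I2
      by (subst Bochner_Integration.integral_sum)
        (auto intro!: Bochner_Integration.integrable_sum sum.cong Bochner_Integration.integral_sum)
    moreover have "(expectation N)\<^sup>2 = (\<Sum>e\<in>?K. \<Sum>f\<in>?K. expectation (I e) * expectation (I f))"
      by (simp add: EN power2_eq_square sum_product)
    ultimately show ?thesis using variance_eq[OF iN iN2] by (simp add: sum_subtractf)
  qed
  \<comment> \<open>The covariance of two meeting edges is charged to every vertex that they share,
    at least one, so that the sum can be organised by vertices.\<close>
  also have "\<dots> \<le> (\<Sum>e\<in>?K. \<Sum>f\<in>?K. \<Sum>u\<in>{1..n}. if u \<in> e \<and> u \<in> f then expectation (\<lambda>\<omega>. I e \<omega> * I f \<omega>) else 0)"
  proof (intro sum_mono)
    fix e f assume ef: "e \<in> ?K" "f \<in> ?K"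
    show "expectation (\<lambda>\<omega>. I e \<omega> * I f \<omega>) - expectation (I e) * expectation (I f)
      \<le> (\<Sum>u\<in>{1..n}. if u \<in> e \<and> u \<in> f then expectation (\<lambda>\<omega>. I e \<omega> * I f \<omega>) else 0)"
    proof (cases "e \<inter> f = {}")
      case True
      then show ?thesis using cov0[OF ef] by (auto intro!: sum_nonneg II0)
    next
      case False
      then obtain u where u: "u \<in> e" "u \<in> f" by auto
      then have un: "u \<in> {1..n}" using ef complete_edges_subset by blast
      have "0 \<le> expectation (I e) * expectation (I f)"
        using bd(3) by (intro mult_nonneg_nonneg integral_nonneg_AE) auto
      then have "expectation (\<lambda>\<omega>. I e \<omega> * I f \<omega>) - expectation (I e) * expectation (I f)
        \<le> (if u \<in> e \<and> u \<in> f then expectation (\<lambda>\<omega>. I e \<omega> * I f \<omega>) else 0)" using u by simp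
      also have "\<dots> \<le> (\<Sum>u\<in>{1..n}. if u \<in> e \<and> u \<in> f then expectation (\<lambda>\<omega>. I e \<omega> * I f \<omega>) else 0)"
        by (rule member_le_sum[OF un]) (auto intro: II0)
      finally show ?thesis .
    qed
  qed
  also have "\<dots> = (\<Sum>u\<in>{1..n}. \<Sum>e\<in>?K. \<Sum>f\<in>?K. if u \<in> e \<and> u \<in> f then expectation (\<lambda>\<omega>. I e \<omega> * I f \<omega>) else 0)"
    by (subst sum.swap[of _ "{1..n}"], intro sum.cong refl sum.swap)
  also have "\<dots> \<le> (\<Sum>u\<in>{1..n}. D * \<kappa> + D\<^sup>2 * \<kappa>)"
  proof (intro sum_mono)
    fix u assume u: "u \<in> {1..n}"
    let ?S = "{e \<in> ?K. u \<in> e}"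
    let ?s = "\<Sum>e\<in>?S. q e"
    have "(\<Sum>e\<in>?K. \<Sum>f\<in>?K. if u \<in> e \<and> u \<in> f then expectation (\<lambda>\<omega>. I e \<omega> * I f \<omega>) else 0)
      = (\<Sum>e\<in>?S. \<Sum>f\<in>?S. expectation (\<lambda>\<omega>. I e \<omega> * I f \<omega>))"
    proof -
      have "(\<Sum>f\<in>?K. if u \<in> e \<and> u \<in> f then expectation (\<lambda>\<omega>. I e \<omega> * I f \<omega>) else 0)
        = (if u \<in> e then (\<Sum>f\<in>?S. expectation (\<lambda>\<omega>. I e \<omega> * I f \<omega>)) else 0)" for e
        by (simp add: sum.inter_filter)
      moreover have "(\<Sum>e\<in>?S. \<Sum>f\<in>?S. expectation (\<lambda>\<omega>. I e \<omega> * I f \<omega>))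
        = (\<Sum>e\<in>?K. if u \<in> e then (\<Sum>f\<in>?S. expectation (\<lambda>\<omega>. I e \<omega> * I f \<omega>)) else 0)"
        by (rule sum.inter_filter) simp
      ultimately show ?thesis by (simp only:)
    qed
    also have "\<dots> \<le> (\<Sum>e\<in>?S. \<Sum>f\<in>?S. (if e = f then q e * \<kappa> else 0) + q e * q f * \<kappa>)"
    proof (intro sum_mono)
      fix e f assume "e \<in> ?S" "f \<in> ?S"
      then have ef: "e \<in> ?K" "f \<in> ?K" by auto
      show "expectation (\<lambda>\<omega>. I e \<omega> * I f \<omega>) \<le> (if e = f then q e * \<kappa> else 0) + q e * q f * \<kappa>"
      proof (cases "e = f")
        case True
        have "(\<lambda>\<omega>. I e \<omega> * I f \<omega>) = I e" using True by (auto simp: I_def iz_def ic_def)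
        then have "expectation (\<lambda>\<omega>. I e \<omega> * I f \<omega>) \<le> q e * \<kappa>" using EI[OF ef(1)] by simp
        then show ?thesis using True q0 ef \<kappa>0 by (simp add: add_increasing2)
      qed (use EII[OF ef] in simp)
    qed
    also have "\<dots> = ?s * \<kappa> + ?s * ?s * \<kappa>"
      by (simp add: sum.distrib sum_distrib_left[symmetric] sum_distrib_right[symmetric] mult.assoc)
    also have "\<dots> \<le> D * \<kappa> + D * D * \<kappa>"
      using sumq[OF u] \<kappa>0 q0 D0 by (intro add_mono mult_right_mono mult_mono sum_nonneg) auto
    finally show "(\<Sum>e\<in>?K. \<Sum>f\<in>?K. if u \<in> e \<and> u \<in> f then expectation (\<lambda>\<omega>. I e \<omega> * I f \<omega>) else 0)
      \<le> D * \<kappa> + D\<^sup>2 * \<kappa>" by (simp add: power2_eq_square)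
  qed
  finally have V: "variance N \<le> real n * (D * \<kappa> + D\<^sup>2 * \<kappa>)" by simp
  have "prob {\<omega> \<in> space M. real n / 4 \<le> N \<omega>} \<le> prob {\<omega> \<in> space M. real n / 8 \<le> \<bar>N \<omega> - expectation N\<bar>}"
    using EN8 by (intro finite_measure_mono) (auto, measurable)
  also have "\<dots> \<le> variance N / (real n / 8)\<^sup>2"
    using n by (intro Chebyshev_inequality Nm iN2) auto
  also have "\<dots> \<le> real n * (D * \<kappa> + D\<^sup>2 * \<kappa>) / (real n / 8)\<^sup>2"
    using V by (intro divide_right_mono) auto
  also have "\<dots> = 64 * (D * \<kappa> + D\<^sup>2 * \<kappa>) / real n"
    using n by (simp add: power2_eq_square field_simps)
  finally show ?thesis unfolding card_eq .
qed

section \<open>Second moments of mark factors and weights\<close>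

lemma mark_second_moment:
  assumes B: "\<And>x. x \<in> space S \<Longrightarrow> (\<integral>\<^sup>+\<omega>. ennreal ((r x (X 1 \<omega>))\<^sup>2) \<partial>M) \<le> ennreal B"
    and h: "h \<in> complete_edges n"
  shows "(\<integral>\<^sup>+\<omega>. ennreal ((mark_cost h \<omega>)\<^sup>2) \<partial>M) \<le> ennreal B"
proof -
  note mm = Min_Max_complete_edges[OF h]
  have gm: "(\<lambda>(x, y). ennreal ((r x y)\<^sup>2)) \<in> borel_measurable (S \<Otimes>\<^sub>M S)"
    using r_measurable by measurable
  have "(\<integral>\<^sup>+\<omega>. 1 * ennreal ((r (X (Min h) \<omega>) (X (Max h) \<omega>))\<^sup>2) \<partial>M) \<le> (\<integral>\<^sup>+\<omega>. 1 \<partial>M) * ennreal B"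
  proof (rule integrate_out_mark[where K="{Mark (Min h)}" and g="\<lambda>x y. ennreal ((r x y)\<^sup>2)"])
    show "(\<integral>\<^sup>+\<omega>. ennreal ((r x (X (Max h) \<omega>))\<^sup>2) \<partial>M) \<le> ennreal B" if x: "x \<in> space S" for x
    proof -
      have [measurable]: "(\<lambda>y. r x y) \<in> borel_measurable S"
        using measurable_compose[OF measurable_Pair1'[OF x] r_measurable] by simp
      have "1 \<in> {1..n}" using mm(1) by auto
      then have "(\<integral>\<^sup>+\<omega>. ennreal ((r x (X (Max h) \<omega>))\<^sup>2) \<partial>M) = (\<integral>\<^sup>+\<omega>. ennreal ((r x (X 1 \<omega>))\<^sup>2) \<partial>M)"
        by (intro nn_integral_mark[OF mm(2)]) measurable
      then show ?thesis using B[OF x] by simp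
    qed
  qed (use mm gm in \<open>auto simp: sources_def\<close>)
  then show ?thesis by (simp add: mark_cost_def emeasure_space_1)
qed

lemma mark_tail:
  assumes B: "\<And>x. x \<in> space S \<Longrightarrow> (\<integral>\<^sup>+\<omega>. ennreal ((r x (X 1 \<omega>))\<^sup>2) \<partial>M) \<le> ennreal B"
    and x: "x \<in> space S" and n: "0 < n" and t: "0 < t" and B0: "0 \<le> B"
  shows "prob {\<omega> \<in> space M. t < r x (X 1 \<omega>)} \<le> B / t\<^sup>2"
proof -
  have [measurable]: "(\<lambda>y. r x y) \<in> borel_measurable S"
    using measurable_compose[OF measurable_Pair1'[OF x] r_measurable] by simp
  have [measurable]: "X 1 \<in> M \<rightarrow>\<^sub>M S" using n by (intro mark_measurable) auto
  have "emeasure M {\<omega> \<in> space M. t < r x (X 1 \<omega>)} = (\<integral>\<^sup>+\<omega>. indicator {\<omega> \<in> space M. t < r x (X 1 \<omega>)} \<omega> \<partial>M)"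
    by (intro nn_integral_indicator[symmetric]) measurable
  also have "\<dots> \<le> (\<integral>\<^sup>+\<omega>. ennreal (1 / t\<^sup>2) * ennreal ((r x (X 1 \<omega>))\<^sup>2) \<partial>M)"
  proof (rule nn_integral_mono)
    fix \<omega>
    have "ennreal 1 \<le> ennreal (1 / t\<^sup>2 * (r x (X 1 \<omega>))\<^sup>2)" if "t < r x (X 1 \<omega>)"
      using that t power_mono[of t "r x (X 1 \<omega>)" 2] by (intro ennreal_leI) (simp add: field_simps)
    then show "indicator {\<omega> \<in> space M. t < r x (X 1 \<omega>)} \<omega> \<le> ennreal (1 / t\<^sup>2) * ennreal ((r x (X 1 \<omega>))\<^sup>2)"
      using t by (simp add: indicator_def ennreal_mult[symmetric])
  qed
  also have "\<dots> = ennreal (1 / t\<^sup>2) * (\<integral>\<^sup>+\<omega>. ennreal ((r x (X 1 \<omega>))\<^sup>2) \<partial>M)"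
    by (intro nn_integral_cmult) measurable
  also have "\<dots> \<le> ennreal (1 / t\<^sup>2) * ennreal B" by (intro mult_left_mono B x) simp
  also have "\<dots> = ennreal (B / t\<^sup>2)" using B0 by (simp add: ennreal_mult[symmetric])
  finally show ?thesis using B0 by (simp add: emeasure_eq_measure)
qed

text \<open>For positive x, \<open>x\<^sup>2\<close> is at most 1 up to x = 1 and at most
  \<open>x powr s\<close> beyond, because s is at least 2.\<close>

lemma weight_second_moment:
  assumes L: "AE x in L. 0 < x" "(\<integral>\<^sup>+ x. ennreal (x powr s) \<partial>L) \<le> ennreal B" "2 \<le> s" "0 \<le> B"
    and h: "h \<in> complete_edges n"
  shows "(\<integral>\<^sup>+\<omega>. ennreal ((W h \<omega>)\<^sup>2) \<partial>M) \<le> ennreal (B + 1)"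
proof -
  have Wm[measurable]: "W h \<in> borel_measurable M" using weight_measurable h .
  have sL[measurable_cong]: "sets L = sets borel" using weight_law[OF h] sets_distr by metis
  have eL: "emeasure L (space L) = 1"
  proof -
    interpret DW: prob_space "distr M borel (W h)" by (rule prob_space_distr) measurable
    show ?thesis using DW.emeasure_space_1 unfolding weight_law[OF h] .
  qed
  have "(\<integral>\<^sup>+\<omega>. ennreal ((W h \<omega>)\<^sup>2) \<partial>M) = (\<integral>\<^sup>+x. ennreal (x\<^sup>2) \<partial>L)"
    unfolding weight_law[OF h, symmetric] by (subst nn_integral_distr) auto
  also have "\<dots> \<le> (\<integral>\<^sup>+x. ennreal (x powr s) + 1 \<partial>L)"
  proof (rule nn_integral_mono_AE)
    have *: "ennreal (x\<^sup>2) \<le> ennreal (x powr s) + 1" if x: "0 < x" for x :: real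
    proof -
      have "x\<^sup>2 \<le> x powr s + 1"
      proof (cases "x \<le> 1")
        case True
        then have "x\<^sup>2 \<le> 1" using x by (simp add: power_le_one)
        then show ?thesis using powr_ge_zero[of x s] by linarith
      next
        case False
        then have "x powr 2 \<le> x powr s" using L(3) by (intro powr_mono) auto
        then show ?thesis using x by simp
      qed
      then have "ennreal (x\<^sup>2) \<le> ennreal (x powr s + 1)" by (rule ennreal_leI)
      then show ?thesis by (simp add: ennreal_plus)
    qed
    show "AE x in L. ennreal (x\<^sup>2) \<le> ennreal (x powr s) + 1"
      using L(1) by eventually_elim (rule *)
  qed
  also have "\<dots> = (\<integral>\<^sup>+x. ennreal (x powr s) \<partial>L) + 1" using eL by (subst nn_integral_add) auto
  also have "\<dots> \<le> ennreal B + 1" using L(2) by (rule add_right_mono)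
  also have "\<dots> = ennreal (B + 1)" using L(4) by (simp add: ennreal_plus)
  finally show ?thesis .
qed

end

section \<open>Variance of the capped minimum\<close>

text \<open>Independence identifies the joint law of the inputs with a product measure, along which
  the product-space inequality is pulled back.\<close>

lemma (in prob_space) efron_stein:
  fixes f :: "('i \<Rightarrow> 'b) \<Rightarrow> real"
  assumes indep: "indep_vars (\<lambda>_. N) V I" and I: "finite I" "I \<noteq> {}"
    and f: "f \<in> borel_measurable (PiM I (\<lambda>_. N))" "\<And>x. x \<in> space (PiM I (\<lambda>_. N)) \<Longrightarrow> \<bar>f x\<bar> \<le> C"
    and g: "\<And>i. i \<in> I \<Longrightarrow> g i \<in> borel_measurable (PiM I (\<lambda>_. N))"
      "\<And>i x. i \<in> I \<Longrightarrow> x \<in> space (PiM I (\<lambda>_. N)) \<Longrightarrow> \<bar>g i x\<bar> \<le> C"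
      "\<And>i x y. i \<in> I \<Longrightarrow> x \<in> space (PiM I (\<lambda>_. N)) \<Longrightarrow> y \<in> space N \<Longrightarrow> g i (x(i := y)) = g i x"
  shows "variance (\<lambda>\<omega>. f (\<lambda>i\<in>I. V i \<omega>))
    \<le> (\<Sum>i\<in>I. expectation (\<lambda>\<omega>. (f (\<lambda>i\<in>I. V i \<omega>) - g i (\<lambda>i\<in>I. V i \<omega>))\<^sup>2))"
proof -
  obtain i0 where i0: "i0 \<in> I" using I by auto
  have V: "V i \<in> M \<rightarrow>\<^sub>M N" if "i \<in> I" for i using indep that by (auto simp: indep_vars_def)
  \<comment> \<open>Outside I the law of some fixed input is taken, because
    \<open>efron_stein_PiM\<close> wants a probability space at every index.\<close>
  define N' where "N' i = distr M N (V (if i \<in> I then i else i0))" for i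
  have pN: "prob_space (N' i)" for i
    unfolding N'_def using V i0 by (intro prob_space_distr) auto
  let ?D = "\<lambda>\<omega>. \<lambda>i\<in>I. V i \<omega>"
  have D[measurable]: "?D \<in> M \<rightarrow>\<^sub>M PiM I (\<lambda>_. N)" using V by (rule measurable_restrict)
  have sets_eq: "sets (PiM I N') = sets (PiM I (\<lambda>_. N))" by (intro sets_PiM_cong) (auto simp: N'_def)
  then have space_eq: "space (PiM I N') = space (PiM I (\<lambda>_. N))" by (rule sets_eq_imp_space_eq)
  have meas_eq: "borel_measurable (PiM I N') = borel_measurable (PiM I (\<lambda>_. N))"
    by (rule measurable_cong_sets) (use sets_eq in auto)
  have distr: "distr M (PiM I (\<lambda>_. N)) ?D = PiM I N'"
  proof -
    have "distr M (PiM I (\<lambda>_. N)) ?D = PiM I (\<lambda>i. distr M N (V i))"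
      using indep indep_vars_iff_distr_eq_PiM'[OF I(2), of V "\<lambda>_. N"] V by simp
    also have "\<dots> = PiM I N'" by (intro PiM_cong) (auto simp: N'_def)
    finally show ?thesis .
  qed
  have transfer: "(LINT x|PiM I N'. h x) = expectation (\<lambda>\<omega>. h (?D \<omega>))"
    if "h \<in> borel_measurable (PiM I (\<lambda>_. N))" for h :: "('i \<Rightarrow> 'b) \<Rightarrow> real"
    unfolding distr[symmetric] by (rule integral_distr[OF D that])
  have "(LINT x|PiM I N'. (f x - (LINT x|PiM I N'. f x))\<^sup>2) \<le> (\<Sum>i\<in>I. LINT x|PiM I N'. (f x - g i x)\<^sup>2)"
  proof (rule efron_stein_PiM[where C=C, OF pN I(1)])
    have "space (N' i) = space N" for i by (simp add: N'_def)
    then show "g i (x(i := y)) = g i x"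
      if "i \<in> I" "x \<in> space (PiM I N')" "y \<in> space (N' i)" for i x y
      using g(3) that space_eq by simp
  qed (use f g(1,2) in \<open>simp_all add: meas_eq space_eq\<close>)
  then show ?thesis using f(1) g(1) by (simp add: transfer)
qed

section \<open>Dependence of the connecting cost on single edge costs\<close>

lemma min_connecting_cost_cong:
  assumes "\<And>h. h \<in> complete_edges n \<Longrightarrow> c h = c' h"
  shows "min_connecting_cost n c = min_connecting_cost n c'"
  unfolding min_connecting_cost_def
  by (intro arg_cong[where f=Min] image_cong refl sum.cong) (use assms in auto)

lemma borel_measurable_min_connecting_cost:
  assumes "\<And>h. h \<in> complete_edges n \<Longrightarrow> (\<lambda>x. c x h) \<in> borel_measurable M"
  shows "(\<lambda>x. min_connecting_cost n (c x)) \<in> borel_measurable M"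
  unfolding min_connecting_cost_def
  by (intro borel_measurable_Min finite_connecting borel_measurable_sum) (use assms in auto)

text \<open>The old optimum T remains a competitor. Each of its raised edges costs at most K more,
  and nothing more if its cost was already K.\<close>

lemma min_connecting_cost_raise:
  assumes c: "\<And>h. h \<in> complete_edges n \<Longrightarrow> 0 \<le> c h \<and> c h \<le> K"
    and c': "\<And>h. h \<in> complete_edges n \<Longrightarrow> c' h = (if h \<in> J then K else c h)"
    and T: "T \<subseteq> complete_edges n" "connected_graph {1..n} T" "min_connecting_cost n c = sum c T"
    and n: "0 < n"
  shows "\<bar>min_connecting_cost n c - min_connecting_cost n c'\<bar> \<le> K * real (card {h \<in> T. h \<in> J \<and> c h < K})"
proof -
  have fT: "finite T" using T(1) finite_subset finite_complete_edges by blast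
  have "min_connecting_cost n c \<le> min_connecting_cost n c'"
    by (rule min_connecting_cost_mono) (use c c' n in auto)
  moreover have "min_connecting_cost n c' \<le> sum c' T" using T by (intro min_connecting_cost_le)
  moreover have "sum c' T \<le> sum c T + (\<Sum>h\<in>T. if h \<in> J \<and> c h < K then K else 0)"
    unfolding sum.distrib[symmetric]
  proof (rule sum_mono)
    fix h assume "h \<in> T"
    then have "h \<in> complete_edges n" using T(1) by auto
    then show "c' h \<le> c h + (if h \<in> J \<and> c h < K then K else 0)"
      using c[of h] c'[of h] by auto
  qed
  moreover have "(\<Sum>h\<in>T. if h \<in> J \<and> c h < K then K else 0) = K * real (card {h \<in> T. h \<in> J \<and> c h < K})"
    using fT by (simp add: sum.inter_filter[symmetric])
  ultimately show ?thesis using T(3) by linarith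
qed

context weighted_random_graph
begin

text \<open>Truncation below at 0 puts the values into [0, K] for every outcome, including the null
  set on which a weight is not positive.\<close>

definition capped_cost :: "real \<Rightarrow> 'w \<Rightarrow> nat set \<Rightarrow> real" where
  "capped_cost K \<omega> h = (if Z h \<omega> then max 0 (min (edge_cost r X W h \<omega>) K) else K)"

text \<open>The edges whose capped cost can depend on the given input.\<close>

definition touched :: "source \<Rightarrow> nat set set" where
  "touched i = (case i of EdgeState h \<Rightarrow> {h} | EdgeWeight h \<Rightarrow> {h} | Mark u \<Rightarrow> {h. u \<in> h})"

lemma finite_sources: "finite sources"
  by (simp add: sources_def)

lemma capped_cost_bounds: "0 \<le> K \<Longrightarrow> 0 \<le> capped_cost K \<omega> h \<and> capped_cost K \<omega> h \<le> K"
  by (auto simp: capped_cost_def)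

text \<open>Raising all touched costs to K gives a function that no longer depends on input i, which
  is the form of comparison function that the Efron-Stein inequality admits. It also never lowers a
  cost, so no resampled input has to be analysed.\<close>

lemma efron_stein_capped:
  assumes n: "0 < n" and K: "0 \<le> K"
  shows "variance (\<lambda>\<omega>. min_connecting_cost n (capped_cost K \<omega>))
    \<le> (\<Sum>i\<in>sources. expectation (\<lambda>\<omega>. (min_connecting_cost n (capped_cost K \<omega>)
        - min_connecting_cost n (\<lambda>h. if h \<in> touched i then K else capped_cost K \<omega> h))\<^sup>2))"
proof -
  define x0 where "x0 = (SOME x. x \<in> space S)"
  obtain \<omega>0 where "\<omega>0 \<in> space M" using not_empty by auto
  then have "X 1 \<omega>0 \<in> space S" using n by (intro mark_space) auto
  then have x0: "x0 \<in> space S" unfolding x0_def by (rule someI)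
  define N where "N = (count_space UNIV :: bool measure) \<Otimes>\<^sub>M (borel :: real measure) \<Otimes>\<^sub>M S"
  define V where "V i \<omega> = (case i of EdgeState h \<Rightarrow> (Z h \<omega>, 0, x0) | EdgeWeight h \<Rightarrow> (False, W h \<omega>, x0)
    | Mark u \<Rightarrow> (False, 0, X u \<omega>))" for i \<omega>
  have Vk: "V i \<in> known {i} \<rightarrow>\<^sub>M N" if "i \<in> sources" for i
  proof (cases i)
    case (EdgeState h)
    then have [measurable]: "Z h \<in> known {EdgeState h} \<rightarrow>\<^sub>M count_space UNIV" using that state_known by (auto simp: sources_def)
    show ?thesis unfolding V_def N_def EdgeState using x0 by simp
  next
    case (EdgeWeight h)
    then have [measurable]: "W h \<in> borel_measurable (known {EdgeWeight h})" using that weight_known by (auto simp: sources_def)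
    show ?thesis unfolding V_def N_def EdgeWeight using x0 by simp
  next
    case (Mark u)
    then have [measurable]: "X u \<in> known {Mark u} \<rightarrow>\<^sub>M S" using that mark_known by (auto simp: sources_def)
    show ?thesis unfolding V_def N_def Mark by simp
  qed
  have ind: "indep_vars (\<lambda>_. N) V sources"
    by (rule indep_known[where K="\<lambda>i. {i}"]) (use Vk in \<open>auto simp: disjoint_family_on_def\<close>)
  define cc where "cc J y h = (if h \<in> J then K else if fst (y (EdgeState h)) then
      max 0 (min (r (snd (snd (y (Mark (Min h))))) (snd (snd (y (Mark (Max h))))) * fst (snd (y (EdgeWeight h)))) K)
      else K)" for J :: "nat set set" and y :: "source \<Rightarrow> bool \<times> real \<times> 'm" and h
  have ccb: "0 \<le> cc J y h \<and> cc J y h \<le> K" for J y h using K by (auto simp: cc_def)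
  have ccm: "(\<lambda>y. cc J y h) \<in> borel_measurable (PiM sources (\<lambda>_. N))" if h: "h \<in> complete_edges n" for h J
  proof -
    have src: "EdgeState h \<in> sources" "EdgeWeight h \<in> sources" "Mark (Min h) \<in> sources" "Mark (Max h) \<in> sources"
      using h Min_Max_complete_edges[OF h] by (auto simp: sources_def)
    have comp: "(\<lambda>y. y i) \<in> PiM sources (\<lambda>_. N) \<rightarrow>\<^sub>M N" if "i \<in> sources" for i
      using that by (rule measurable_component_singleton)
    have [measurable]: "(\<lambda>y. fst (y (EdgeState h))) \<in> PiM sources (\<lambda>_. N) \<rightarrow>\<^sub>M count_space UNIV"
      "(\<lambda>y. fst (snd (y (EdgeWeight h)))) \<in> borel_measurable (PiM sources (\<lambda>_. N))"
      "(\<lambda>y. snd (snd (y (Mark (Min h))))) \<in> PiM sources (\<lambda>_. N) \<rightarrow>\<^sub>M S"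
      "(\<lambda>y. snd (snd (y (Mark (Max h))))) \<in> PiM sources (\<lambda>_. N) \<rightarrow>\<^sub>M S"
      using comp[OF src(1)] comp[OF src(2)] comp[OF src(3)] comp[OF src(4)] unfolding N_def by simp_all
    have [measurable]: "(\<lambda>y. r (snd (snd (y (Mark (Min h))))) (snd (snd (y (Mark (Max h))))))
      \<in> borel_measurable (PiM sources (\<lambda>_. N))"
      by (rule measurable_Pair_compose_split[OF r_measurable]) measurable
    show ?thesis unfolding cc_def by measurable
  qed
  have cc_V: "cc J (\<lambda>i\<in>sources. V i \<omega>) h = (if h \<in> J then K else capped_cost K \<omega> h)"
    if h: "h \<in> complete_edges n" for J \<omega> h
  proof -
    have "EdgeState h \<in> sources" "EdgeWeight h \<in> sources" "Mark (Min h) \<in> sources" "Mark (Max h) \<in> sources"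
      using h Min_Max_complete_edges[OF h] by (auto simp: sources_def)
    then show ?thesis by (simp add: cc_def V_def capped_cost_def edge_cost_def)
  qed
  have cc_upd: "cc (touched i) (y(i := z)) h = cc (touched i) y h" if h: "h \<in> complete_edges n" for i y z h
  proof -
    have "Min h \<in> h" "Max h \<in> h" using Min_Max_complete_edges(4)[OF h] by auto
    then show ?thesis by (cases i) (auto simp: cc_def touched_def)
  qed
  have "variance (\<lambda>\<omega>. min_connecting_cost n (cc {} (\<lambda>i\<in>sources. V i \<omega>)))
    \<le> (\<Sum>i\<in>sources. expectation (\<lambda>\<omega>. (min_connecting_cost n (cc {} (\<lambda>i\<in>sources. V i \<omega>))
        - min_connecting_cost n (cc (touched i) (\<lambda>i\<in>sources. V i \<omega>)))\<^sup>2))"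
  proof (rule efron_stein[OF ind finite_sources, where C="real (n - 1) * K"
        and f="\<lambda>y. min_connecting_cost n (cc {} y)" and g="\<lambda>i y. min_connecting_cost n (cc (touched i) y)"])
    show "sources \<noteq> {}" using n by (auto simp: sources_def)
    have bd: "\<bar>min_connecting_cost n (cc J y)\<bar> \<le> real (n - 1) * K" for J y
      using min_connecting_cost_bounds[of n "cc J y" K] ccb n by simp
    then show "\<bar>min_connecting_cost n (cc {} y)\<bar> \<le> real (n - 1) * K"
      "\<bar>min_connecting_cost n (cc (touched i) y)\<bar> \<le> real (n - 1) * K" for i y by blast+
    show "min_connecting_cost n (cc (touched i) (y(i := z))) = min_connecting_cost n (cc (touched i) y)" for i y z
      by (intro min_connecting_cost_cong cc_upd)
  qed (intro borel_measurable_min_connecting_cost ccm; assumption)+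
  moreover have "min_connecting_cost n (cc J (\<lambda>i\<in>sources. V i \<omega>))
      = min_connecting_cost n (\<lambda>h. if h \<in> J then K else capped_cost K \<omega> h)" for J \<omega>
    by (intro min_connecting_cost_cong cc_V)
  ultimately show ?thesis by simp
qed

lemma capped_cost_measurable:
  assumes h: "h \<in> complete_edges n"
  shows "(\<lambda>\<omega>. capped_cost K \<omega> h) \<in> borel_measurable M"
proof -
  have [measurable]: "edge_cost r X W h \<in> borel_measurable M" "Z h \<in> M \<rightarrow>\<^sub>M count_space UNIV"
    using edge_cost_measurable state_measurable h by auto
  show ?thesis unfolding capped_cost_def by measurable
qed

text \<open>A bound for every outcome: the optimal tree T has fewer than n edges, so the edge states
  and the edge weights contribute at most n each, in units of K squared; the marks contribute the
  terms with l and with the vertices of large degree.\<close>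

lemma sum_resampling_bound:
  assumes n: "0 < n" and K: "0 \<le> K" and l: "0 \<le> l"
  shows "(\<Sum>i\<in>sources. (min_connecting_cost n (capped_cost K \<omega>)
        - min_connecting_cost n (\<lambda>h. if h \<in> touched i then K else capped_cost K \<omega> h))\<^sup>2)
    \<le> K\<^sup>2 * (2 * real n * l + 2 * real n + (real n)\<^sup>2 *
        (\<Sum>u\<in>{1..n}. if l \<le> real (card {v \<in> {1..n} - {u}. Z {u, v} \<omega>}) then 1 else 0))"
proof -
  let ?c = "capped_cost K \<omega>"
  let ?deg = "\<lambda>u. real (card {v \<in> {1..n} - {u}. Z {u, v} \<omega>})"
  let ?ov = "\<lambda>u. if l \<le> ?deg u then 1 else 0 :: real"
  obtain T where T: "T \<subseteq> complete_edges n" "connected_graph {1..n} T" "card T = n - 1"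
    "min_connecting_cost n ?c = sum ?c T"
    by (rule min_connecting_cost_attained[of n ?c]) (use capped_cost_bounds[OF K] n in auto)
  have fT: "finite T" using T(1) finite_subset finite_complete_edges by blast
  define \<Delta> where "\<Delta> i = min_connecting_cost n ?c
        - min_connecting_cost n (\<lambda>h. if h \<in> touched i then K else ?c h)" for i
  define t where "t i = real (card {h \<in> T. h \<in> touched i \<and> Z h \<omega>})" for i
  have \<Delta>: "(\<Delta> i)\<^sup>2 \<le> K\<^sup>2 * (t i)\<^sup>2" for i
  proof -
    have "\<bar>\<Delta> i\<bar> \<le> K * real (card {h \<in> T. h \<in> touched i \<and> ?c h < K})"
      unfolding \<Delta>_def by (rule min_connecting_cost_raise[OF _ _ T(1,2,4) n]) (use capped_cost_bounds[OF K] in auto)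
    \<comment> \<open>A capped cost below K means that the edge is present in G.\<close>
    also have "\<dots> \<le> K * t i"
      unfolding t_def using fT K by (intro mult_left_mono of_nat_mono card_mono) (auto simp: capped_cost_def)
    finally have "\<bar>\<Delta> i\<bar> \<le> \<bar>K * t i\<bar>" by linarith
    then have "(\<Delta> i)\<^sup>2 \<le> (K * t i)\<^sup>2" by (simp only: abs_le_square_iff)
    then show ?thesis by (simp add: power_mult_distrib)
  qed
  have t_edge: "(\<Sum>e\<in>complete_edges n. (t (f e))\<^sup>2) \<le> real n" if "\<And>e. touched (f e) = {e}" for f
  proof -
    have "(t (f e))\<^sup>2 \<le> (if e \<in> T then 1 else 0)" for e
    proof -
      have "{h \<in> T. h \<in> touched (f e) \<and> Z h \<omega>} \<subseteq> (if e \<in> T then {e} else {})" using that[of e] by auto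
      then have "card {h \<in> T. h \<in> touched (f e) \<and> Z h \<omega>} \<le> card (if e \<in> T then {e} else {})"
        by (intro card_mono) auto
      then have "t (f e) \<le> (if e \<in> T then 1 else 0)" by (auto simp: t_def split: if_splits)
      moreover have "0 \<le> t (f e)" by (simp add: t_def)
      ultimately show ?thesis by (auto simp: power_le_one split: if_splits)
    qed
    then have "(\<Sum>e\<in>complete_edges n. (t (f e))\<^sup>2) \<le> (\<Sum>e\<in>complete_edges n. if e \<in> T then 1 else 0)"
      by (intro sum_mono)
    also have "\<dots> = real (card (complete_edges n \<inter> T))" by (simp add: sum.If_cases)
    also have "complete_edges n \<inter> T = T" using T(1) by auto
    finally show ?thesis using T(3) by simp
  qed
  \<comment> \<open>The count is bounded by the degree of u in G and by its degree in T. One factor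
    of the square is replaced by l; the other is kept, because the tree degrees sum to 2(n - 1).
    Vertices of large degree in G get the trivial bound.\<close>
  have t_mark: "(t (Mark u))\<^sup>2 \<le> l * real (card {h \<in> T. u \<in> h}) + (real n)\<^sup>2 * ?ov u" if u: "u \<in> {1..n}" for u
  proof -
    have "t (Mark u) \<le> (\<Sum>h\<in>{h \<in> complete_edges n. u \<in> h}. if Z h \<omega> then 1 else 0)"
    proof -
      have "card {h \<in> T. h \<in> touched (Mark u) \<and> Z h \<omega>} \<le> card {h \<in> {h \<in> complete_edges n. u \<in> h}. Z h \<omega>}"
        using T(1) by (intro card_mono) (auto simp: touched_def)
      then show ?thesis by (simp add: t_def sum.If_cases Int_def)
    qed
    also have "\<dots> = ?deg u"
      unfolding sum_edges_at[OF u] by (simp add: sum.If_cases Int_def conj_commute)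
    finally have t_deg: "t (Mark u) \<le> ?deg u" .
    have "card {v \<in> {1..n} - {u}. Z {u, v} \<omega>} \<le> card {1..n}" by (intro card_mono) auto
    then have deg_n: "?deg u \<le> real n" by simp
    have t0: "0 \<le> t (Mark u)" by (simp add: t_def)
    have "card {h \<in> T. h \<in> touched (Mark u) \<and> Z h \<omega>} \<le> card {h \<in> T. u \<in> h}"
      using fT by (intro card_mono) (auto simp: touched_def)
    then have t_T: "t (Mark u) \<le> real (card {h \<in> T. u \<in> h})" by (simp add: t_def)
    show ?thesis
    proof (cases "l \<le> ?deg u")
      case True
      have "(t (Mark u))\<^sup>2 \<le> (real n)\<^sup>2" using t0 t_deg deg_n by (intro power_mono) auto
      then show ?thesis using True l by (simp add: add_increasing)
    next
      case False
      then have "t (Mark u) * t (Mark u) \<le> l * real (card {h \<in> T. u \<in> h})"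
        using t0 t_deg t_T l by (intro mult_mono) auto
      then show ?thesis using False by (simp add: power2_eq_square)
    qed
  qed
  have deg_sum: "(\<Sum>u\<in>{1..n}. real (card {h \<in> T. u \<in> h})) \<le> 2 * real n"
    using sum_edges_handshake[OF T(1), of "\<lambda>_. 1"] T(3) by simp
  have "(\<Sum>i\<in>sources. (\<Delta> i)\<^sup>2) \<le> (\<Sum>i\<in>sources. K\<^sup>2 * (t i)\<^sup>2)" by (intro sum_mono \<Delta>)
  also have "\<dots> = K\<^sup>2 * (\<Sum>i\<in>sources. (t i)\<^sup>2)" by (simp add: sum_distrib_left)
  also have "(\<Sum>i\<in>sources. (t i)\<^sup>2) = (\<Sum>e\<in>complete_edges n. (t (EdgeState e))\<^sup>2)
      + (\<Sum>e\<in>complete_edges n. (t (EdgeWeight e))\<^sup>2) + (\<Sum>u\<in>{1..n}. (t (Mark u))\<^sup>2)"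
    unfolding sources_def
    by (subst sum.union_disjoint; (auto simp: sum.reindex inj_on_def)?)
      (subst sum.union_disjoint; auto simp: sum.reindex inj_on_def)
  also have "\<dots> \<le> real n + real n
      + (\<Sum>u\<in>{1..n}. l * real (card {h \<in> T. u \<in> h}) + (real n)\<^sup>2 * ?ov u)"
    by (intro add_mono t_edge sum_mono t_mark) (auto simp: touched_def)
  also have "\<dots> = 2 * real n + l * (\<Sum>u\<in>{1..n}. real (card {h \<in> T. u \<in> h})) + (real n)\<^sup>2 * (\<Sum>u\<in>{1..n}. ?ov u)"
    by (simp add: sum.distrib sum_distrib_left)
  also have "\<dots> \<le> 2 * real n * l + 2 * real n + (real n)\<^sup>2 * (\<Sum>u\<in>{1..n}. ?ov u)"
    using mult_left_mono[OF deg_sum l] by (simp add: algebra_simps)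
  finally show ?thesis unfolding \<Delta>_def by (simp add: mult_left_mono)
qed

text \<open>In the last term, n vertices may have an exceptional degree, each with the trivial
  contribution n squared, and the exponential is the probability of such a degree.\<close>

lemma variance_capped:
  assumes n: "0 < n" and K: "0 \<le> K" and l: "0 \<le> l"
    and D: "\<And>u. u \<in> {1..n} \<Longrightarrow> (\<Sum>v\<in>{1..n} - {u}. q {u, v}) \<le> D"
  shows "variance (\<lambda>\<omega>. min_connecting_cost n (capped_cost K \<omega>))
    \<le> K\<^sup>2 * (2 * real n * l + 2 * real n + real n ^ 3 * exp (2 * D - l))"
proof -
  let ?f = "\<lambda>\<omega>. min_connecting_cost n (capped_cost K \<omega>)"
  let ?g = "\<lambda>i \<omega>. min_connecting_cost n (\<lambda>h. if h \<in> touched i then K else capped_cost K \<omega> h)"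
  let ?deg = "\<lambda>u \<omega>. real (card {v \<in> {1..n} - {u}. Z {u, v} \<omega>})"
  let ?ov = "\<lambda>u \<omega>. if l \<le> ?deg u \<omega> then 1 else 0 :: real"
  have fm: "?f \<in> borel_measurable M"
    by (intro borel_measurable_min_connecting_cost capped_cost_measurable)
  have gm: "?g i \<in> borel_measurable M" for i
  proof (rule borel_measurable_min_connecting_cost)
    show "(\<lambda>\<omega>. if h \<in> touched i then K else capped_cost K \<omega> h) \<in> borel_measurable M"
      if "h \<in> complete_edges n" for h
      using capped_cost_measurable[OF that] by (cases "h \<in> touched i") auto
  qed
  have fb: "0 \<le> ?f \<omega>" "?f \<omega> \<le> real (n - 1) * K" for \<omega>
    by (rule min_connecting_cost_bounds; use capped_cost_bounds[OF K] n in auto)+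
  have gb: "0 \<le> ?g i \<omega>" "?g i \<omega> \<le> real (n - 1) * K" for i \<omega>
    by (rule min_connecting_cost_bounds; use capped_cost_bounds[OF K] n K in auto)+
  have int: "integrable M (\<lambda>\<omega>. (?f \<omega> - ?g i \<omega>)\<^sup>2)" for i
  proof (rule integrable_bounded_real[of _ "(real (n - 1) * K)\<^sup>2"])
    fix \<omega>
    have "\<bar>?f \<omega> - ?g i \<omega>\<bar> \<le> \<bar>real (n - 1) * K\<bar>" using fb[of \<omega>] gb[of i \<omega>] by linarith
    then show "\<bar>(?f \<omega> - ?g i \<omega>)\<^sup>2\<bar> \<le> (real (n - 1) * K)\<^sup>2"
      unfolding abs_power2 by (rule abs_le_square_iff[THEN iffD1])
  qed (use fm gm in auto)
  have degm: "?deg u \<in> borel_measurable M" if u: "u \<in> {1..n}" for u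
  proof -
    have "{u, v} \<in> complete_edges n" if "v \<in> {1..n} - {u}" for v using that u by auto
    then have [measurable]: "Z {u, v} \<in> M \<rightarrow>\<^sub>M count_space UNIV" if "v \<in> {1..n} - {u}" for v
      using that state_measurable by blast
    have "?deg u \<omega> = (\<Sum>v\<in>{1..n} - {u}. if Z {u, v} \<omega> then 1 else 0)" for \<omega>
      by (simp add: sum.If_cases Int_def conj_commute)
    then show ?thesis by simp
  qed
  have ev: "{\<omega> \<in> space M. l \<le> ?deg u \<omega>} \<in> events" if "u \<in> {1..n}" for u
    using degm[OF that] by measurable
  have iov: "integrable M (?ov u)" if u: "u \<in> {1..n}" for u
  proof (rule integrable_bounded_real[of _ 1])
    note [measurable] = degm[OF u]
    show "?ov u \<in> borel_measurable M" by measurable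
  qed auto
  have Eov: "expectation (?ov u) \<le> exp (2 * D - l)" if u: "u \<in> {1..n}" for u
  proof -
    have "expectation (?ov u) = expectation (indicator {\<omega> \<in> space M. l \<le> ?deg u \<omega>})"
    proof (rule Bochner_Integration.integral_cong[OF refl])
      fix \<omega> assume "\<omega> \<in> space M"
      then show "?ov u \<omega> = indicator {\<omega> \<in> space M. l \<le> ?deg u \<omega>} \<omega>"
        by (simp only: indicator_def mem_Collect_eq simp_thms of_bool_def)
    qed
    also have "\<dots> = prob {\<omega> \<in> space M. l \<le> ?deg u \<omega>}"
      unfolding Bochner_Integration.integral_indicator sets.Int_space_eq2[OF ev[OF u]] ..
    also have "\<dots> \<le> exp (2 * D - l)" by (rule degree_tail[OF u D[OF u]])
    finally show ?thesis .
  qed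
  have "variance ?f \<le> (\<Sum>i\<in>sources. expectation (\<lambda>\<omega>. (?f \<omega> - ?g i \<omega>)\<^sup>2))"
    by (rule efron_stein_capped[OF n K])
  also have "\<dots> = expectation (\<lambda>\<omega>. \<Sum>i\<in>sources. (?f \<omega> - ?g i \<omega>)\<^sup>2)"
    using int by (intro Bochner_Integration.integral_sum[symmetric])
  also have "\<dots> \<le> expectation (\<lambda>\<omega>. K\<^sup>2 * (2 * real n * l + 2 * real n + (real n)\<^sup>2 * (\<Sum>u\<in>{1..n}. ?ov u \<omega>)))"
  proof (rule integral_mono)
    show "integrable M (\<lambda>\<omega>. K\<^sup>2 * (2 * real n * l + 2 * real n + (real n)\<^sup>2 * (\<Sum>u\<in>{1..n}. ?ov u \<omega>)))"
      using iov by (intro integrable_mult_right Bochner_Integration.integrable_add Bochner_Integration.integrable_sum) auto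
  qed (use int sum_resampling_bound[OF n K l] in auto)
  also have "\<dots> = K\<^sup>2 * (2 * real n * l + 2 * real n + (real n)\<^sup>2 * (\<Sum>u\<in>{1..n}. expectation (?ov u)))"
  proof -
    define Q where "Q \<omega> = (\<Sum>u\<in>{1..n}. ?ov u \<omega>)" for \<omega>
    have "integrable M Q" unfolding Q_def using iov by (rule Bochner_Integration.integrable_sum)
    moreover have "expectation Q = (\<Sum>u\<in>{1..n}. expectation (?ov u))"
      unfolding Q_def using iov by (rule Bochner_Integration.integral_sum)
    ultimately show ?thesis unfolding Q_def[symmetric] by (simp add: prob_space)
  qed
  also have "\<dots> \<le> K\<^sup>2 * (2 * real n * l + 2 * real n + (real n)\<^sup>2 * (\<Sum>u\<in>{1..n}. exp (2 * D - l)))"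
    by (intro mult_left_mono add_left_mono sum_mono Eov) auto
  also have "\<dots> = K\<^sup>2 * (2 * real n * l + 2 * real n + real n ^ 3 * exp (2 * D - l))"
    by (simp add: power2_eq_square power3_eq_cube)
  finally show ?thesis .
qed

end

section \<open>The minimum spanning tree\<close>

context weighted_random_graph
begin

section \<open>Measurability of the spanning tree cost\<close>

lemma random_edges_subset: "random_edges n Z \<omega> \<subseteq> complete_edges n"
  by (auto simp: random_edges_def)

lemma random_edges_pred: "Measurable.pred M (\<lambda>\<omega>. random_edges n Z \<omega> = E)" if E: "E \<subseteq> complete_edges n"
proof -
  have [measurable]: "Z e \<in> M \<rightarrow>\<^sub>M count_space UNIV" if "e \<in> complete_edges n" for e
    using state_measurable that .
  have "Measurable.pred M (\<lambda>\<omega>. \<forall>e\<in>complete_edges n. Z e \<omega> = (e \<in> E))"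
    by measurable
  moreover have "(\<forall>e\<in>complete_edges n. Z e \<omega> = (e \<in> E)) \<longleftrightarrow> random_edges n Z \<omega> = E" for \<omega>
    using E by (auto simp: random_edges_def)
  ultimately show ?thesis by simp
qed

text \<open>A random graph takes finitely many values, so a quantity built from it is a finite sum
  over these values. This handles the arbitrary rule \<open>pick\<close> without any regularity of
  it.\<close>

lemma measurable_finite_cases:
  fixes F :: "nat set set \<Rightarrow> 'w \<Rightarrow> real"
  assumes "\<And>\<omega>. \<omega> \<in> space M \<Longrightarrow> R \<omega> \<subseteq> complete_edges n"
    and "\<And>E. E \<subseteq> complete_edges n \<Longrightarrow> Measurable.pred M (\<lambda>\<omega>. R \<omega> = E)"
    and "\<And>E. E \<subseteq> complete_edges n \<Longrightarrow> F E \<in> borel_measurable M"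
  shows "(\<lambda>\<omega>. F (R \<omega>) \<omega>) \<in> borel_measurable M"
proof -
  have "(\<lambda>\<omega>. \<Sum>E\<in>Pow (complete_edges n). if R \<omega> = E then F E \<omega> else 0) \<in> borel_measurable M"
  proof (rule borel_measurable_sum)
    fix E assume "E \<in> Pow (complete_edges n)"
    then have [measurable]: "Measurable.pred M (\<lambda>\<omega>. R \<omega> = E)" "F E \<in> borel_measurable M" using assms by auto
    show "(\<lambda>\<omega>. if R \<omega> = E then F E \<omega> else 0) \<in> borel_measurable M" by measurable
  qed
  then show ?thesis
    by (rule measurable_cong[THEN iffD1, rotated]) (use assms(1) in simp)
qed

lemma mst_cost_measurable: "mst_cost n pick r Z W X \<in> borel_measurable M"
proof -
  define F where "F E \<omega> = Min ((\<lambda>T. \<Sum>h\<in>T. edge_cost r X W h \<omega>) ` {T. spanning_tree_of (pick E) E T})" for E \<omega>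
  have "(\<lambda>\<omega>. F (random_edges n Z \<omega>) \<omega>) \<in> borel_measurable M"
  proof (rule measurable_finite_cases[OF random_edges_subset random_edges_pred])
    fix E assume E: "E \<subseteq> complete_edges n"
    then have fE: "finite E" using finite_subset finite_complete_edges by blast
    show "F E \<in> borel_measurable M"
      unfolding F_def
      by (intro borel_measurable_Min finite_spanning_trees fE borel_measurable_sum edge_cost_measurable)
        (use E in \<open>auto simp: spanning_tree_of_def\<close>)
  qed
  then show ?thesis by (simp add: F_def mst_cost_def[abs_def])
qed

lemma cheap_graph_subset: "cheap_graph y t \<omega> \<subseteq> complete_edges n"
  by (auto simp: cheap_graph_def)

lemma cheap_graph_pred: "Measurable.pred M (\<lambda>\<omega>. cheap_graph y t \<omega> = E)" if E: "E \<subseteq> complete_edges n"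
proof -
  have [measurable]: "Z e \<in> M \<rightarrow>\<^sub>M count_space UNIV" "W e \<in> borel_measurable M" if "e \<in> complete_edges n" for e
    using state_measurable weight_measurable that by auto
  have [measurable]: "mark_cost e \<in> borel_measurable M" if e: "e \<in> complete_edges n" for e
    by (rule measurable_known[OF mark_cost_known[OF e, of "Mark ` {1..n}"] mark_sources])
      (use complete_edges_subset[OF e] in auto)
  have "Measurable.pred M (\<lambda>\<omega>. \<forall>e\<in>complete_edges n. (Z e \<omega> \<and> W e \<omega> \<le> y \<and> mark_cost e \<omega> \<le> t) = (e \<in> E))"
    by measurable
  moreover have "(\<forall>e\<in>complete_edges n. (Z e \<omega> \<and> W e \<omega> \<le> y \<and> mark_cost e \<omega> \<le> t) = (e \<in> E))
    \<longleftrightarrow> cheap_graph y t \<omega> = E" for \<omega>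
    using E by (auto simp: cheap_graph_def)
  ultimately show ?thesis by simp
qed

definition bad :: "real \<Rightarrow> real \<Rightarrow> 'w \<Rightarrow> real" where
  "bad y t \<omega> = (if connected_graph {1..n} (cheap_graph y t \<omega>) then 0 else 1)"

lemma bad_measurable: "bad y t \<in> borel_measurable M"
  unfolding bad_def[abs_def]
  by (rule measurable_finite_cases[OF cheap_graph_subset cheap_graph_pred,
        where F="\<lambda>E \<omega>. if connected_graph {1..n} E then 0 else 1"]) auto

definition total_cost :: "'w \<Rightarrow> real" where
  "total_cost \<omega> = (\<Sum>h\<in>complete_edges n. edge_cost r X W h \<omega>)"

lemma total_cost_measurable: "total_cost \<in> borel_measurable M"
  unfolding total_cost_def[abs_def] by (intro borel_measurable_sum edge_cost_measurable)

definition positive_weights :: "'w \<Rightarrow> bool" where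
  "positive_weights \<omega> \<longleftrightarrow> (\<forall>h\<in>complete_edges n. 0 < W h \<omega>)"

lemma AE_positive_weights:
  assumes "AE x in L. 0 < x"
  shows "AE \<omega> in M. positive_weights \<omega>"
  unfolding positive_weights_def
proof (rule AE_finite_allI[OF finite_complete_edges])
  fix h assume h: "h \<in> complete_edges n"
  have "AE x in distr M borel (W h). 0 < x" unfolding weight_law[OF h] by (rule assms)
  then show "AE \<omega> in M. 0 < W h \<omega>" by (rule AE_distrD[OF weight_measurable[OF h]])
qed

lemma edge_cost_pos:
  "positive_weights \<omega> \<Longrightarrow> \<omega> \<in> space M \<Longrightarrow> h \<in> complete_edges n \<Longrightarrow> 0 < edge_cost r X W h \<omega>"
  by (simp add: positive_weights_def edge_cost_eq mark_cost_pos)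

text \<open>Valid also when G is disconnected: the sum of all edge costs is the only control over
  \<tau> on the failure event.\<close>

lemma mst_cost_bounds:
  assumes pick: "largest_component_rule n pick" and \<omega>: "\<omega> \<in> space M" "positive_weights \<omega>"
  shows "0 \<le> mst_cost n pick r Z W X \<omega>" "mst_cost n pick r Z W X \<omega> \<le> total_cost \<omega>"
proof -
  let ?E = "random_edges n Z \<omega>"
  let ?A = "{T. spanning_tree_of (pick ?E) ?E T}"
  have fE: "finite ?E" using random_edges_subset finite_subset finite_complete_edges by blast
  have "pick ?E \<in> components {1..n} ?E"
    using pick random_edges_subset by (auto simp: largest_component_rule_def largest_components_def)
  then have ne: "?A \<noteq> {}" using component_has_spanning_tree random_edges_subset by blast
  have "mst_cost n pick r Z W X \<omega> \<in> (\<lambda>T. \<Sum>h\<in>T. edge_cost r X W h \<omega>) ` ?A"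
    unfolding mst_cost_def using finite_spanning_trees[OF fE] ne by (intro Min_in) auto
  then obtain T where T: "spanning_tree_of (pick ?E) ?E T"
    "mst_cost n pick r Z W X \<omega> = (\<Sum>h\<in>T. edge_cost r X W h \<omega>)" by auto
  have TK: "T \<subseteq> complete_edges n" using T(1) random_edges_subset by (auto simp: spanning_tree_of_def)
  have pos: "0 \<le> edge_cost r X W h \<omega>" if "h \<in> complete_edges n" for h
    using edge_cost_pos[OF \<omega>(2,1) that] by simp
  show "0 \<le> mst_cost n pick r Z W X \<omega>" unfolding T(2) using TK pos by (intro sum_nonneg) auto
  show "mst_cost n pick r Z W X \<omega> \<le> total_cost \<omega>"
    unfolding T(2) total_cost_def using TK pos by (intro sum_mono2) auto
qed

lemma pick_connected:
  assumes "largest_component_rule n pick" "connected_graph {1..n} (random_edges n Z \<omega>)"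
  shows "pick (random_edges n Z \<omega>) = {1..n}"
  using assms random_edges_subset components_connected_graph
  by (auto simp: largest_component_rule_def largest_components_def)

lemma mst_cost_eq_capped:
  assumes pick: "largest_component_rule n pick" and \<omega>: "\<omega> \<in> space M" "positive_weights \<omega>"
    and n: "0 < n" and yt: "0 \<le> y" "0 \<le> t" and good: "connected_graph {1..n} (cheap_graph y t \<omega>)"
  shows "connected_graph {1..n} (random_edges n Z \<omega>)"
    and "mst_cost n pick r Z W X \<omega> = min_connecting_cost n (capped_cost (t * y) \<omega>)"
proof -
  let ?E = "random_edges n Z \<omega>"
  let ?c = "\<lambda>h. edge_cost r X W h \<omega>"
  have sub: "cheap_graph y t \<omega> \<subseteq> {h \<in> ?E. ?c h \<le> t * y}"
  proof
    fix h assume h: "h \<in> cheap_graph y t \<omega>"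
    then have "h \<in> complete_edges n" "0 < W h \<omega>" "0 < mark_cost h \<omega>"
      using \<omega> mark_cost_pos by (auto simp: cheap_graph_def positive_weights_def)
    moreover have "mark_cost h \<omega> * W h \<omega> \<le> t * y"
      using h calculation yt by (intro mult_mono) (auto simp: cheap_graph_def)
    ultimately show "h \<in> {h \<in> ?E. ?c h \<le> t * y}"
      using h by (auto simp: cheap_graph_def random_edges_def edge_cost_eq)
  qed
  have c1: "connected_graph {1..n} {h \<in> ?E. ?c h \<le> t * y}" by (rule connected_graph_mono[OF good sub])
  then show con: "connected_graph {1..n} ?E" by (rule connected_graph_mono) auto
  have "mst_cost n pick r Z W X \<omega> = Min ((\<lambda>T. \<Sum>h\<in>T. ?c h) ` {T. spanning_tree_of {1..n} ?E T})"
    by (simp add: mst_cost_def pick_connected[OF pick con])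
  also have "\<dots> = min_connecting_cost n (\<lambda>h. if h \<in> ?E then max 0 (min (?c h) (t * y)) else t * y)"
  proof (rule min_spanning_tree_eq_capped[OF n random_edges_subset _ _ c1])
    show "0 \<le> ?c h" if "h \<in> ?E" for h
      using that edge_cost_pos[OF \<omega>(2,1), of h] random_edges_subset by fastforce
  qed (use yt in simp)
  also have "\<dots> = min_connecting_cost n (capped_cost (t * y) \<omega>)"
    by (intro min_connecting_cost_cong) (simp add: capped_cost_def random_edges_def)
  finally show "mst_cost n pick r Z W X \<omega> = min_connecting_cost n (capped_cost (t * y) \<omega>)" .
qed

lemma mst_cost_lower:
  assumes pick: "largest_component_rule n pick" and \<omega>: "\<omega> \<in> space M" "positive_weights \<omega>"
    and n: "2 \<le> n" and y: "0 \<le> y" and con: "connected_graph {1..n} (random_edges n Z \<omega>)"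
    and few: "real (card {e \<in> complete_edges n. Z e \<omega> \<and> edge_cost r X W e \<omega> \<le> y}) < real n / 4"
  shows "real n / 4 * y \<le> mst_cost n pick r Z W X \<omega>"
proof -
  let ?E = "random_edges n Z \<omega>"
  let ?c = "\<lambda>h. edge_cost r X W h \<omega>"
  let ?C = "{e \<in> complete_edges n. Z e \<omega> \<and> ?c e \<le> y}"
  let ?A = "{T. spanning_tree_of {1..n} ?E T}"
  have fE: "finite ?E" using random_edges_subset finite_subset finite_complete_edges by blast
  have EV: "h \<subseteq> {1..n}" if "h \<in> ?E" for h using that random_edges_subset complete_edges_subset by blast
  have ne: "?A \<noteq> {}" using connected_graph_spanning_tree[OF con] EV n by auto
  have "mst_cost n pick r Z W X \<omega> \<in> (\<lambda>T. \<Sum>h\<in>T. ?c h) ` ?A"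
    unfolding mst_cost_def pick_connected[OF pick con]
    using finite_spanning_trees[OF fE] ne by (intro Min_in) auto
  then obtain T where T: "spanning_tree_of {1..n} ?E T" "mst_cost n pick r Z W X \<omega> = (\<Sum>h\<in>T. ?c h)" by auto
  have TE: "T \<subseteq> ?E" and Tc: "connected_graph {1..n} T" and TV: "\<And>h. h \<in> T \<Longrightarrow> h \<subseteq> {1..n}"
    using T(1) by (auto simp: spanning_tree_of_def)
  have fT: "finite T" using TE fE finite_subset by blast
  have "card {1..n} - 1 \<le> card T" by (rule connected_graph_card_edges[OF Tc TV _ fT]) auto
  moreover have "card T \<le> card (T - ?C) + card ?C"
  proof -
    have "card T \<le> card ((T - ?C) \<union> ?C)" using fT by (intro card_mono) auto
    also have "\<dots> \<le> card (T - ?C) + card ?C" by (rule card_Un_le)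
    finally show ?thesis .
  qed
  ultimately have "real n - 1 \<le> real (card (T - ?C)) + real (card ?C)" by simp
  \<comment> \<open>The inequality n - 1 - n/4 >= n/4 holds exactly when n >= 2.\<close>
  then have "real n / 4 \<le> real (card (T - ?C))" using few n by linarith
  then have "real n / 4 * y \<le> real (card (T - ?C)) * y" using y by (rule mult_right_mono)
  also have "\<dots> = (\<Sum>h\<in>T - ?C. y)" by simp
  also have "\<dots> \<le> (\<Sum>h\<in>T - ?C. ?c h)"
  proof (rule sum_mono)
    fix h assume "h \<in> T - ?C"
    then show "y \<le> ?c h" using TE by (auto simp: random_edges_def)
  qed
  also have "\<dots> \<le> (\<Sum>h\<in>T. ?c h)"
  proof (rule sum_mono2[OF fT])
    show "0 \<le> ?c h" if "h \<in> T - (T - ?C)" for h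
      using edge_cost_pos[OF \<omega>(2,1), of h] that by auto
  qed auto
  finally show ?thesis using T(2) by simp
qed

end

section \<open>Second moments of the total cost\<close>

locale bounded_moments = weighted_random_graph M n q L S r Z W X
  for M :: "'w measure" and n q L and S :: "'m measure" and r Z W X +
  fixes B s :: real
  assumes B0: "0 \<le> B" and s2: "2 \<le> s" and n2: "2 \<le> n"
    and mark_moment: "x \<in> space S \<Longrightarrow> (\<integral>\<^sup>+ \<omega>. ennreal ((r x (X 1 \<omega>))\<^sup>2) \<partial>M) \<le> ennreal B"
    and weight_pos: "AE x in L. 0 < x"
    and weight_moment: "(\<integral>\<^sup>+ x. ennreal (x powr s) \<partial>L) \<le> ennreal B"
begin

text \<open>The factorisation is a hypothesis so that the bound serves twice: with b and e equal to
  1 for integrability, and with the failure indicator and its probability bound.\<close>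

lemma edge_cost_bad_moment:
  assumes h: "h \<in> complete_edges n" and b: "b \<in> borel_measurable M"
    and fac: "(\<integral>\<^sup>+\<omega>. ennreal ((mark_cost h \<omega>)\<^sup>2) * ennreal ((W h \<omega>)\<^sup>2) * b \<omega> \<partial>M)
      \<le> (\<integral>\<^sup>+\<omega>. ennreal ((mark_cost h \<omega>)\<^sup>2) \<partial>M) * (\<integral>\<^sup>+\<omega>. ennreal ((W h \<omega>)\<^sup>2) \<partial>M) * e"
  shows "(\<integral>\<^sup>+\<omega>. ennreal ((edge_cost r X W h \<omega>)\<^sup>2) * b \<omega> \<partial>M) \<le> ennreal (B * (B + 1)) * e"
proof -
  have "(\<integral>\<^sup>+\<omega>. ennreal ((edge_cost r X W h \<omega>)\<^sup>2) * b \<omega> \<partial>M)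
      = (\<integral>\<^sup>+\<omega>. ennreal ((mark_cost h \<omega>)\<^sup>2) * ennreal ((W h \<omega>)\<^sup>2) * b \<omega> \<partial>M)"
    by (simp add: edge_cost_eq power_mult_distrib ennreal_mult)
  also have "\<dots> \<le> ennreal B * ennreal (B + 1) * e"
    using fac mark_second_moment[OF mark_moment h] weight_second_moment[OF weight_pos weight_moment s2 B0 h]
    by (elim order_trans, intro mult_mono) auto
  also have "ennreal B * ennreal (B + 1) = ennreal (B * (B + 1))" using B0 by (simp add: ennreal_mult)
  finally show ?thesis .
qed

lemma card_complete_edges_le: "real (card (complete_edges n)) \<le> (real n)\<^sup>2"
proof -
  have "complete_edges n \<subseteq> (\<lambda>(u, v). {u, v}) ` ({1..n} \<times> {1..n})" by (auto simp: complete_edges_def)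
  then have "card (complete_edges n) \<le> card ((\<lambda>(u, v). {u, v}) ` ({1..n} \<times> {1..n}))" by (intro card_mono) auto
  also have "\<dots> \<le> card ({1..n} \<times> {1..n})" by (rule card_image_le) auto
  also have "\<dots> = n\<^sup>2" by (simp add: power2_eq_square)
  finally show ?thesis by (metis of_nat_le_iff of_nat_power)
qed

text \<open>Cauchy-Schwarz costs one factor, the number of edges, and summing the individual moments
  costs another; each is at most n squared.\<close>

lemma total_cost_moment:
  assumes b: "b \<in> borel_measurable M"
    and each: "\<And>h. h \<in> complete_edges n \<Longrightarrow>
      (\<integral>\<^sup>+\<omega>. ennreal ((edge_cost r X W h \<omega>)\<^sup>2) * b \<omega> \<partial>M) \<le> ennreal C" and C: "0 \<le> C"
  shows "(\<integral>\<^sup>+\<omega>. ennreal ((total_cost \<omega>)\<^sup>2) * b \<omega> \<partial>M) \<le> ennreal (real n ^ 4 * C)"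
proof -
  let ?K = "complete_edges n"
  have em[measurable]: "edge_cost r X W h \<in> borel_measurable M" if "h \<in> ?K" for h
    using edge_cost_measurable[OF that] .
  note [measurable] = b
  have cs: "(total_cost \<omega>)\<^sup>2 \<le> (real n)\<^sup>2 * (\<Sum>h\<in>?K. (edge_cost r X W h \<omega>)\<^sup>2)" for \<omega>
  proof -
    have "(total_cost \<omega>)\<^sup>2 \<le> (\<Sum>h\<in>?K. 1\<^sup>2) * (\<Sum>h\<in>?K. (edge_cost r X W h \<omega>)\<^sup>2)"
      using Cauchy_Schwarz_ineq_sum[of "\<lambda>_. 1" "\<lambda>h. edge_cost r X W h \<omega>" ?K] by (simp add: total_cost_def)
    also have "\<dots> \<le> (real n)\<^sup>2 * (\<Sum>h\<in>?K. (edge_cost r X W h \<omega>)\<^sup>2)"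
      using card_complete_edges_le by (intro mult_right_mono sum_nonneg) auto
    finally show ?thesis .
  qed
  have "(\<integral>\<^sup>+\<omega>. ennreal ((total_cost \<omega>)\<^sup>2) * b \<omega> \<partial>M)
      \<le> (\<integral>\<^sup>+\<omega>. ennreal ((real n)\<^sup>2) * (\<Sum>h\<in>?K. ennreal ((edge_cost r X W h \<omega>)\<^sup>2) * b \<omega>) \<partial>M)"
  proof (rule nn_integral_mono)
    fix \<omega>
    have "ennreal ((total_cost \<omega>)\<^sup>2) \<le> ennreal ((real n)\<^sup>2) * (\<Sum>h\<in>?K. ennreal ((edge_cost r X W h \<omega>)\<^sup>2))"
      using ennreal_leI[OF cs[of \<omega>]] by (simp add: ennreal_mult sum_nonneg sum_ennreal)
    then have "ennreal ((total_cost \<omega>)\<^sup>2) * b \<omega>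
      \<le> ennreal ((real n)\<^sup>2) * (\<Sum>h\<in>?K. ennreal ((edge_cost r X W h \<omega>)\<^sup>2)) * b \<omega>" by (rule mult_right_mono) simp
    then show "ennreal ((total_cost \<omega>)\<^sup>2) * b \<omega>
      \<le> ennreal ((real n)\<^sup>2) * (\<Sum>h\<in>?K. ennreal ((edge_cost r X W h \<omega>)\<^sup>2) * b \<omega>)"
      by (simp only: sum_distrib_right mult.assoc)
  qed
  also have "\<dots> = ennreal ((real n)\<^sup>2) * (\<Sum>h\<in>?K. \<integral>\<^sup>+\<omega>. ennreal ((edge_cost r X W h \<omega>)\<^sup>2) * b \<omega> \<partial>M)"
    by (subst nn_integral_cmult, measurable) (auto intro!: arg_cong2[where f="(*)"] nn_integral_sum)
  also have "\<dots> \<le> ennreal ((real n)\<^sup>2) * (\<Sum>h\<in>?K. ennreal C)" by (intro mult_left_mono sum_mono each) auto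
  also have "\<dots> = ennreal ((real n)\<^sup>2 * (real (card ?K) * C))"
    using C by (simp add: ennreal_mult ennreal_of_nat_eq_real_of_nat)
  also have "\<dots> \<le> ennreal ((real n)\<^sup>2 * ((real n)\<^sup>2 * C))"
    using C card_complete_edges_le by (intro ennreal_leI mult_left_mono mult_right_mono) auto
  also have "(real n)\<^sup>2 * ((real n)\<^sup>2 * C) = real n ^ 4 * C" by (simp add: power2_eq_square power4_eq_xxxx)
  finally show ?thesis .
qed

lemma total_cost_square_integrable: "integrable M (\<lambda>\<omega>. (total_cost \<omega>)\<^sup>2)"
proof -
  have "(\<integral>\<^sup>+\<omega>. ennreal ((total_cost \<omega>)\<^sup>2) * 1 \<partial>M) \<le> ennreal (real n ^ 4 * (B * (B + 1)))"
  proof (rule total_cost_moment)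
    fix h assume h: "h \<in> complete_edges n"
    have "(\<integral>\<^sup>+\<omega>. ennreal ((edge_cost r X W h \<omega>)\<^sup>2) * 1 \<partial>M) \<le> ennreal (B * (B + 1)) * 1"
    proof (rule edge_cost_bad_moment[OF h])
      have mk: "(\<lambda>\<omega>. ennreal ((mark_cost h \<omega>)\<^sup>2)) \<in> borel_measurable (known (Mark ` h))"
        using mark_cost_known[OF h order_refl] by measurable
      have wk: "(\<lambda>\<omega>. ennreal ((W h \<omega>)\<^sup>2)) \<in> borel_measurable (known {EdgeWeight h})"
        using weight_known[OF h, of "{EdgeWeight h}"] by measurable
      show "(\<integral>\<^sup>+\<omega>. ennreal ((mark_cost h \<omega>)\<^sup>2) * ennreal ((W h \<omega>)\<^sup>2) * 1 \<partial>M)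
        \<le> (\<integral>\<^sup>+\<omega>. ennreal ((mark_cost h \<omega>)\<^sup>2) \<partial>M) * (\<integral>\<^sup>+\<omega>. ennreal ((W h \<omega>)\<^sup>2) \<partial>M) * 1"
      proof -
        have "Mark ` h \<subseteq> sources" "{EdgeWeight h} \<subseteq> sources" "Mark ` h \<inter> {EdgeWeight h} = {}"
          using h complete_edges_subset[OF h] by (auto simp: sources_def)
        from nn_integral_mult_known[OF this mk wk] show ?thesis by simp
      qed
    qed simp
    then show "(\<integral>\<^sup>+\<omega>. ennreal ((edge_cost r X W h \<omega>)\<^sup>2) * 1 \<partial>M) \<le> ennreal (B * (B + 1))" by simp
  qed (use B0 in auto)
  then have "(\<integral>\<^sup>+\<omega>. ennreal ((total_cost \<omega>)\<^sup>2) \<partial>M) < \<infinity>"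
    by (simp add: le_less_trans[OF _ ennreal_less_top])
  then show ?thesis
    using total_cost_measurable by (intro integrableI_nonneg) auto
qed

lemma mst_cost_integrable:
  assumes pick: "largest_component_rule n pick"
  shows "integrable M (mst_cost n pick r Z W X)" "integrable M (\<lambda>\<omega>. (mst_cost n pick r Z W X \<omega>)\<^sup>2)"
proof -
  have [measurable]: "mst_cost n pick r Z W X \<in> borel_measurable M" by (rule mst_cost_measurable)
  show 2: "integrable M (\<lambda>\<omega>. (mst_cost n pick r Z W X \<omega>)\<^sup>2)"
  proof (rule Bochner_Integration.integrable_bound[OF total_cost_square_integrable])
    show "AE \<omega> in M. norm ((mst_cost n pick r Z W X \<omega>)\<^sup>2) \<le> norm ((total_cost \<omega>)\<^sup>2)"
      using AE_positive_weights[OF weight_pos] AE_space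
    proof eventually_elim
      case (elim \<omega>)
      then show ?case using mst_cost_bounds[OF pick elim(2,1)] by (simp add: power_mono)
    qed
  qed measurable
  show "integrable M (mst_cost n pick r Z W X)"
    by (rule square_integrable_imp_integrable[OF _ 2]) measurable
qed

end

section \<open>Bounds in terms of the failure probability\<close>

context bounded_moments
begin

text \<open>The estimate \<open>disconnected_moment\<close> is applied with constant factors for the
  probability, and with the squared mark factor and squared weight of one edge for its part of the
  second moment.\<close>

lemma bad_bounds:
  assumes deg: "\<And>u A. u \<in> {1..n} \<Longrightarrow> A \<subseteq> {1..n} \<Longrightarrow> \<gamma>0 * real n \<le> real (card A) \<Longrightarrow>
      a \<le> (\<Sum>v\<in>A - {u}. q {u, v})"
    and \<delta>: "\<delta> + \<gamma>0 \<le> 1 / 2" and z: "z \<le> cdf L y" and a: "0 \<le> a" and t: "0 < t"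
    and \<epsilon>: "exp 1 * ((1 + exp (- z * a)) ^ n - 1) + real n * exp (2 - \<delta> * real n + 2 * (B / t\<^sup>2) * real n) \<le> \<epsilon>"
  shows "expectation (bad y t) \<le> \<epsilon>"
    and "expectation (\<lambda>\<omega>. (total_cost \<omega>)\<^sup>2 * bad y t \<omega>) \<le> real n ^ 4 * (B * (B + 1) * \<epsilon>)"
proof -
  have [measurable]: "bad y t \<in> borel_measurable M" "total_cost \<in> borel_measurable M"
    by (rule bad_measurable total_cost_measurable)+
  have n0: "0 < n" using n2 by simp
  have bad01: "0 \<le> bad y t \<omega>" "bad y t \<omega> \<le> 1" for \<omega> by (auto simp: bad_def)
  have ebad: "ennreal (bad y t \<omega>) = (if connected_graph {1..n} (cheap_graph y t \<omega>) then 0 else 1)" for \<omega>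
    by (simp add: bad_def)
  have tail: "prob {\<omega> \<in> space M. t < r x (X 1 \<omega>)} \<le> B / t\<^sup>2" if "x \<in> space S" for x
    by (rule mark_tail[OF mark_moment that n0 t B0])
  have mom: "(\<integral>\<^sup>+\<omega>. \<Phi> \<omega> * g (W h \<omega>) * ennreal (bad y t \<omega>) \<partial>M)
      \<le> (\<integral>\<^sup>+\<omega>. \<Phi> \<omega> \<partial>M) * (\<integral>\<^sup>+\<omega>. g (W h \<omega>) \<partial>M) * ennreal \<epsilon>"
    if "h \<in> complete_edges n" "\<Phi> \<in> borel_measurable (known (Mark ` h))" "g \<in> borel_measurable borel" for h \<Phi> g
    unfolding ebad
  proof (rule order_trans[OF disconnected_moment[OF deg \<delta> that z a tail]])
    show "0 \<le> B / t\<^sup>2" using B0 by simp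
  qed (assumption | rule mult_left_mono[OF ennreal_leI[OF \<epsilon>]] zero_le)+
  \<comment> \<open>Some edge has to be named even when \<Phi> and g are constant; n >= 2 provides
    this one.\<close>
  have h12: "{1, 2} \<in> complete_edges n" using n2 by simp
  have e0: "0 \<le> \<epsilon>" using \<epsilon> by (rule order_trans[rotated]) (simp add: one_le_power)
  have "(\<integral>\<^sup>+\<omega>. ennreal (bad y t \<omega>) \<partial>M) \<le> ennreal \<epsilon>"
    using mom[OF h12, of "\<lambda>_. 1" "\<lambda>_. 1"] by (simp add: emeasure_space_1)
  moreover have ib: "integrable M (bad y t)"
    by (rule integrable_bounded_real[of _ 1]) (use bad01 in auto)
  ultimately show "expectation (bad y t) \<le> \<epsilon>"
    using bad01 e0 by (simp add: nn_integral_eq_integral)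
  have "(\<integral>\<^sup>+\<omega>. ennreal ((total_cost \<omega>)\<^sup>2) * ennreal (bad y t \<omega>) \<partial>M) \<le> ennreal (real n ^ 4 * (B * (B + 1) * \<epsilon>))"
  proof (rule total_cost_moment)
    fix h assume h: "h \<in> complete_edges n"
    have "(\<integral>\<^sup>+\<omega>. ennreal ((edge_cost r X W h \<omega>)\<^sup>2) * ennreal (bad y t \<omega>) \<partial>M) \<le> ennreal (B * (B + 1)) * ennreal \<epsilon>"
    proof (rule edge_cost_bad_moment[OF h])
      have "(\<lambda>\<omega>. ennreal ((mark_cost h \<omega>)\<^sup>2)) \<in> borel_measurable (known (Mark ` h))"
        using mark_cost_known[OF h order_refl] by measurable
      then show "(\<integral>\<^sup>+\<omega>. ennreal ((mark_cost h \<omega>)\<^sup>2) * ennreal ((W h \<omega>)\<^sup>2) * ennreal (bad y t \<omega>) \<partial>M)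
        \<le> (\<integral>\<^sup>+\<omega>. ennreal ((mark_cost h \<omega>)\<^sup>2) \<partial>M) * (\<integral>\<^sup>+\<omega>. ennreal ((W h \<omega>)\<^sup>2) \<partial>M) * ennreal \<epsilon>"
        by (intro mom[OF h, of "\<lambda>\<omega>. ennreal ((mark_cost h \<omega>)\<^sup>2)" "\<lambda>x. ennreal (x\<^sup>2)"]) auto
    qed simp
    then show "(\<integral>\<^sup>+\<omega>. ennreal ((edge_cost r X W h \<omega>)\<^sup>2) * ennreal (bad y t \<omega>) \<partial>M) \<le> ennreal (B * (B + 1) * \<epsilon>)"
      using B0 e0 by (simp add: ennreal_mult)
  qed (use B0 e0 in auto)
  moreover have "integrable M (\<lambda>\<omega>. (total_cost \<omega>)\<^sup>2 * bad y t \<omega>)"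
    by (rule Bochner_Integration.integrable_bound[OF total_cost_square_integrable])
      (use bad01 in \<open>auto simp: abs_mult mult_left_le\<close>)
  ultimately show "expectation (\<lambda>\<omega>. (total_cost \<omega>)\<^sup>2 * bad y t \<omega>) \<le> real n ^ 4 * (B * (B + 1) * \<epsilon>)"
    using bad01 e0 B0
    by (subst (asm) ennreal_mult[symmetric]) (auto simp: nn_integral_eq_integral ennreal_mult[symmetric])
qed

lemma connected_pred: "Measurable.pred M (\<lambda>\<omega>. connected_graph {1..n} (random_edges n Z \<omega>))"
proof -
  have "(\<lambda>\<omega>. if connected_graph {1..n} (random_edges n Z \<omega>) then 1 else 0 :: real) \<in> borel_measurable M"
    by (rule measurable_finite_cases[OF random_edges_subset random_edges_pred,
        where F="\<lambda>E \<omega>. if connected_graph {1..n} E then 1 else 0"]) auto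
  then have "Measurable.pred M (\<lambda>\<omega>. (if connected_graph {1..n} (random_edges n Z \<omega>) then 1 else 0 :: real) = 1)"
    by measurable
  moreover have "((if connected_graph {1..n} (random_edges n Z \<omega>) then 1 else 0 :: real) = 1)
    \<longleftrightarrow> connected_graph {1..n} (random_edges n Z \<omega>)" for \<omega> by (cases "connected_graph {1..n} (random_edges n Z \<omega>)") simp_all
  ultimately show ?thesis by (simp only:)
qed

lemma many_cheap_edges_pred: "Measurable.pred M (\<lambda>\<omega>. real n / 4 \<le> real (card {e \<in> complete_edges n. Z e \<omega> \<and> edge_cost r X W e \<omega> \<le> y}))"
proof -
  have [measurable]: "Z e \<in> M \<rightarrow>\<^sub>M count_space UNIV" "edge_cost r X W e \<in> borel_measurable M"
    if "e \<in> complete_edges n" for e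
    using state_measurable edge_cost_measurable that by auto
  have "real (card {e \<in> complete_edges n. Z e \<omega> \<and> edge_cost r X W e \<omega> \<le> y})
      = (\<Sum>e\<in>complete_edges n. if Z e \<omega> \<and> edge_cost r X W e \<omega> \<le> y then 1 else 0)" for \<omega>
    by (simp add: sum.If_cases Int_def)
  then show ?thesis by simp
qed

section \<open>Consequences of the two bounds on the failure event\<close>

context
  fixes pick and y t \<epsilon> :: real
  assumes pick: "largest_component_rule n pick" and y0: "0 \<le> y" and t0: "0 \<le> t"
    and E1: "expectation (bad y t) \<le> \<epsilon>"
    and E2: "expectation (\<lambda>\<omega>. (total_cost \<omega>)\<^sup>2 * bad y t \<omega>) \<le> real n ^ 4 * (B * (B + 1) * \<epsilon>)"
begin

abbreviation mst_value where "mst_value \<equiv> mst_cost n pick r Z W X"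
abbreviation capped_value where "capped_value \<omega> \<equiv> min_connecting_cost n (capped_cost (t * y) \<omega>)"

lemma bad_le_1: "0 \<le> bad y t \<omega>" "bad y t \<omega> \<le> 1" by (auto simp: bad_def)

lemma bad_integrable: "integrable M (bad y t)"
  by (rule integrable_bounded_real[of _ 1]) (use bad_measurable bad_le_1 in auto)

lemma total_bad_integrable: "integrable M (\<lambda>\<omega>. (total_cost \<omega>)\<^sup>2 * bad y t \<omega>)"
  by (rule Bochner_Integration.integrable_bound[OF total_cost_square_integrable])
    (use bad_le_1 bad_measurable total_cost_measurable in \<open>auto simp: abs_mult mult_left_le\<close>)

lemma capped_bounds: "0 \<le> capped_value \<omega>" "capped_value \<omega> \<le> real n * (t * y)"
proof -
  have K: "0 \<le> t * y" using y0 t0 by simp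
  show "0 \<le> capped_value \<omega>" by (rule min_connecting_cost_bounds) (use capped_cost_bounds[OF K] n2 in auto)
  have "capped_value \<omega> \<le> real (n - 1) * (t * y)"
    by (rule min_connecting_cost_bounds) (use capped_cost_bounds[OF K] n2 in auto)
  also have "\<dots> \<le> real n * (t * y)" using K by (intro mult_right_mono) auto
  finally show "capped_value \<omega> \<le> real n * (t * y)" .
qed

lemma mst_good:
  assumes "\<omega> \<in> space M" "positive_weights \<omega>" "bad y t \<omega> = 0"
  shows "mst_value \<omega> = capped_value \<omega>" "connected_graph {1..n} (random_edges n Z \<omega>)"
  using mst_cost_eq_capped[OF pick assms(1,2) _ y0 t0] assms(3) n2 by (auto simp: bad_def split: if_splits)

text \<open>Off the failure event \<tau> is the capped minimum, at most nK; on it, \<tau> is at most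
  1 plus the square of the total cost, so the second-moment bound covers the mean as well.\<close>

lemma mst_expectation_upper:
  "expectation mst_value \<le> real n * (t * y) + \<epsilon> + real n ^ 4 * (B * (B + 1) * \<epsilon>)"
proof -
  have "expectation mst_value \<le> expectation (\<lambda>\<omega>. real n * (t * y) + bad y t \<omega> + (total_cost \<omega>)\<^sup>2 * bad y t \<omega>)"
  proof (rule integral_mono_AE)
    show "AE \<omega> in M. mst_value \<omega> \<le> real n * (t * y) + bad y t \<omega> + (total_cost \<omega>)\<^sup>2 * bad y t \<omega>"
      using AE_positive_weights[OF weight_pos] AE_space
    proof eventually_elim
      case (elim \<omega>)
      show ?case
      proof (cases "bad y t \<omega> = 0")
        case True
        then show ?thesis using mst_good[OF elim(2,1)] capped_bounds(2) by simp
      next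
        case False
        then have 1: "bad y t \<omega> = 1" by (simp add: bad_def split: if_splits)
        \<comment> \<open>Chosen so that expanding it gives the bound of x by the square of x plus
          1/2.\<close>
        have "0 \<le> (total_cost \<omega> - 1)\<^sup>2 + (total_cost \<omega>)\<^sup>2" by simp
        then have "2 * total_cost \<omega> \<le> 2 * (total_cost \<omega>)\<^sup>2 + 1" by (simp add: power2_eq_square algebra_simps)
        moreover have "0 \<le> real n * (t * y)" using y0 t0 by simp
        ultimately show ?thesis using mst_cost_bounds[OF pick elim(2,1)] 1 by simp
      qed
    qed
  qed (use mst_cost_integrable[OF pick] bad_integrable total_bad_integrable in auto)
  also have "\<dots> = real n * (t * y) + expectation (bad y t) + expectation (\<lambda>\<omega>. (total_cost \<omega>)\<^sup>2 * bad y t \<omega>)"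
    using bad_integrable total_bad_integrable by (simp add: prob_space)
  finally show ?thesis using E1 E2 by simp
qed

text \<open>Both \<tau> and the capped minimum are centred at the mean of the latter. They differ
  only on the failure event, up to a null set, where their squares are bounded separately.\<close>

lemma mst_variance_upper:
  "variance mst_value \<le> 2 * variance capped_value + 2 * (real n ^ 4 * (B * (B + 1) * \<epsilon>) + (real n * (t * y))\<^sup>2 * \<epsilon>)"
proof -
  let ?m = "expectation capped_value"
  have cm: "capped_value \<in> borel_measurable M"
    by (intro borel_measurable_min_connecting_cost capped_cost_measurable)
  have ic: "integrable M capped_value"
    by (rule integrable_bounded_real[of _ "real n * (t * y)"]) (use cm capped_bounds in \<open>auto simp: abs_le_iff\<close>)
  have icm: "integrable M (\<lambda>\<omega>. (capped_value \<omega> - ?m)\<^sup>2)"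
  proof (rule integrable_bounded_real[of _ "(real n * (t * y))\<^sup>2"])
    fix \<omega>
    have "0 \<le> ?m" using capped_bounds by (intro integral_nonneg_AE) auto
    moreover have "?m \<le> expectation (\<lambda>_. real n * (t * y))"
      using ic capped_bounds by (intro integral_mono) auto
    ultimately have "\<bar>capped_value \<omega> - ?m\<bar> \<le> \<bar>real n * (t * y)\<bar>" using capped_bounds[of \<omega>] by (simp add: prob_space abs_le_iff)
    then show "\<bar>(capped_value \<omega> - ?m)\<^sup>2\<bar> \<le> (real n * (t * y))\<^sup>2" unfolding abs_power2 by (rule abs_le_square_iff[THEN iffD1])
  qed (use cm in auto)
  have "variance mst_value \<le> expectation (\<lambda>\<omega>. (mst_value \<omega> - ?m)\<^sup>2)"
    by (rule variance_le_sq_deviation[OF mst_cost_integrable[OF pick]])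
  also have "\<dots> \<le> expectation (\<lambda>\<omega>. 2 * (capped_value \<omega> - ?m)\<^sup>2 + 2 * ((total_cost \<omega>)\<^sup>2 * bad y t \<omega> + (real n * (t * y))\<^sup>2 * bad y t \<omega>))"
  proof (rule integral_mono_AE)
    have "(\<lambda>\<omega>. (mst_value \<omega> - ?m)\<^sup>2) = (\<lambda>\<omega>. (mst_value \<omega>)\<^sup>2 - 2 * ?m * mst_value \<omega> + ?m\<^sup>2)"
      by (auto simp: power2_eq_square algebra_simps)
    then show "integrable M (\<lambda>\<omega>. (mst_value \<omega> - ?m)\<^sup>2)" using mst_cost_integrable[OF pick] by simp
    show "AE \<omega> in M. (mst_value \<omega> - ?m)\<^sup>2 \<le> 2 * (capped_value \<omega> - ?m)\<^sup>2
        + 2 * ((total_cost \<omega>)\<^sup>2 * bad y t \<omega> + (real n * (t * y))\<^sup>2 * bad y t \<omega>)"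
      using AE_positive_weights[OF weight_pos] AE_space
    proof eventually_elim
      case (elim \<omega>)
      show ?case
      proof (cases "bad y t \<omega> = 0")
        case True
        then show ?thesis using mst_good(1)[OF elim(2,1)] by simp
      next
        case False
        then have 1: "bad y t \<omega> = 1" by (simp add: bad_def split: if_splits)
        define x where "x = mst_value \<omega>"
        define x' where "x' = capped_value \<omega>"
        have x: "0 \<le> x" "x \<le> total_cost \<omega>" using mst_cost_bounds[OF pick elim(2,1)] by (auto simp: x_def)
        have x': "0 \<le> x'" "x' \<le> real n * (t * y)" using capped_bounds by (auto simp: x'_def)
        have "(x - ?m)\<^sup>2 \<le> 2 * (x' - ?m)\<^sup>2 + 2 * (x - x')\<^sup>2"
        proof -
          have "0 \<le> ((x' - ?m) - (x - x'))\<^sup>2" by simp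
          then show ?thesis by (simp add: power2_eq_square algebra_simps)
        qed
        \<comment> \<open>The cross term has the right sign because both values are
          nonnegative.\<close>
        also have "(x - x')\<^sup>2 \<le> x\<^sup>2 + x'\<^sup>2" using x(1) x'(1) by (simp add: power2_diff)
        also have "x\<^sup>2 \<le> (total_cost \<omega>)\<^sup>2" using x by (intro power_mono) auto
        also have "x'\<^sup>2 \<le> (real n * (t * y))\<^sup>2" using x' by (intro power_mono) auto
        finally show ?thesis by (simp add: 1 x_def x'_def)
      qed
    qed
  qed (use icm bad_integrable total_bad_integrable in auto)
  also have "\<dots> = 2 * variance capped_value + 2 * (expectation (\<lambda>\<omega>. (total_cost \<omega>)\<^sup>2 * bad y t \<omega>)
      + (real n * (t * y))\<^sup>2 * expectation (bad y t))"
  proof -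
    define Q where "Q \<omega> = (capped_value \<omega> - ?m)\<^sup>2" for \<omega>
    define R where "R \<omega> = (total_cost \<omega>)\<^sup>2 * bad y t \<omega>" for \<omega>
    have "integrable M Q" "integrable M R" using icm total_bad_integrable unfolding Q_def[abs_def] R_def[abs_def] by blast+
    then show ?thesis unfolding Q_def[symmetric] R_def[symmetric] using bad_integrable by simp
  qed
  finally show ?thesis
    using E2 mult_left_mono[OF E1, of "(real n * (t * y))\<^sup>2"] by simp
qed

context
  fixes w \<rho> :: real
  assumes w0: "0 \<le> w"
    and few: "prob {\<omega> \<in> space M. real n / 4 \<le> real (card {e \<in> complete_edges n. Z e \<omega> \<and> edge_cost r X W e \<omega> \<le> w})} \<le> \<rho>"
begin

text \<open>Apart from a null set, both bounds hold for every outcome with connected cheap graph and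
  few very cheap edges; \<epsilon> and \<rho> bound the probabilities of the two exceptions.\<close>

lemma mst_event:
  "1 - \<epsilon> - \<rho> \<le> prob {\<omega> \<in> space M. connected_graph {1..n} (random_edges n Z \<omega>) \<and>
      real n / 4 * w \<le> mst_value \<omega> \<and> mst_value \<omega> \<le> real n * (t * y)}" (is "_ \<le> prob ?G")
proof -
  have tm[measurable]: "mst_value \<in> borel_measurable M" by (rule mst_cost_measurable)
  note [measurable] = connected_pred many_cheap_edges_pred bad_measurable
  let ?F = "{\<omega> \<in> space M. real n / 4 \<le> real (card {e \<in> complete_edges n. Z e \<omega> \<and> edge_cost r X W e \<omega> \<le> w})}"
  let ?b = "{\<omega> \<in> space M. bad y t \<omega> = 1}"
  have ev: "?G \<in> events" "?F \<in> events" "?b \<in> events" by measurable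
  have "expectation (bad y t) = expectation (indicator ?b)"
    by (rule Bochner_Integration.integral_cong) (auto simp: bad_def indicator_def)
  then have pb: "prob ?b \<le> \<epsilon>" using E1 ev by simp
  have "AE \<omega> in M. \<omega> \<in> space M - ?G \<longrightarrow> \<omega> \<in> ?F \<union> ?b"
    using AE_positive_weights[OF weight_pos] AE_space
  proof eventually_elim
    case (elim \<omega>)
    show ?case
    proof (rule impI, rule ccontr)
      assume nG: "\<omega> \<in> space M - ?G" and "\<omega> \<notin> ?F \<union> ?b"
      then have nb: "bad y t \<omega> = 0" and nF: "real (card {e \<in> complete_edges n. Z e \<omega> \<and> edge_cost r X W e \<omega> \<le> w}) < real n / 4"
        by (auto simp: bad_def not_le split: if_splits)
      note g = mst_good[OF elim(2,1) nb]
      have "real n / 4 * w \<le> mst_value \<omega>" by (rule mst_cost_lower[OF pick elim(2,1) n2 w0 g(2) nF])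
      then show False using nG g capped_bounds(2)[of \<omega>] by simp
    qed
  qed
  then have "prob (space M - ?G) \<le> prob (?F \<union> ?b)" using ev by (intro finite_measure_mono_AE) auto
  also have "\<dots> \<le> prob ?F + prob ?b" using ev by (intro measure_Un_le) auto
  also have "\<dots> \<le> \<rho> + \<epsilon>" using few pb by (rule add_mono)
  finally show ?thesis using prob_compl[OF ev(1)] by linarith
qed

text \<open>The value n/4 times w is reached with probability at least 1/2 and \<tau> is nonnegative
  otherwise, hence the factor 1/8.\<close>

lemma mst_expectation_lower:
  assumes "1 / 2 \<le> 1 - \<epsilon> - \<rho>"
  shows "real n / 8 * w \<le> expectation mst_value"
proof -
  let ?G = "{\<omega> \<in> space M. connected_graph {1..n} (random_edges n Z \<omega>) \<and>
      real n / 4 * w \<le> mst_value \<omega> \<and> mst_value \<omega> \<le> real n * (t * y)}"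
  have [measurable]: "mst_value \<in> borel_measurable M" by (rule mst_cost_measurable)
  note [measurable] = connected_pred
  have ev: "?G \<in> events" by measurable
  have "real n / 8 * w = real n / 4 * w * (1 / 2)" by simp
  also have "\<dots> \<le> real n / 4 * w * prob ?G"
    using assms mst_event w0 by (intro mult_left_mono) auto
  also have "\<dots> = expectation (\<lambda>\<omega>. real n / 4 * w * indicator ?G \<omega>)" using ev by simp
  also have "\<dots> \<le> expectation mst_value"
  proof (rule integral_mono_AE)
    show "AE \<omega> in M. real n / 4 * w * indicator ?G \<omega> \<le> mst_value \<omega>"
      using AE_positive_weights[OF weight_pos] AE_space
    proof eventually_elim
      case (elim \<omega>)
      then show ?case using mst_cost_bounds(1)[OF pick elim(2,1)] by (auto simp: indicator_def)
    qed
    show "integrable M (\<lambda>\<omega>. real n / 4 * w * indicator ?G \<omega>)"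
      using ev by (intro integrable_mult_right integrable_real_indicator) (auto simp: emeasure_eq_measure)
  qed (rule mst_cost_integrable(1)[OF pick])
  finally show ?thesis .
qed

end

end

end

text \<open>The factor \<open>1 / 2\<close> covers \<open>z = 1\<close>, where \<open>inv_cdf L z = \<infinity>\<close> and \<open>z \<le> cdf L y\<close> may fail for all \<open>y\<close>.\<close>
lemma inv_cdf_witness:
  assumes "prob_space L" "sets L = sets borel" "AE x in L. 0 < x" "0 < z" "z \<le> 1"
  shows "\<exists>y\<ge>0. z / 2 \<le> cdf L y \<and> ennreal y \<le> inv_cdf L z"
proof -
  interpret L: real_distribution L
    using assms(1,2) by (intro real_distribution.intro real_distribution_axioms.intro) (auto dest: sets_eq_imp_space_eq)
  show ?thesis
  proof (cases "inv_cdf L z")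
    case top
    have "eventually (\<lambda>x. 1 / 2 < cdf L x) at_top"
      using L.cdf_lim_at_top_prob by (rule order_tendstoD) simp
    then have "eventually (\<lambda>x. 1 / 2 < cdf L x \<and> 0 \<le> x) at_top"
      using eventually_ge_at_top[of "0::real"] by (rule eventually_conj)
    then obtain x where "1 / 2 < cdf L x" "0 \<le> x" by (auto simp: eventually_at_top_linorder)
    then show ?thesis using assms(5) top by (intro exI[of _ x]) auto
  next
    case (real y)
    have "z \<le> cdf L y"
    proof (rule tendsto_lowerbound)
      show "(cdf L \<longlongrightarrow> cdf L y) (at_right y)"
        using L.cdf_is_right_cont[of y] by (simp add: continuous_within)
      show "eventually (\<lambda>x. z \<le> cdf L x) (at_right y)"
        unfolding eventually_at_right_field
      proof (intro exI[of _ "y + 1"] conjI allI impI)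
        fix x assume x: "y < x" "x < y + 1"
        show "z \<le> cdf L x"
        proof (rule ccontr)
          assume "\<not> z \<le> cdf L x"
          then have "ennreal x \<le> inv_cdf L z"
            unfolding inv_cdf_def using x real by (intro SUP_upper) auto
          then show False using x real by simp
        qed
      qed simp
    qed simp
    then show ?thesis using assms(4) real by (intro exI[of _ y]) auto
  qed
qed

text \<open>The supremum \<open>y\<close> need not be attained, as \<open>cdf L\<close> may jump there; hence \<open>y / 2\<close>.\<close>
lemma inv_cdf_half:
  assumes "prob_space L" "sets L = sets borel" "0 \<le> z" "z < 1"
  shows "\<exists>y\<ge>0. inv_cdf L z = ennreal y \<and> (y = 0 \<or> cdf L (y / 2) \<le> z)"
proof -
  interpret L: real_distribution L
    using assms(1,2) by (intro real_distribution.intro real_distribution_axioms.intro) (auto dest: sets_eq_imp_space_eq)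
  have "eventually (\<lambda>x. z < cdf L x) at_top"
    using L.cdf_lim_at_top_prob assms(4) by (rule order_tendstoD)
  then have "eventually (\<lambda>x. z < cdf L x \<and> 0 \<le> x) at_top"
    using eventually_ge_at_top[of "0::real"] by (rule eventually_conj)
  then obtain b where b: "z < cdf L b" "0 \<le> b" by (auto simp: eventually_at_top_linorder)
  have "inv_cdf L z \<le> ennreal b"
    unfolding inv_cdf_def
  proof (rule SUP_least)
    fix x assume x: "x \<in> {x. 0 < x \<and> cdf L x \<le> z}"
    show "ennreal x \<le> ennreal b"
    proof (rule ennreal_leI, rule ccontr)
      assume "\<not> x \<le> b"
      then show False using L.cdf_nondecreasing[of b x] b x by simp
    qed
  qed
  then obtain y where y: "0 \<le> y" "inv_cdf L z = ennreal y"
    by (metis ennreal_cases ennreal_less_top leD top.not_eq_extremum)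
  have "cdf L (y / 2) \<le> z" if "y \<noteq> 0"
  proof -
    have "ennreal (y / 2) < inv_cdf L z" using y that by (simp add: ennreal_less_iff)
    then obtain x where x: "0 < x" "cdf L x \<le> z" "ennreal (y / 2) < ennreal x"
      unfolding inv_cdf_def less_SUP_iff by auto
    then have "y / 2 \<le> x" using y by (simp add: ennreal_less_iff)
    then show ?thesis using L.cdf_nondecreasing[of "y / 2" x] x(2) by simp
  qed
  then show ?thesis using y by auto
qed

section \<open>Choice of the constants\<close>

text \<open>Turns the union bound over all cuts into a multiple of n times the bound x for cutting
  off a single vertex.\<close>

lemma power_one_plus_le:
  assumes "0 \<le> (x::real)" "real n * x \<le> 1"
  shows "(1 + x) ^ n - 1 \<le> 2 * (real n * x)"
proof -
  have "(1 + x) ^ n \<le> exp x ^ n" using assms(1) exp_ge_add_one_self[of x] by (intro power_mono) auto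
  also have "\<dots> = exp (real n * x)" by (simp add: exp_of_nat_mult)
  also have "\<dots> \<le> 1 + real n * x + (real n * x)\<^sup>2" using assms by (intro exp_bound) auto
  also have "(real n * x)\<^sup>2 \<le> real n * x"
    using assms mult_left_le[of "real n * x" "real n * x"] by (simp add: power2_eq_square)
  finally show ?thesis by linarith
qed

context bounded_moments
begin

lemma prob_space_weight_law: "prob_space L" "sets L = sets borel"
proof -
  have h: "{1, 2} \<in> complete_edges n" using n2 by simp
  show "prob_space L" using prob_space_distr[OF weight_measurable[OF h]] weight_law[OF h] by simp
  show "sets L = sets borel" using weight_law[OF h] sets_distr by metis
qed

text \<open>Hypothesis (II) at \<open>y / 2\<close> transfers the weight quantile to the costs. For
  y = 0 it gives nothing, and positivity of the costs takes its place.\<close>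

lemma cheap_edge_prob:
  assumes c: "0 < c1" "0 < c2" and y: "0 \<le> y" "y = 0 \<or> cdf L (y / 2) \<le> z" and z: "0 \<le> z"
    and h: "h \<in> complete_edges n"
    and cmp: "\<And>x. 0 < x \<Longrightarrow> cdf L x \<ge> c1 * cdf (distr M borel (edge_cost r X W h)) (c2 * x)"
  shows "prob {\<omega> \<in> space M. edge_cost r X W h \<omega> \<le> c2 * (y / 2)} \<le> z / c1"
proof -
  have [measurable]: "edge_cost r X W h \<in> borel_measurable M" by (rule edge_cost_measurable[OF h])
  show ?thesis
  proof (cases "y = 0")
    case True
    have "AE \<omega> in M. \<not> edge_cost r X W h \<omega> \<le> 0"
      using AE_positive_weights[OF weight_pos] AE_space
    proof eventually_elim
      case (elim \<omega>)
      then show ?case using edge_cost_pos[OF elim h] by simp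
    qed
    then have "prob {\<omega> \<in> space M. edge_cost r X W h \<omega> \<le> 0} = 0" by (intro prob_eq_0_AE) auto
    then show ?thesis using True z c by simp
  next
    case False
    have "c1 * cdf (distr M borel (edge_cost r X W h)) (c2 * (y / 2)) \<le> z"
      using cmp[of "y / 2"] False y by simp
    moreover have "cdf (distr M borel (edge_cost r X W h)) (c2 * (y / 2))
        = prob {\<omega> \<in> space M. edge_cost r X W h \<omega> \<le> c2 * (y / 2)}"
      unfolding cdf_def by (subst measure_distr) (auto intro!: arg_cong[where f=prob])
    ultimately show ?thesis using c by (simp add: field_simps)
  qed
qed

text \<open>Each lower bound on \<open>lam\<close> has its main purpose: the first makes the cut
  terms a power of n, \<open>t\<close> serves the upper bounds, \<open>16 / c2\<close> the lower
  ones, \<open>4 * b0 / c1\<close> keeps the expected number of very cheap edges at a vertex below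
  1/4, \<open>17 + 16 * b0\<close> covers the failure probability, and the last serves the
  variance.\<close>

lemma mst_cost_estimates:
  fixes p a0 b0 c1 c2 \<gamma>0 \<gamma> lam t :: real
  assumes pick: "largest_component_rule n pick"
    and pos: "0 < a0" "0 < b0" "0 < c1" "0 < c2" "0 < \<gamma>" "0 < \<gamma>0" "\<gamma>0 < 1 / 2" "0 < t"
    and t: "B / t\<^sup>2 = (1 / 2 - \<gamma>0) / 4"
    and lam: "2 * (\<gamma> + 10) / a0 \<le> lam" "t \<le> lam" "16 / c2 \<le> lam" "4 * b0 / c1 \<le> lam"
      "17 + 16 * b0 \<le> lam" "t\<^sup>2 * (8 * b0 + 12) \<le> lam"
    and deg: "\<And>u A. u \<in> {1..n} \<Longrightarrow> A \<subseteq> {1..n} \<Longrightarrow> \<gamma>0 * real n \<le> real (card A) \<Longrightarrow>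
      a0 * real n * p \<le> (\<Sum>v\<in>A - {u}. q {u, v})"
    and total: "\<And>u. u \<in> {1..n} \<Longrightarrow> (\<Sum>v\<in>{1..n} - {u}. q {u, v}) \<le> b0 * real n * p"
    and cmp: "\<And>h x. h \<in> complete_edges n \<Longrightarrow> 0 < x \<Longrightarrow>
      cdf L x \<ge> c1 * cdf (distr M borel (edge_cost r X W h)) (c2 * x)"
    and p: "0 < p" "lam * ln (real n) / real n \<le> p" "lam * p \<le> 1 / 2"
    and N: "6 * real n * real n powr (- (\<gamma> + 10)) + real n * exp (2 - (1 / 2 - \<gamma>0) / 2 * real n)
        \<le> real n powr (- (\<gamma> + 7))" "2 + 2 * (B * (B + 1)) \<le> real n"
  defines "\<tau> \<equiv> mst_cost n pick r Z W X"
    and "\<zeta> \<equiv> inv_cdf L (1 / (lam * real n * p))"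
    and "\<phi> \<equiv> inv_cdf L (lam * ln (real n) / (real n * p))"
  shows "1 - lam * p \<le> prob {\<omega> \<in> space M. connected_graph {1..n} (random_edges n Z \<omega>) \<and>
        ennreal (real n / lam) * \<zeta> \<le> ennreal (\<tau> \<omega>) \<and> ennreal (\<tau> \<omega>) \<le> ennreal (lam * real n) * \<phi>}"
    and "ennreal (real n / lam) * \<zeta> \<le> ennreal (expectation \<tau>)"
    and "ennreal (expectation \<tau>) \<le> ennreal (lam * real n) * \<phi> + ennreal (1 / real n powr (1 + \<gamma>))"
    and "ennreal (variance \<tau>)
      \<le> ennreal (lam * (real n)\<^sup>2 * p) * \<phi>\<^sup>2 + ennreal (1 / real n powr (1 + \<gamma>))"
proof -
  have n: "2 \<le> real n" using n2 by simp
  have n1: "1 \<le> real n" and n0: "0 < real n" using n by auto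
  have lam17: "17 \<le> lam" and lam0: "0 < lam" using lam(5) pos(2) by auto
  have ln_n: "1 / 2 \<le> ln (real n)"
  proof -
    have "ln 2 \<le> ln (real n)" using n by simp
    then show ?thesis using ln2_ge_two_thirds by simp
  qed
  have lln: "1 \<le> lam * ln (real n)" using mult_mono[OF lam17 ln_n] lam0 by simp
  have np_ge: "lam * ln (real n) \<le> real n * p" using p(2) n0 by (simp add: field_simps)
  then have np1: "1 \<le> real n * p" using lln by linarith
  then have np0: "0 < real n * p" by simp
  have inv_n: "1 / real n \<le> p" using np1 n0 by (simp add: field_simps)
  \<comment> \<open>Four powers of n are spent on the second moment of the total cost, two on
    constants formed from B, and 1 + \<gamma> remain.\<close>
  define \<epsilon> where "\<epsilon> = real n powr (- (\<gamma> + 7))"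
  have \<epsilon>_inv: "\<epsilon> \<le> 1 / real n"
  proof -
    have "\<epsilon> \<le> real n powr (- 1)" unfolding \<epsilon>_def using n1 pos(5) by (intro powr_mono) auto
    then show ?thesis using n0 by (simp add: powr_minus_divide)
  qed
  have \<epsilon>0: "0 \<le> \<epsilon>" by (simp add: \<epsilon>_def)
  have \<epsilon>6: "real n ^ 6 * \<epsilon> = 1 / real n powr (1 + \<gamma>)"
  proof -
    have "real n ^ 6 * \<epsilon> = real n powr 6 * real n powr (- (\<gamma> + 7))" using n0 by (simp add: \<epsilon>_def)
    also have "\<dots> = real n powr (6 + - (\<gamma> + 7))" by (simp only: powr_add)
    also have "6 + - (\<gamma> + 7) = - (1 + \<gamma>)" by simp
    finally show ?thesis by (simp only: powr_minus_divide)
  qed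
  define z where "z = lam * ln (real n) / (real n * p)"
  have z0: "0 < z" unfolding z_def using lln np0 by (intro divide_pos_pos) auto
  have z1: "z \<le> 1" using np_ge np0 by (simp add: z_def)
  obtain y where y: "0 \<le> y" "z / 2 \<le> cdf L y" "ennreal y \<le> \<phi>"
    using inv_cdf_witness[OF prob_space_weight_law weight_pos z0 z1] by (auto simp: z_def \<phi>_def)
  \<comment> \<open>The factor that each vertex on the smaller side contributes to the bound for a
    cut; the halved z comes from \<open>inv_cdf_witness\<close>.\<close>
  define x where "x = exp (- (z / 2) * (a0 * real n * p))"
  have x_le: "x \<le> real n powr (- (\<gamma> + 10))"
  proof -
    \<comment> \<open>The np in the argument of \<phi> cancels here, so each vertex of a cut
      contributes a power of n whose exponent grows linearly in \<open>lam\<close>.\<close>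
    have "(z / 2) * (a0 * real n * p) = a0 * lam / 2 * ln (real n)"
      using n0 p(1) by (simp add: z_def field_simps)
    moreover have "\<gamma> + 10 \<le> a0 * lam / 2" using lam(1) pos(1) by (simp add: field_simps)
    then have "(\<gamma> + 10) * ln (real n) \<le> a0 * lam / 2 * ln (real n)" using ln_n by (intro mult_right_mono) auto
    ultimately have "(\<gamma> + 10) * ln (real n) \<le> z / 2 * (a0 * real n * p)" by linarith
    then have "- (z / 2) * (a0 * real n * p) \<le> - (\<gamma> + 10) * ln (real n)"
      unfolding mult_minus_left neg_le_iff_le .
    then show ?thesis using n0 by (simp only: x_def powr_def) simp
  qed
  have x0: "0 \<le> x" by (simp add: x_def)
  have nx: "real n * x \<le> 1"
  proof -
    have "real n * x \<le> real n * real n powr (- (\<gamma> + 10))" using x_le n0 by simp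
    also have "\<dots> = real n powr 1 * real n powr (- (\<gamma> + 10))" using n0 by simp
    also have "\<dots> = real n powr (1 + - (\<gamma> + 10))" by (simp only: powr_add)
    also have "\<dots> \<le> real n powr 0" using n1 pos(5) by (intro powr_mono) auto
    finally show ?thesis using n0 by simp
  qed
  have eps_bound: "exp 1 * ((1 + x) ^ n - 1) + real n * exp (2 - (1 / 2 - \<gamma>0) * real n + 2 * (B / t\<^sup>2) * real n) \<le> \<epsilon>"
  proof -
    have "exp 1 * ((1 + x) ^ n - 1) \<le> 3 * (2 * (real n * x))"
      using power_one_plus_le[OF x0 nx] exp_le x0 by (intro mult_mono) (auto simp: one_le_power)
    also have "\<dots> \<le> 6 * real n * real n powr (- (\<gamma> + 10))" using x_le n0 by simp
    finally have *: "exp 1 * ((1 + x) ^ n - 1) \<le> 6 * real n * real n powr (- (\<gamma> + 10))" .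
    \<comment> \<open>By the choice of t, the exponential moment of the costly marks uses up exactly
      half of the tolerance \<delta>n.\<close>
    have eq: "2 - (1 / 2 - \<gamma>0) * real n + 2 * (B / t\<^sup>2) * real n = 2 - (1 / 2 - \<gamma>0) / 2 * real n"
      unfolding t by (simp add: field_simps)
    show ?thesis using * N(1) unfolding \<epsilon>_def eq by linarith
  qed
  have a: "0 \<le> a0 * real n * p" using pos(1) p(1) by simp
  note bb = bad_bounds[where \<delta>="1 / 2 - \<gamma>0" and ?\<gamma>0.0=\<gamma>0, OF deg _ y(2) a pos(8), folded x_def, OF _ _ _ _ eps_bound]
  have E1: "expectation (bad y t) \<le> \<epsilon>" by (rule bb(1)) auto
  have E2: "expectation (\<lambda>\<omega>. (total_cost \<omega>)\<^sup>2 * bad y t \<omega>) \<le> real n ^ 4 * (B * (B + 1) * \<epsilon>)" by (rule bb(2)) auto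
  have t0: "0 \<le> t" using pos(8) by simp
  note setting = pick y(1) t0 E1 E2
  define z' where "z' = 1 / (lam * real n * p)"
  have lnp: "17 \<le> lam * real n * p"
    using mult_mono[OF lam17 np1] lam0 by (simp add: mult.assoc)
  then have z': "0 \<le> z'" "z' < 1" by (auto simp: z'_def)
  obtain yz where yz: "0 \<le> yz" "\<zeta> = ennreal yz" "yz = 0 \<or> cdf L (yz / 2) \<le> z'"
    using inv_cdf_half[OF prob_space_weight_law z'] by (auto simp: z'_def \<zeta>_def)
  define w where "w = c2 * (yz / 2)"
  have w0: "0 \<le> w" using yz pos by (simp add: w_def)
  define D where "D = b0 * real n * p"
  have D0: "0 \<le> D" using pos p by (simp add: D_def)
  \<comment> \<open>The np in D cancels the one in \<open>z'\<close>. This is the reason for the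
    argument 1/(lam n p) in \<zeta>.\<close>
  have D\<kappa>: "D * (z' / c1) \<le> 1 / 4"
  proof -
    have "D * (z' / c1) = b0 / (lam * c1)" using np0 lam0 pos p n0 by (simp add: D_def z'_def field_simps)
    also have "\<dots> \<le> 1 / 4" using lam(4) lam0 pos by (simp add: field_simps)
    finally show ?thesis .
  qed
  define \<rho> where "\<rho> = 64 * (D * (z' / c1) + D\<^sup>2 * (z' / c1)) / real n"
  have few: "prob {\<omega> \<in> space M. real n / 4 \<le> real (card {e \<in> complete_edges n. Z e \<omega> \<and> edge_cost r X W e \<omega> \<le> w})} \<le> \<rho>"
    unfolding \<rho>_def
  proof (rule few_cheap_edges[OF _ _ _ _ D\<kappa> D0])
    show "prob {\<omega> \<in> space M. edge_cost r X W e \<omega> \<le> w} \<le> z' / c1" if "e \<in> complete_edges n" for e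
      unfolding w_def by (rule cheap_edge_prob[OF pos(3,4) yz(1,3) z'(1) that cmp[OF that]])
  qed (use n2 total z' pos in \<open>auto simp: D_def\<close>)
  \<comment> \<open>In the term with D squared one factor D of order np survives and becomes p after
    division by n; the other term is a multiple of 1/n, which is at most p.\<close>
  have \<rho>: "\<rho> \<le> 16 * p + 16 * b0 * p"
  proof -
    have "D\<^sup>2 * (z' / c1) = D * (D * (z' / c1))" by (simp add: power2_eq_square)
    also have "\<dots> \<le> D * (1 / 4)" using D\<kappa> D0 by (rule mult_left_mono)
    finally have "\<rho> \<le> 64 * (1 / 4 + D / 4) / real n"
      unfolding \<rho>_def using D\<kappa> n0 by (intro divide_right_mono) auto
    also have "\<dots> = 16 * (1 / real n) + 16 * b0 * p" using n0 by (simp add: D_def field_simps)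
    finally show ?thesis using inv_n by simp
  qed
  have fail: "\<epsilon> + \<rho> \<le> lam * p"
  proof -
    have "\<epsilon> + \<rho> \<le> (17 + 16 * b0) * p" using \<epsilon>_inv inv_n \<rho> by (simp add: algebra_simps)
    also have "\<dots> \<le> lam * p" using lam(5) p(1) by (intro mult_right_mono) auto
    finally show ?thesis .
  qed
  have lower_const: "real n / lam * yz \<le> real n / 8 * w"
  proof -
    have "16 \<le> lam * c2" using lam(3) pos(4) by (simp add: field_simps)
    then have "1 / lam \<le> c2 / 16" using lam0 by (simp add: field_simps)
    then have "real n * yz * (1 / lam) \<le> real n * yz * (c2 / 16)" using yz(1) by (intro mult_left_mono) auto
    then show ?thesis by (simp add: w_def mult_ac)
  qed
  have \<zeta>_eq: "ennreal (real n / lam) * \<zeta> = ennreal (real n / lam * yz)"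
    unfolding yz(2) using yz(1) lam0 by (intro ennreal_mult[symmetric]) auto
  have upper: "ennreal (real n * (t * y)) \<le> ennreal (lam * real n) * \<phi>"
  proof -
    have "t * (real n * y) \<le> lam * (real n * y)" using lam(2) y(1) by (intro mult_right_mono) auto
    then have "ennreal (real n * (t * y)) \<le> ennreal (lam * real n * y)" by (intro ennreal_leI) (simp add: mult_ac)
    also have "\<dots> = ennreal (lam * real n) * ennreal y" using y lam0 by (simp add: ennreal_mult)
    also have "\<dots> \<le> ennreal (lam * real n) * \<phi>" using y(3) by (intro mult_left_mono) auto
    finally show ?thesis .
  qed
  have \<tau>m[measurable]: "\<tau> \<in> borel_measurable M" unfolding \<tau>_def by (rule mst_cost_measurable)
  note [measurable] = connected_pred
  have "1 - lam * p \<le> 1 - \<epsilon> - \<rho>" using fail by simp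
  also have "\<dots> \<le> prob {\<omega> \<in> space M. connected_graph {1..n} (random_edges n Z \<omega>) \<and>
      real n / 4 * w \<le> \<tau> \<omega> \<and> \<tau> \<omega> \<le> real n * (t * y)}"
    unfolding \<tau>_def by (rule mst_event[OF setting w0 few])
  also have "\<dots> \<le> prob {\<omega> \<in> space M. connected_graph {1..n} (random_edges n Z \<omega>) \<and>
        ennreal (real n / lam) * \<zeta> \<le> ennreal (\<tau> \<omega>) \<and> ennreal (\<tau> \<omega>) \<le> ennreal (lam * real n) * \<phi>}"
  proof (rule finite_measure_mono)
    show "{\<omega> \<in> space M. connected_graph {1..n} (random_edges n Z \<omega>) \<and>
        real n / 4 * w \<le> \<tau> \<omega> \<and> \<tau> \<omega> \<le> real n * (t * y)}
      \<subseteq> {\<omega> \<in> space M. connected_graph {1..n} (random_edges n Z \<omega>) \<and>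
        ennreal (real n / lam) * \<zeta> \<le> ennreal (\<tau> \<omega>) \<and> ennreal (\<tau> \<omega>) \<le> ennreal (lam * real n) * \<phi>}"
    proof safe
      fix \<omega> assume \<omega>: "real n / 4 * w \<le> \<tau> \<omega>" "\<tau> \<omega> \<le> real n * (t * y)"
      have "real n / 8 * w \<le> real n / 4 * w" using w0 by (intro mult_right_mono) auto
      then have "real n / lam * yz \<le> \<tau> \<omega>" using lower_const \<omega>(1) by linarith
      then show "ennreal (real n / lam) * \<zeta> \<le> ennreal (\<tau> \<omega>)" unfolding \<zeta>_eq by (rule ennreal_leI)
      show "ennreal (\<tau> \<omega>) \<le> ennreal (lam * real n) * \<phi>"
        by (rule order_trans[OF ennreal_leI[OF \<omega>(2)] upper])
    qed
  qed measurable
  finally show "1 - lam * p \<le> prob {\<omega> \<in> space M. connected_graph {1..n} (random_edges n Z \<omega>) \<and>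
        ennreal (real n / lam) * \<zeta> \<le> ennreal (\<tau> \<omega>) \<and> ennreal (\<tau> \<omega>) \<le> ennreal (lam * real n) * \<phi>}" .
  have "real n / 8 * w \<le> expectation \<tau>"
    unfolding \<tau>_def by (rule mst_expectation_lower[OF setting w0 few]) (use fail p(3) in linarith)
  then show "ennreal (real n / lam) * \<zeta> \<le> ennreal (expectation \<tau>)"
    unfolding \<zeta>_eq using lower_const by (intro ennreal_leI) linarith
  have n2sq: "real n \<le> (real n)\<^sup>2" using n1 by (simp add: power2_eq_square)
  have n46: "real n ^ 4 * (real n)\<^sup>2 = real n ^ 6" by (simp add: power_add[symmetric])
  have n4_ge: "1 \<le> real n ^ 4" using n1 by (rule one_le_power)
  have BB0: "0 \<le> B * (B + 1)" using B0 by simp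
  have BBn: "1 + B * (B + 1) \<le> (real n)\<^sup>2" "2 * (B * (B + 1)) \<le> (real n)\<^sup>2"
    using N(2) BB0 n2sq by linarith+
  have tail_mean: "\<epsilon> + real n ^ 4 * (B * (B + 1) * \<epsilon>) \<le> 1 / real n powr (1 + \<gamma>)"
  proof -
    have "\<epsilon> + real n ^ 4 * (B * (B + 1) * \<epsilon>) = (1 + real n ^ 4 * (B * (B + 1))) * \<epsilon>" by (simp add: algebra_simps)
    also have "\<dots> \<le> (real n ^ 4 * 1 + real n ^ 4 * (B * (B + 1))) * \<epsilon>"
      using n4_ge \<epsilon>0 by (intro mult_right_mono add_right_mono) auto
    also have "\<dots> = real n ^ 4 * (1 + B * (B + 1)) * \<epsilon>" by (simp add: algebra_simps)
    also have "\<dots> \<le> real n ^ 4 * (real n)\<^sup>2 * \<epsilon>"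
      using BBn(1) \<epsilon>0 by (intro mult_right_mono mult_left_mono) simp_all
    finally show ?thesis unfolding n46 \<epsilon>6 .
  qed
  have tail_var: "2 * (real n ^ 4 * (B * (B + 1) * \<epsilon>)) \<le> 1 / real n powr (1 + \<gamma>)"
  proof -
    have "2 * (real n ^ 4 * (B * (B + 1) * \<epsilon>)) = real n ^ 4 * (2 * (B * (B + 1))) * \<epsilon>" by simp
    also have "\<dots> \<le> real n ^ 4 * (real n)\<^sup>2 * \<epsilon>"
      using BBn(2) \<epsilon>0 by (intro mult_right_mono mult_left_mono) simp_all
    finally show ?thesis unfolding n46 \<epsilon>6 .
  qed
  have "expectation \<tau> \<le> real n * (t * y) + 1 / real n powr (1 + \<gamma>)"
    using mst_expectation_upper[OF setting] tail_mean unfolding \<tau>_def by linarith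
  then have "ennreal (expectation \<tau>) \<le> ennreal (real n * (t * y) + 1 / real n powr (1 + \<gamma>))" by (rule ennreal_leI)
  also have "\<dots> = ennreal (real n * (t * y)) + ennreal (1 / real n powr (1 + \<gamma>))"
    using t0 y(1) by (intro ennreal_plus) auto
  also have "\<dots> \<le> ennreal (lam * real n) * \<phi> + ennreal (1 / real n powr (1 + \<gamma>))"
    using upper by (rule add_right_mono)
  finally show "ennreal (expectation \<tau>) \<le> ennreal (lam * real n) * \<phi> + ennreal (1 / real n powr (1 + \<gamma>))" .
  define K where "K = t * y"
  have K0: "0 \<le> K" using t0 y by (simp add: K_def)
  \<comment> \<open>This exceeds 2D by np, which is at least 2 ln n, so the term with n cubed
    shrinks to at most n.\<close>
  define l where "l = (2 * b0 + 1) * (real n * p)"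
  have l0: "0 \<le> l" using pos np0 by (simp add: l_def)
  have n_le: "real n \<le> (real n)\<^sup>2 * p" using mult_left_mono[OF np1, of "real n"] by (simp add: power2_eq_square mult_ac)
  have "variance (\<lambda>\<omega>. min_connecting_cost n (capped_cost K \<omega>))
      \<le> K\<^sup>2 * (2 * real n * l + 2 * real n + real n ^ 3 * exp (2 * D - l))"
    by (rule variance_capped[OF _ K0 l0]) (use n2 total in \<open>auto simp: D_def\<close>)
  also have "\<dots> \<le> K\<^sup>2 * ((4 * b0 + 5) * ((real n)\<^sup>2 * p))"
  proof (intro mult_left_mono)
    have "2 * D - l = - (real n * p)" by (simp add: D_def l_def algebra_simps)
    also have "\<dots> \<le> - (2 * ln (real n))"
    proof -
      have "2 * ln (real n) \<le> lam * ln (real n)" using lam17 ln_n by (intro mult_right_mono) auto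
      then show ?thesis using np_ge by linarith
    qed
    finally have "exp (2 * D - l) \<le> exp (- (2 * ln (real n)))" by simp
    also have "\<dots> = 1 / (real n)\<^sup>2" using n0 by (simp add: exp_minus exp_double inverse_eq_divide)
    finally have "real n ^ 3 * exp (2 * D - l) \<le> real n ^ 3 * (1 / (real n)\<^sup>2)" by (intro mult_left_mono) auto
    also have "\<dots> = real n" using n0 by (simp add: power2_eq_square power3_eq_cube)
    finally have "2 * real n * l + 2 * real n + real n ^ 3 * exp (2 * D - l) \<le> 2 * real n * l + 3 * real n" by simp
    also have "\<dots> \<le> 2 * real n * l + 3 * ((real n)\<^sup>2 * p)" using n_le by simp
    also have "\<dots> = (4 * b0 + 5) * ((real n)\<^sup>2 * p)" by (simp add: l_def power2_eq_square algebra_simps)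
    finally show "2 * real n * l + 2 * real n + real n ^ 3 * exp (2 * D - l) \<le> (4 * b0 + 5) * ((real n)\<^sup>2 * p)" .
  qed simp
  finally have vc: "variance (\<lambda>\<omega>. min_connecting_cost n (capped_cost (t * y) \<omega>))
    \<le> K\<^sup>2 * ((4 * b0 + 5) * ((real n)\<^sup>2 * p))" unfolding K_def .
  \<comment> \<open>K has no polynomial bound in n, so the part of the capped minimum on the failure
    event goes into the main term and not into the tail.\<close>
  have "(real n * K)\<^sup>2 * \<epsilon> \<le> (real n * K)\<^sup>2 * (1 / real n)" using \<epsilon>_inv by (intro mult_left_mono) auto
  also have "\<dots> = K\<^sup>2 * real n" using n0 by (simp add: power2_eq_square)
  also have "\<dots> \<le> K\<^sup>2 * ((real n)\<^sup>2 * p)" using n_le by (intro mult_left_mono) auto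
  finally have vb: "(real n * (t * y))\<^sup>2 * \<epsilon> \<le> K\<^sup>2 * ((real n)\<^sup>2 * p)" unfolding K_def .
  have "variance \<tau> \<le> 2 * (K\<^sup>2 * ((4 * b0 + 5) * ((real n)\<^sup>2 * p))) + 2 * (K\<^sup>2 * ((real n)\<^sup>2 * p))
      + 1 / real n powr (1 + \<gamma>)"
  proof -
    have *: "v \<le> 2 * c' + 2 * e' + g" if "v \<le> 2 * c + 2 * (d + e)" "c \<le> c'" "e \<le> e'" "2 * d \<le> g"
      for v c c' d e e' g :: real using that by argo
    show ?thesis unfolding \<tau>_def by (rule *[OF mst_variance_upper[OF setting] vc vb tail_var])
  qed
  also have "2 * (K\<^sup>2 * ((4 * b0 + 5) * ((real n)\<^sup>2 * p))) + 2 * (K\<^sup>2 * ((real n)\<^sup>2 * p))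
      = t\<^sup>2 * (8 * b0 + 12) * ((real n)\<^sup>2 * p * y\<^sup>2)" by (simp add: K_def power_mult_distrib algebra_simps)
  also have "\<dots> \<le> lam * ((real n)\<^sup>2 * p * y\<^sup>2)" using lam(6) p(1) by (intro mult_right_mono) auto
  finally have "ennreal (variance \<tau>) \<le> ennreal (lam * ((real n)\<^sup>2 * p * y\<^sup>2) + 1 / real n powr (1 + \<gamma>))"
    by (intro ennreal_leI) simp
  also have "\<dots> = ennreal (lam * (real n)\<^sup>2 * p) * (ennreal y)\<^sup>2 + ennreal (1 / real n powr (1 + \<gamma>))"
    using lam0 p(1) y(1) by (subst ennreal_plus) (auto simp: ennreal_power ennreal_mult[symmetric] mult_ac)
  also have "\<dots> \<le> ennreal (lam * (real n)\<^sup>2 * p) * \<phi>\<^sup>2 + ennreal (1 / real n powr (1 + \<gamma>))"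
    using y(3) by (intro add_right_mono mult_left_mono power_mono) auto
  finally show "ennreal (variance \<tau>)
      \<le> ennreal (lam * (real n)\<^sup>2 * p) * \<phi>\<^sup>2 + ennreal (1 / real n powr (1 + \<gamma>))" .
qed

end

text \<open>The first term is of order n^(-(\<gamma>+9)) and the second is exponentially
  small.\<close>

lemma eventually_tail_bound:
  fixes \<gamma> \<delta> :: real
  assumes "0 < \<delta>"
  shows "\<forall>\<^sub>F n in sequentially. 6 * real n * real n powr (- (\<gamma> + 10)) + real n * exp (2 - \<delta> / 2 * real n)
      \<le> real n powr (- (\<gamma> + 7))"
  using assms by real_asymp

text \<open>The inequalities live in the extended nonnegative reals because \<phi> may be infinite.
  Integrability is part of the conclusion because the Bochner integral of a nonintegrable function
  is 0, which would make a bound on it meaningless. The choice of \<open>lam\<close> precedes all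
  sequences, so it does not depend on n or on the model.\<close>

theorem theorem4:
  fixes L :: "real measure" and S :: "'m measure"
    and a0 b0 \<gamma>0 B s c1 c2 :: real
  assumes "prob_space L" and "sets L = sets borel" and "AE x in L. 0 < x"
    and "0 < a0" and "0 < b0" and "0 < \<gamma>0" and "\<gamma>0 < 1 / 2"
    and "0 < B" and "2 \<le> s" and "0 < c1" and "0 < c2"
    and "(\<integral>\<^sup>+ x. ennreal (x powr s) \<partial>L) \<le> ennreal B"
  shows "\<forall>\<gamma>>0. \<exists>lam>0.
    \<forall>(p :: nat \<Rightarrow> real) (q :: nat \<Rightarrow> nat set \<Rightarrow> real) (r :: nat \<Rightarrow> 'm \<Rightarrow> 'm \<Rightarrow> real)
     (M :: nat \<Rightarrow> 'w measure) (Z :: nat \<Rightarrow> nat set \<Rightarrow> 'w \<Rightarrow> bool)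
     (W :: nat \<Rightarrow> nat set \<Rightarrow> 'w \<Rightarrow> real) (X :: nat \<Rightarrow> nat \<Rightarrow> 'w \<Rightarrow> 'm)
     (pick :: nat \<Rightarrow> nat set set \<Rightarrow> nat set).
      (\<forall>n\<ge>2. weighted_random_graph (M n) n (q n) L S (r n) (Z n) (W n) (X n)) \<longrightarrow>
      (\<forall>n\<ge>2. largest_component_rule n (pick n)) \<longrightarrow>
      (\<forall>n\<ge>2. 0 < p n \<and> p n < 1) \<longrightarrow>
      (\<forall>\<^sub>F n in sequentially. \<forall>u\<in>{1..n}. \<forall>A\<subseteq>{1..n}. \<gamma>0 * real n \<le> real (card A) \<longrightarrow>
         a0 * real n * p n \<le> (\<Sum>v\<in>A - {u}. q n {u, v}) \<and>
         (\<Sum>v\<in>A - {u}. q n {u, v}) \<le> (\<Sum>v\<in>{1..n} - {u}. q n {u, v}) \<and>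
         (\<Sum>v\<in>{1..n} - {u}. q n {u, v}) \<le> b0 * real n * p n) \<longrightarrow>
      (\<forall>n\<ge>2. \<forall>x\<in>space S. (\<integral>\<^sup>+ \<omega>. ennreal ((r n x (X n 1 \<omega>))\<^sup>2) \<partial>M n) \<le> ennreal B) \<longrightarrow>
      (\<forall>n\<ge>2. \<forall>h\<in>complete_edges n. \<forall>x>0.
         cdf L x \<ge> c1 * cdf (distr (M n) borel (edge_cost (r n) (X n) (W n) h)) (c2 * x)) \<longrightarrow>
      (\<forall>\<^sub>F n in sequentially. p n \<ge> lam * ln (real n) / real n) \<longrightarrow>
      p \<longlonglongrightarrow> 0 \<longrightarrow>
      (\<forall>\<^sub>F n in sequentially.
         let \<tau> = mst_cost n (pick n) (r n) (Z n) (W n) (X n);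
             \<zeta> = inv_cdf L (1 / (lam * real n * p n));
             \<phi> = inv_cdf L (lam * ln (real n) / (real n * p n))
         in measure (M n) {\<omega> \<in> space (M n).
                connected_graph {1..n} (random_edges n (Z n) \<omega>) \<and>
                ennreal (real n / lam) * \<zeta> \<le> ennreal (\<tau> \<omega>) \<and>
                ennreal (\<tau> \<omega>) \<le> ennreal (lam * real n) * \<phi>} \<ge> 1 - lam * p n \<and>
            integrable (M n) \<tau> \<and> integrable (M n) (\<lambda>\<omega>. (\<tau> \<omega>)\<^sup>2) \<and>
            ennreal (real n / lam) * \<zeta> \<le> ennreal (prob_space.expectation (M n) \<tau>) \<and>
            ennreal (prob_space.expectation (M n) \<tau>)
              \<le> ennreal (lam * real n) * \<phi> + ennreal (1 / real n powr (1 + \<gamma>)) \<and>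
            ennreal (prob_space.variance (M n) \<tau>)
              \<le> ennreal (lam * (real n)\<^sup>2 * p n) * \<phi>\<^sup>2 + ennreal (1 / real n powr (1 + \<gamma>)))"
proof (rule allI, rule impI, goal_cases)
  case (1 \<gamma>)
  note \<gamma> = 1
  define \<delta> where "\<delta> = 1 / 2 - \<gamma>0"
  have \<delta>: "0 < \<delta>" using assms(7) by (simp add: \<delta>_def)
  \<comment> \<open>By Markov's inequality for squares, a mark factor then exceeds t with
    probability at most \<delta>/4, well below the tolerated fraction \<delta>.\<close>
  define t where "t = sqrt (4 * B / \<delta>)"
  have t: "0 < t" "B / t\<^sup>2 = (1 / 2 - \<gamma>0) / 4"
    using assms(8) \<delta> by (auto simp: t_def \<delta>_def[symmetric])
  \<comment> \<open>The sum of the six thresholds; as all are nonnegative, it dominates each of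
    them.\<close>
  define lam where "lam = 2 * (\<gamma> + 10) / a0 + t + 16 / c2 + 4 * b0 / c1 + (17 + 16 * b0) + t\<^sup>2 * (8 * b0 + 12)"
  have nonneg: "0 \<le> 2 * (\<gamma> + 10) / a0" "0 \<le> t" "0 \<le> 16 / c2" "0 \<le> 4 * b0 / c1" "0 \<le> 17 + 16 * b0"
    "0 \<le> t\<^sup>2 * (8 * b0 + 12)"
    using \<gamma> assms t by auto
  have lam: "2 * (\<gamma> + 10) / a0 \<le> lam" "t \<le> lam" "16 / c2 \<le> lam" "4 * b0 / c1 \<le> lam"
    "17 + 16 * b0 \<le> lam" "t\<^sup>2 * (8 * b0 + 12) \<le> lam"
    using nonneg unfolding lam_def by linarith+
  have lam0: "0 < lam" using lam(2) t(1) by linarith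
  have tail: "\<forall>\<^sub>F n in sequentially. 6 * real n * real n powr (- (\<gamma> + 10))
      + real n * exp (2 - (1 / 2 - \<gamma>0) / 2 * real n) \<le> real n powr (- (\<gamma> + 7))"
    using eventually_tail_bound[OF \<delta>] by (simp add: \<delta>_def)
  have large: "\<forall>\<^sub>F n in sequentially. 2 + 2 * (B * (B + 1)) \<le> real n"
    by real_asymp
  show ?case
  proof (rule exI[of _ lam], intro conjI lam0 allI impI, goal_cases)
    case (1 p q r M Z W X pick)
    \<comment> \<open>Here p = o(1) enters: the good event must have probability at least 1/2 for
      the lower bound on the mean.\<close>
    have "\<forall>\<^sub>F n in sequentially. lam * p n < 1 / 2"
      using tendsto_mult_left[OF 1(8), of lam] by (intro order_tendstoD(2)[of _ "lam * 0"]) auto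
    with 1(4,7) tail large eventually_ge_at_top[of 2] show ?case
    proof eventually_elim
      case (elim n)
      have n: "2 \<le> n" by fact
      interpret weighted_random_graph "M n" n "q n" L S "r n" "Z n" "W n" "X n"
        using 1(1) n by blast
      interpret bounded_moments "M n" n "q n" L S "r n" "Z n" "W n" "X n" B s
        by unfold_locales (use 1(5) n assms in auto)
      have deg: "a0 * real n * p n \<le> (\<Sum>v\<in>A - {u}. q n {u, v})"
        if "u \<in> {1..n}" "A \<subseteq> {1..n}" "\<gamma>0 * real n \<le> real (card A)" for u A
        using elim(1) that by blast
      \<comment> \<open>The upper degree bound is stated along with an admissible set A, and the
        full vertex set is one.\<close>
      have full: "\<gamma>0 * real n \<le> real (card {1..n})"
        using assms(7) mult_right_mono[of \<gamma>0 1 "real n"] by simp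
      have total: "(\<Sum>v\<in>{1..n} - {u}. q n {u, v}) \<le> b0 * real n * p n" if "u \<in> {1..n}" for u
        using elim(1) that full by blast
      have pick: "largest_component_rule n (pick n)" using 1(2) n by blast
      note b = mst_cost_estimates[OF pick assms(4,5,10,11) \<gamma> assms(6,7) t lam deg total _ _ elim(2) _ elim(3,4)]
      show ?case
        unfolding Let_def
        by (intro conjI b mst_cost_integrable[OF pick])
          (use 1(3,6) n elim in \<open>auto intro: less_imp_le\<close>)
    qed
  qed
qed

end
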